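(* Let $\rho$ be a $g$-measure on $A^{\mathbb N}$ associated to $\phi=\log g$, and let $x_1^n$ be a sample path distributed according to $\rho$. Assume that the sequence of positive integers $(k(n))_{n\in\mathbb N}$ diverges and eventually satisfies $$k(n)\leq \frac{1-\epsilon}{\log|A|}\log n$$ for some $0<\epsilon<1$. Then the conditional empirical entropy $\hat h_{k(n)}(x_1^n)$ satisfies the following large deviation principle. For any closed set $C\subset\mathbb R$, $$\limsup_{n\to\infty}\frac1n\log\rho\{x_1^n:\hat h_{k(n)}(x_1^n)\in C\}\leq-\inf\{\mathbf I(u):u\in C\},$$ and for any open set $O\subset\mathbb R$, $$\liminf_{n\to\infty}\frac1n\log\rho\{x_1^n:\hat h_{k(n)}(x_1^n)\in O\}\geq-\inf\{\mathbf I(u):u\in O\},$$ where the rate function $\mathbf I$ is convex and is defined by $$\mathbf I(u)=\inf\{h(\nu|\rho):\nu\in\mathcal M_s,\ h(\nu)=u\}\ \text{ if } u\in[0,\log|A|],\qquad \mathbf I(u)=+\infty\ \text{ otherwise.}$$ The same large deviation principle (with the same rate function $\mathbf I$) holds if $\hat h_{k(n)}(x_1^n)$ is replaced by the rescaled empirical entropy $\frac{\hat H_{k(n)}(x_1^n)}{k(n)}$.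
   Context: $A$ is a finite alphabet; $a_1^k$ denotes the string $(a_1,\dots,a_k)\in A^k$; $T$ is the shift on $A^{\mathbb N}$, $Tx_1^\infty=x_2^\infty$; $[a_1^n]$ is the cylinder of infinite strings beginning with $a_1^n$. For a set $S$ of strings $x_1^n\in A^n$, $\rho(S)=\sum_{x_1^n\in S}\rho([x_1^n])$. $\mathcal M_s$ is the set of shift-invariant Borel probability measures on $A^{\mathbb N}$; $\mathbb E_\nu$ is expectation with respect to $\nu$; $h(\nu)$ is the Shannon-Kolmogorov-Sinai entropy of $\nu\in\mathcal M_s$. $g$-measures: $g:A^{\mathbb N}\to(0,1)$ is a continuous, strictly positive function with $\sum_{b_1^\infty:Tb_1^\infty=a_1^\infty}g(b_1^\infty)=1$ for all $a_1^\infty$; $\phi=\log g$. An equilibrium state of a continuous $\psi:A^{\mathbb N}\to\mathbb R$ is a measure in $\mathcal M_s$ attaining $\sup\{\mathbb E_\eta[\psi]+h(\eta):\eta\in\mathcal M_s\}$. A $g$-measure is an equilibrium state of $\phi=\log g$ (not assumed unique); $\rho$ is one fixed such measure. Relative entropy: for $\nu\in\mathcal M_s$, $h(\nu|\rho)=\lim_{k\to\infty}\frac1k\sum_{a_1^k}\nu([a_1^k])\log\frac{\nu([a_1^k])}{\rho([a_1^k])}=-\mathbb E_\nu[\phi]-h(\nu)$. Empirical entropies: for $x_1^n\in A^n$ let $\tilde x_1^\infty$ be its $n$-periodic extension $x_1^nx_1^nx_1^n\cdots$ and $\pi_k(a_1^k;x_1^n)=\frac1n\#\{1\le i\le n:\tilde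 x_i^{i+k-1}=a_1^k\}$. For a probability measure $\nu_k$ on $A^k$, with $\nu_{k-1}(a_1^{k-1})=\sum_b\nu_k(a_1^{k-1}b)$, let $H_k(\nu_k)=-\sum_{a_1^k}\nu_k(a_1^k)\log\nu_k(a_1^k)$, $H_0=0$, and $h_k(\nu_k)=H_k(\nu_k)-H_{k-1}(\nu_{k-1})$ (convention $0\log 0=0$). Then $\hat H_k(x_1^n)=H_k(\pi_k(\cdot;x_1^n))$ and $\hat h_k(x_1^n)=h_k(\pi_k(\cdot;x_1^n))$. *)

theory Defs
  imports "HOL-Probability.Probability"
begin

text \<open>
  The alphabet is a finite type \<open>'a\<close> with the discrete topology, and infinite strings are functions
  \<open>nat \<Rightarrow> 'a\<close> (positions start at 0) with the product topology. Finite strings are lists.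
\<close>

definition shift_map :: "(nat \<Rightarrow> 'a) \<Rightarrow> (nat \<Rightarrow> 'a)" where
  "shift_map x = (\<lambda>i. x (Suc i))"

definition cylinder :: "'a list \<Rightarrow> (nat \<Rightarrow> 'a) set" where
  "cylinder a = {x. \<forall>i<length a. x i = a ! i}"

definition strings :: "nat \<Rightarrow> 'a list set" where
  "strings n = {a. length a = n}"

definition string_measure :: "(nat \<Rightarrow> 'a) measure \<Rightarrow> 'a list set \<Rightarrow> real" where
  "string_measure \<rho> S = (\<Sum>a\<in>S. measure \<rho> (cylinder a))"

definition invariant_measures :: "(nat \<Rightarrow> 'a::topological_space) measure set" where
  "invariant_measures = {\<nu>. prob_space \<nu> \<and> sets \<nu> = sets borel \<and> distr \<nu> borel shift_map = \<nu>}"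


text \<open>Since \<open>ln 0 = 0\<close>, and since \<open>0\<close> absorbs, the convention \<open>0 log 0 = 0\<close> holds automatically below.\<close>

definition block_entropy :: "nat \<Rightarrow> ('a::finite list \<Rightarrow> real) \<Rightarrow> real" where
  "block_entropy k p = (if k = 0 then 0 else - (\<Sum>a\<in>strings k. p a * ln (p a)))"

definition marginal :: "('a::finite list \<Rightarrow> real) \<Rightarrow> 'a list \<Rightarrow> real" where
  "marginal p a = (\<Sum>b\<in>UNIV. p (a @ [b]))"

definition cond_block_entropy :: "nat \<Rightarrow> ('a::finite list \<Rightarrow> real) \<Rightarrow> real" where
  "cond_block_entropy k p = block_entropy k p - block_entropy (k - 1) (marginal p)"

text \<open>
  The Shannon-Kolmogorov-Sinai entropy of the shift, as the Shannon entropy rate of the process,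
  in the same form as the relative entropy. For invariant measures the limit exists.
\<close>

definition entropy :: "(nat \<Rightarrow> 'a::finite) measure \<Rightarrow> real" where
  "entropy \<nu> = lim (\<lambda>k. block_entropy k (\<lambda>a. measure \<nu> (cylinder a)) / real k)"

definition relative_entropy ::
  "(nat \<Rightarrow> 'a::finite) measure \<Rightarrow> (nat \<Rightarrow> 'a) measure \<Rightarrow> real" where
  "relative_entropy \<nu> \<rho> =
     lim (\<lambda>k. (1 / real k) * (\<Sum>a\<in>strings k. measure \<nu> (cylinder a) *
                 ln (measure \<nu> (cylinder a) / measure \<rho> (cylinder a))))"


definition g_function :: "((nat \<Rightarrow> 'a::{finite,discrete_topology}) \<Rightarrow> real) \<Rightarrow> bool" where
  "g_function g \<longleftrightarrow> continuous_on UNIV g \<and> (\<forall>x. 0 < g x \<and> g x < 1) \<and>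
     (\<forall>a. (\<Sum>b\<in>{b. shift_map b = a}. g b) = 1)"

definition equilibrium_state ::
  "((nat \<Rightarrow> 'a::{finite,discrete_topology}) \<Rightarrow> real) \<Rightarrow> (nat \<Rightarrow> 'a) measure \<Rightarrow> bool" where
  "equilibrium_state \<psi> \<nu> \<longleftrightarrow> \<nu> \<in> invariant_measures \<and>
     (\<forall>\<eta>\<in>invariant_measures.
        integral\<^sup>L \<eta> \<psi> + entropy \<eta> \<le> integral\<^sup>L \<nu> \<psi> + entropy \<nu>)"

definition g_measure ::
  "((nat \<Rightarrow> 'a::{finite,discrete_topology}) \<Rightarrow> real) \<Rightarrow> (nat \<Rightarrow> 'a) measure \<Rightarrow> bool" where
  "g_measure g \<rho> \<longleftrightarrow> g_function g \<and> equilibrium_state (\<lambda>x. ln (g x)) \<rho>"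


definition periodic_extension :: "'a list \<Rightarrow> nat \<Rightarrow> 'a" where
  "periodic_extension x i = x ! (i mod length x)"

text \<open>The block length is the length of the string argument \<open>a\<close>.\<close>

definition empirical :: "'a list \<Rightarrow> 'a list \<Rightarrow> real" where
  "empirical x a = real (card {i. i < length x \<and>
     map (periodic_extension x) [i..<i + length a] = a}) / real (length x)"

definition empirical_entropy :: "nat \<Rightarrow> 'a::finite list \<Rightarrow> real" where
  "empirical_entropy k x = block_entropy k (empirical x)"

definition cond_empirical_entropy :: "nat \<Rightarrow> 'a::finite list \<Rightarrow> real" where
  "cond_empirical_entropy k x = cond_block_entropy k (empirical x)"


text \<open>Logarithm with \<open>log 0 = -\<infinity>\<close>, used for probabilities.\<close>

definition ereal_ln :: "real \<Rightarrow> ereal" where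
  "ereal_ln p = (if p = 0 then -\<infinity> else ereal (ln p))"

definition large_deviation_principle ::
  "(nat \<Rightarrow> 'a) measure \<Rightarrow> (nat \<Rightarrow> 'a list \<Rightarrow> real) \<Rightarrow> (real \<Rightarrow> ereal) \<Rightarrow> bool" where
  "large_deviation_principle \<rho> F I \<longleftrightarrow>
     (\<forall>C. closed C \<longrightarrow>
        limsup (\<lambda>n. ereal (1 / real n) * ereal_ln (string_measure \<rho> {x \<in> strings n. F n x \<in> C}))
          \<le> - (INF u\<in>C. I u)) \<and>
     (\<forall>U. open U \<longrightarrow>
        liminf (\<lambda>n. ereal (1 / real n) * ereal_ln (string_measure \<rho> {x \<in> strings n. F n x \<in> U}))
          \<ge> - (INF u\<in>U. I u))"

definition rate_function ::
  "(nat \<Rightarrow> 'a::{finite,discrete_topology}) measure \<Rightarrow> real \<Rightarrow> ereal" where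
  "rate_function \<rho> u =
     (if u \<in> {0..ln (real CARD('a))}
      then INF \<nu>\<in>{\<nu> \<in> invariant_measures. entropy \<nu> = u}. ereal (relative_entropy \<nu> \<rho>)
      else \<infinity>)"

text \<open>The library's \<open>convex_on\<close> is for real-valued functions only. In \<open>ereal\<close>, \<open>0 * \<infinity> = 0\<close>.\<close>

definition ereal_convex :: "(real \<Rightarrow> ereal) \<Rightarrow> bool" where
  "ereal_convex I \<longleftrightarrow> (\<forall>u v s t. 0 \<le> s \<and> 0 \<le> t \<and> s + t = 1 \<longrightarrow>
     I (s * u + t * v) \<le> ereal s * I u + ereal t * I v)"

end

theory Submission
  imports Defs "HOL-Real_Asymp.Real_Asymp"
begin

text \<open>
  Write \<open>L a\<close> for the logarithm of the probability \<open>\<rho>\<close> of the cylinder of \<open>a\<close>. Two properties of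
  \<open>\<rho>\<close> carry the large deviation principle: every cylinder has positive probability, and \<open>L\<close> is almost
  additive, that is, \<open>L (a @ b) - L a - L b\<close> is bounded by a quantity that is sublinear in the length
  of \<open>a\<close>. For an invariant \<open>\<nu>\<close> the \<open>\<nu>\<close>-average of \<open>L\<close> over strings of length \<open>k\<close>, divided by \<open>k\<close>,
  then converges to a number \<open>e(\<nu>)\<close>, and the relative entropy of \<open>\<nu>\<close> is \<open>- h(\<nu>) - e(\<nu>)\<close>.
  Entropy and \<open>e\<close> are affine, so the rate function is convex.

  Almost additivity (\<open>almost_additive_equilibrium\<close>) comes from the variational principle. Strings of
  length \<open>N\<close>, weighted by products of values of \<open>g\<close>, can be concatenated independently to an invariant
  process whose entropy plus mean of \<open>ln g\<close> is nearly 0, so this sum is at least 0 for the equilibrium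
  state. Gibbs' inequality then leaves no room between the conditional probabilities of \<open>\<rho>\<close> and \<open>g\<close>,
  and \<open>g\<close> is uniformly continuous.

  Let \<open>h\<close> and \<open>H\<close> be the conditional and the block entropy of the empirical measure of \<open>k\<close>-blocks of a
  string of length \<open>n\<close>. The two statistics of the theorem, \<open>h\<close> and \<open>H / k\<close>, are the ends of the interval
  from \<open>h\<close> to \<open>H / k\<close>, and the principle holds for every statistic \<open>F\<close> with values in this interval.

  Upper bound. There are \<open>exp (o(n))\<close> empirical measures of \<open>k\<close>-blocks, because of the growth condition
  on \<open>k\<close>, and each is shared by at most \<open>exp (n h + o(n))\<close> strings (\<open>sum_le_type_count\<close>). Each string \<open>x\<close>
  yields an invariant measure with entropy exactly \<open>F x\<close> whose mean \<open>e\<close> is at least \<open>L x / n - o(1)\<close>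
  (\<open>invariant_measure_of_string\<close>): concatenate independent \<open>k\<close>-blocks with the law of the empirical
  measure, which gives entropy at least \<open>H / k\<close>, and mix with the periodic orbit of \<open>x\<close>, which has
  entropy 0. As \<open>h \<le> F x\<close>, the strings that share the empirical measure of \<open>x\<close> together have
  probability at most \<open>exp (n (F x + e + o(1)))\<close>, and \<open>F x + e\<close> is minus the relative entropy.

  Lower bound. Given \<open>\<nu>\<close> with entropy \<open>u\<close> in the open set, concatenations of typical sequences of
  \<open>N\<close>-blocks of \<open>\<nu>\<close> provide about \<open>exp (n u)\<close> strings of probability about \<open>exp (n e(\<nu>))\<close> with
  \<open>H / k \<le> u + \<delta>\<close> (\<open>typical_strings\<close>). By the counting bound only \<open>exp (n (u - \<delta>) + o(n))\<close>
  strings have \<open>h \<le> u - \<delta>\<close>, so nearly all of the strings so constructed have their statistic within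
  \<open>\<delta>\<close> of \<open>u\<close>.
\<close>


section \<open>Sums over strings\<close>

lemma strings_0 [simp]: "strings 0 = {[]}"
  by (auto simp: strings_def)

lemma length_strings: "a \<in> strings n \<Longrightarrow> length a = n"
  by (simp add: strings_def)

lemma finite_strings [simp]: "finite (strings n :: 'a::finite list set)"
  using finite_lists_length_eq[of "UNIV :: 'a set" n] by (simp add: strings_def)

lemma card_strings: "card (strings n :: 'a::finite list set) = CARD('a) ^ n"
  using card_lists_length_eq[of "UNIV :: 'a set" n] by (simp add: strings_def)

lemma le_sum_strings:
  fixes f :: "'a::finite list \<Rightarrow> real"
  assumes "\<And>b. 0 \<le> f b" shows "f a \<le> (\<Sum>b\<in>strings (length a). f b)"
proof (rule member_le_sum)
  show "a \<in> strings (length a)" by (simp add: strings_def)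
qed (use assms in auto)

lemma sum_strings_append:
  fixes f :: "'a::finite list \<Rightarrow> 'b::comm_monoid_add"
  shows "(\<Sum>a\<in>strings (m + n). f a) = (\<Sum>a\<in>strings m. \<Sum>b\<in>strings n. f (a @ b))"
proof -
  have "(\<Sum>a\<in>strings m. \<Sum>b\<in>strings n. f (a @ b)) = (\<Sum>(a,b)\<in>strings m \<times> strings n. f (a @ b))"
    by (simp add: sum.cartesian_product)
  also have "\<dots> = (\<Sum>a\<in>strings (m + n). f a)"
    by (rule sum.reindex_bij_witness[where i = "\<lambda>c. (take m c, drop m c)" and j = "\<lambda>(a,b). a @ b"])
       (auto simp: strings_def)
  finally show ?thesis by simp
qed

lemma sum_strings_1:
  fixes f :: "'a::finite list \<Rightarrow> 'b::comm_monoid_add"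
  shows "(\<Sum>a\<in>strings (Suc 0). f a) = (\<Sum>b\<in>UNIV. f [b])"
  by (rule sum.reindex_bij_witness[where i = "\<lambda>b. [b]" and j = hd])
     (auto simp: strings_def length_Suc_conv)

lemma sum_strings_Cons:
  fixes f :: "'a::finite list \<Rightarrow> 'b::comm_monoid_add"
  shows "(\<Sum>a\<in>strings (Suc n). f a) = (\<Sum>b\<in>UNIV. \<Sum>a\<in>strings n. f (b # a))"
  using sum_strings_append[of f 1 n] by (simp add: sum_strings_1)

lemma sum_strings_snoc:
  fixes f :: "'a::finite list \<Rightarrow> 'b::comm_monoid_add"
  shows "(\<Sum>a\<in>strings (Suc n). f a) = (\<Sum>a\<in>strings n. \<Sum>b\<in>UNIV. f (a @ [b]))"
  using sum_strings_append[of f n 1] by (simp add: sum_strings_1)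


section \<open>Gibbs' inequality\<close>

text \<open>
  This is \<open>ln t \<le> 2 * (sqrt t - 1)\<close> at \<open>t = q / p\<close>. The bound \<open>ln t \<le> t - 1\<close> would lose the square,
  which is what makes a small relative entropy force two distributions to be close.
\<close>

lemma mult_ln_div_ge_hellinger:
  fixes p q :: real
  assumes "0 \<le> p" "0 \<le> q" "q = 0 \<Longrightarrow> p = 0"
  shows "p - q + (sqrt p - sqrt q)\<^sup>2 \<le> p * (ln p - ln q)"
proof (cases "p = 0")
  case True
  then show ?thesis using assms by simp
next
  case False
  then have pos: "p > 0" "q > 0" using assms by fastforce+
  have "ln (sqrt q / sqrt p) \<le> sqrt q / sqrt p - 1"
    using pos by (intro ln_le_minus_one) auto
  moreover have "ln (sqrt q / sqrt p) = (ln q - ln p) / 2"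
    using pos by (simp add: ln_div ln_sqrt diff_divide_distrib)
  ultimately have "2 * (1 - sqrt q / sqrt p) \<le> ln p - ln q" by simp
  then have "p * (2 * (1 - sqrt q / sqrt p)) \<le> p * (ln p - ln q)"
    using pos by (intro mult_left_mono) auto
  moreover have "p * (2 * (1 - sqrt q / sqrt p)) = 2 * p - 2 * (sqrt p * sqrt q)"
  proof -
    have "p * (sqrt q / sqrt p) = sqrt p * sqrt q"
      using pos by (simp add: field_simps)
    moreover have "p * (2 * (1 - sqrt q / sqrt p)) = 2 * p - 2 * (p * (sqrt q / sqrt p))"
      by (simp add: right_diff_distrib)
    ultimately show ?thesis by simp
  qed
  moreover have "(sqrt p - sqrt q)\<^sup>2 = p + q - 2 * (sqrt p * sqrt q)"
    using pos by (simp add: power2_diff)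
  ultimately show ?thesis by simp
qed

text \<open>
  As \<open>ln 0 = 0\<close>, absolute continuity has to be assumed where the relative entropy would be infinite.
\<close>

lemma gibbs:
  fixes p q :: "'b \<Rightarrow> real"
  assumes "\<And>a. a \<in> S \<Longrightarrow> 0 \<le> p a" "\<And>a. a \<in> S \<Longrightarrow> 0 \<le> q a"
    and "\<And>a. a \<in> S \<Longrightarrow> q a = 0 \<Longrightarrow> p a = 0" and "sum q S \<le> sum p S"
  shows "(\<Sum>a\<in>S. p a * ln (q a)) \<le> (\<Sum>a\<in>S. p a * ln (p a))"
proof -
  have "0 \<le> (\<Sum>a\<in>S. p a - q a)" using assms(4) by (simp add: sum_subtractf)
  also have "\<dots> \<le> (\<Sum>a\<in>S. p a * (ln (p a) - ln (q a)))"
  proof (rule sum_mono)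
    fix a assume "a \<in> S"
    with assms mult_ln_div_ge_hellinger[of "p a" "q a"]
    show "p a - q a \<le> p a * (ln (p a) - ln (q a))"
      by (smt (verit) zero_le_power2)
  qed
  finally show ?thesis by (simp add: right_diff_distrib sum_subtractf)
qed


section \<open>Cesaro means\<close>

lemma cesaro_mean_tendsto:
  fixes a :: "nat \<Rightarrow> real"
  assumes "a \<longlonglongrightarrow> L"
  shows "(\<lambda>n. (\<Sum>i<n. a i) / real n) \<longlonglongrightarrow> L"
proof (rule LIMSEQ_I)
  fix e :: real assume e: "e > 0"
  from LIMSEQ_D[OF assms half_gt_zero[OF e]] obtain N where N: "\<And>n. n \<ge> N \<Longrightarrow> \<bar>a n - L\<bar> < e/2"
    by auto
  define B where "B = (\<Sum>i<N. \<bar>a i - L\<bar>)"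
  have B0: "B \<ge> 0" by (simp add: B_def sum_nonneg)
  obtain N2 :: nat where N2: "real N2 > 2 * B / e" using reals_Archimedean2 by blast
  show "\<exists>no. \<forall>n\<ge>no. norm ((\<Sum>i<n. a i) / real n - L) < e"
  proof (intro exI[of _ "Suc (max N N2)"] allI impI)
    fix n assume n: "Suc (max N N2) \<le> n"
    then have n0: "real n > 0" by simp
    have "(\<Sum>i<n. a i) / real n - L = (\<Sum>i<n. a i - L) / real n"
      using n0 by (simp add: sum_subtractf field_simps)
    then have "\<bar>(\<Sum>i<n. a i) / real n - L\<bar> \<le> (\<Sum>i<n. \<bar>a i - L\<bar>) / real n"
      using n0 sum_abs[of "\<lambda>i. a i - L" "{..<n}"] by (simp add: divide_right_mono)
    also have eq: "{..<n} = {..<N} \<union> {N..<n}" using n by auto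
    also have "(\<Sum>i\<in>{..<N} \<union> {N..<n}. \<bar>a i - L\<bar>) = B + (\<Sum>i\<in>{N..<n}. \<bar>a i - L\<bar>)"
      unfolding B_def by (rule sum.union_disjoint) auto
    also have "(\<Sum>i\<in>{N..<n}. \<bar>a i - L\<bar>) \<le> (\<Sum>i\<in>{N..<n}. e/2)"
      by (intro sum_mono less_imp_le[OF N]) auto
    also have "\<dots> \<le> real n * (e/2)" using e by (simp add: mult_right_mono)
    finally have "\<bar>(\<Sum>i<n. a i) / real n - L\<bar> \<le> (B + real n * (e/2)) / real n"
      using n0 eq by (simp add: divide_right_mono)
    moreover have "B < e / 2 * real n"
    proof -
      have "B < e/2 * real N2" using N2 e by (simp add: field_simps)
      also have "\<dots> \<le> e/2 * real n" using n e by (intro mult_left_mono) auto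
      finally show ?thesis .
    qed
    then have "(B + real n * (e/2)) / real n < e" using n0 by (simp add: field_simps)
    ultimately show "norm ((\<Sum>i<n. a i) / real n - L) < e" by simp
  qed
qed


section \<open>Stationary string functions and their entropy\<close>

text \<open>
  The cylinder probabilities of shift-invariant measures. Consistency on the right characterises
  the functions that come from a measure, and consistency on the left expresses its invariance.
  Empirical measures, block processes and mixtures are handled as functions of this kind.
\<close>

definition stationary :: "('a::finite list \<Rightarrow> real) \<Rightarrow> bool" where
  "stationary p \<longleftrightarrow> p [] = 1 \<and> (\<forall>a. 0 \<le> p a) \<and>
     (\<forall>a. (\<Sum>b\<in>UNIV. p (a @ [b])) = p a) \<and> (\<forall>a. (\<Sum>b\<in>UNIV. p (b # a)) = p a)"

lemma stationary_nonneg: "stationary p \<Longrightarrow> 0 \<le> p a"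
  and stationary_Nil: "stationary p \<Longrightarrow> p [] = 1"
  and stationary_snoc: "stationary p \<Longrightarrow> (\<Sum>b\<in>UNIV. p (a @ [b])) = p a"
  and stationary_Cons: "stationary p \<Longrightarrow> (\<Sum>b\<in>UNIV. p (b # a)) = p a"
  by (simp_all add: stationary_def)

lemma stationary_append_right:
  assumes "stationary p" shows "(\<Sum>b\<in>strings n. p (a @ b)) = p a"
proof (induction n)
  case (Suc n)
  have "(\<Sum>b\<in>strings (Suc n). p (a @ b)) = (\<Sum>b\<in>strings n. \<Sum>c\<in>UNIV. p ((a @ b) @ [c]))"
    by (simp add: sum_strings_snoc)
  with Suc show ?case by (simp only: stationary_snoc[OF assms])
qed simp

lemma stationary_append_left:
  assumes "stationary p" shows "(\<Sum>b\<in>strings n. p (b @ a)) = p a"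
proof (induction n)
  case (Suc n)
  have "(\<Sum>b\<in>strings (Suc n). p (b @ a)) = (\<Sum>c\<in>UNIV. \<Sum>b\<in>strings n. p (c # b @ a))"
    by (simp add: sum_strings_Cons)
  also have "\<dots> = (\<Sum>b\<in>strings n. \<Sum>c\<in>UNIV. p (c # b @ a))" by (rule sum.swap)
  finally show ?case using Suc by (simp only: stationary_Cons[OF assms])
qed simp

lemma stationary_sum:
  assumes "stationary p" shows "(\<Sum>a\<in>strings n. p a) = 1"
  using stationary_append_right[OF assms, where n = n and a = "[]"] assms by (simp add: stationary_Nil)

lemma stationary_le_right:
  assumes "stationary p" shows "p (a @ b) \<le> p a"
proof -
  have "p (a @ b) \<le> (\<Sum>b\<in>strings (length b). p (a @ b))"
    by (rule le_sum_strings) (rule stationary_nonneg[OF assms])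
  then show ?thesis by (simp add: stationary_append_right[OF assms])
qed

lemma stationary_le_left:
  assumes "stationary p" shows "p (a @ b) \<le> p b"
proof -
  have "p (a @ b) \<le> (\<Sum>a\<in>strings (length a). p (a @ b))"
    by (rule le_sum_strings[where f = "\<lambda>a. p (a @ b)"]) (rule stationary_nonneg[OF assms])
  then show ?thesis by (simp add: stationary_append_left[OF assms])
qed

lemma stationary_le_1: "stationary p \<Longrightarrow> p a \<le> 1"
  using stationary_le_right[of p "[]" a] by (simp add: stationary_Nil)

lemma stationary_marginal: "stationary p \<Longrightarrow> marginal p = p"
  by (auto simp: marginal_def stationary_snoc)

lemma block_entropy_stationary:
  "stationary p \<Longrightarrow> block_entropy k p = - (\<Sum>a\<in>strings k. p a * ln (p a))"
  by (auto simp: block_entropy_def stationary_Nil)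

lemma cond_block_entropy_stationary:
  "stationary p \<Longrightarrow> cond_block_entropy k p = block_entropy k p - block_entropy (k - 1) p"
  by (simp add: cond_block_entropy_def stationary_marginal)

lemma block_entropy_0: "block_entropy 0 p = 0"
  by (simp add: block_entropy_def)

text \<open>
  The choice of \<open>q\<close> is the choice of a code: uniform, Markov, or adapted to a block structure.
\<close>

lemma block_entropy_le_cross_entropy:
  assumes p: "stationary p" and q: "\<And>a. a \<in> strings k \<Longrightarrow> 0 \<le> q a"
    "\<And>a. a \<in> strings k \<Longrightarrow> q a = 0 \<Longrightarrow> p a = 0" "(\<Sum>a\<in>strings k. q a) \<le> 1"
  shows "block_entropy k p \<le> - (\<Sum>a\<in>strings k. p a * ln (q a))"
  unfolding block_entropy_stationary[OF p]
  using gibbs[of "strings k" p q] q by (simp add: stationary_nonneg[OF p] stationary_sum[OF p])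

lemma block_entropy_nonneg:
  assumes "stationary p" shows "0 \<le> block_entropy k p"
proof -
  have "(\<Sum>a\<in>strings k. p a * ln (p a)) \<le> 0"
  proof (intro sum_nonpos mult_nonneg_nonpos stationary_nonneg[OF assms])
    fix a show "ln (p a) \<le> 0"
      using stationary_nonneg[OF assms, of a] stationary_le_1[OF assms, of a] by (cases "p a = 0") auto
  qed
  then show ?thesis by (simp add: block_entropy_stationary[OF assms])
qed

lemma block_entropy_le:
  fixes p :: "'a::finite list \<Rightarrow> real"
  assumes "stationary p" shows "block_entropy k p \<le> real k * ln (real CARD('a))"
proof -
  have "block_entropy k p \<le> - (\<Sum>a\<in>strings k. p a * ln (1 / real CARD('a) ^ k))"
    by (rule block_entropy_le_cross_entropy[OF assms]) (auto simp: card_strings)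
  also have "\<dots> = real k * ln (real CARD('a))"
    by (subst sum_distrib_right[symmetric]) (simp add: stationary_sum[OF assms] ln_div ln_realpow)
  finally show ?thesis .
qed

lemma block_entropy_mono_Suc:
  assumes "stationary p" shows "block_entropy k p \<le> block_entropy (Suc k) p"
proof -
  have "(\<Sum>a\<in>strings (Suc k). p a * ln (p a)) \<le> (\<Sum>a\<in>strings k. \<Sum>b\<in>UNIV. p (a @ [b]) * ln (p a))"
    unfolding sum_strings_snoc
  proof (intro sum_mono)
    fix a b
    show "p (a @ [b]) * ln (p (a @ [b])) \<le> p (a @ [b]) * ln (p a)"
      using stationary_nonneg[OF assms, of "a @ [b]"] stationary_le_right[OF assms, of a "[b]"]
      by (cases "p (a @ [b]) = 0") (auto intro!: mult_left_mono)
  qed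
  also have "\<dots> = (\<Sum>a\<in>strings k. p a * ln (p a))"
    by (simp flip: sum_distrib_right add: stationary_snoc[OF assms])
  finally show ?thesis by (simp add: block_entropy_stationary[OF assms])
qed

text \<open>
  Strong subadditivity: this is Gibbs' inequality against the distribution under which the first
  and the last letter of a string are conditionally independent given the letters in between.
\<close>

lemma cond_entropy_antimono:
  fixes p :: "'a::finite list \<Rightarrow> real"
  assumes p: "stationary p"
  shows "block_entropy (Suc (Suc k)) p - block_entropy (Suc k) p
       \<le> block_entropy (Suc k) p - block_entropy k p"
proof -
  note nn = stationary_nonneg[OF p]
  define m where "m = (\<lambda>w::'a list. butlast (tl w))"
  define q where "q w = p (butlast w) * p (tl w) / p (m w)" for w
  have split: "(\<Sum>w\<in>strings (Suc (Suc k)). f w) =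
      (\<Sum>a\<in>strings k. \<Sum>c\<in>UNIV. \<Sum>b\<in>UNIV. f (c # a @ [b]))" for f :: "'a list \<Rightarrow> real"
    unfolding sum_strings_Cons[of f "Suc k"] sum_strings_snoc[of _ k] by (rule sum.swap)
  have split': "(\<Sum>w\<in>strings (Suc (Suc k)). f w) =
      (\<Sum>a\<in>strings k. \<Sum>b\<in>UNIV. \<Sum>c\<in>UNIV. f (c # a @ [b]))" for f :: "'a list \<Rightarrow> real"
    unfolding split by (rule sum.cong[OF refl], rule sum.swap)
  have le1: "p (c # a @ [b]) \<le> p (c # a)" for a b c using stationary_le_right[OF p, of "c # a" "[b]"] by simp
  have le2: "p (c # a @ [b]) \<le> p (a @ [b])" for a b c using stationary_le_left[OF p, of "[c]" "a @ [b]"] by simp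
  have le3: "p (a @ [b]) \<le> p a" for a b using stationary_le_right[OF p, of a "[b]"] by simp
  have sumq: "(\<Sum>w\<in>strings (Suc (Suc k)). q w) \<le> 1"
  proof -
    have "(\<Sum>w\<in>strings (Suc (Suc k)). q w) = (\<Sum>a\<in>strings k. \<Sum>c\<in>UNIV. \<Sum>b\<in>UNIV. p (c # a) * p (a @ [b]) / p a)"
      unfolding split by (simp add: q_def m_def butlast_append)
    also have "\<dots> = (\<Sum>a\<in>strings k. p a * p a / p a)"
    proof (rule sum.cong[OF refl])
      fix a
      have "(\<Sum>c\<in>UNIV. \<Sum>b\<in>UNIV. p (c # a) * p (a @ [b]) / p a)
          = (\<Sum>c\<in>UNIV. p (c # a)) * (\<Sum>b\<in>UNIV. p (a @ [b])) / p a"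
        unfolding sum_product sum_divide_distrib ..
      then show "(\<Sum>c\<in>UNIV. \<Sum>b\<in>UNIV. p (c # a) * p (a @ [b]) / p a) = p a * p a / p a"
        by (simp only: stationary_snoc[OF p] stationary_Cons[OF p])
    qed
    also have "\<dots> = 1" using stationary_sum[OF p, of k] by simp
    finally show ?thesis by simp
  qed
  have "block_entropy (Suc (Suc k)) p \<le> - (\<Sum>w\<in>strings (Suc (Suc k)). p w * ln (q w))"
  proof (rule block_entropy_le_cross_entropy[OF p _ _ sumq])
    fix w :: "'a list" assume w: "w \<in> strings (Suc (Suc k))"
    show "0 \<le> q w" by (simp add: q_def nn)
    from w obtain c a b where [simp]: "w = c # a @ [b]"
      by (metis length_strings length_Suc_conv length_Suc_conv_rev)
    show "q w = 0 \<Longrightarrow> p w = 0"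
      using le1[of c a b] le2[of c a b] le3[of a b] nn[of "c # a @ [b]"]
      by (auto simp: q_def m_def butlast_append)
  qed
  also have "(\<Sum>w\<in>strings (Suc (Suc k)). p w * ln (q w)) =
     (\<Sum>w\<in>strings (Suc (Suc k)). p w * ln (p (butlast w)) + p w * ln (p (tl w)) - p w * ln (p (m w)))"
  proof (rule sum.cong[OF refl])
    fix w :: "'a list" assume w: "w \<in> strings (Suc (Suc k))"
    from w obtain c a b where [simp]: "w = c # a @ [b]"
      by (metis length_strings length_Suc_conv length_Suc_conv_rev)
    show "p w * ln (q w) = p w * ln (p (butlast w)) + p w * ln (p (tl w)) - p w * ln (p (m w))"
    proof (cases "p w = 0")
      case False
      then have "p (c # a @ [b]) > 0" using nn[of w] by simp
      then have "p (c # a) > 0" "p (a @ [b]) > 0" "p a > 0"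
        using le1[of c a b] le2[of c a b] le3[of a b] by auto
      then show ?thesis
        by (simp add: q_def m_def butlast_append ln_mult ln_div algebra_simps)
    qed simp
  qed
  also have "\<dots> = (\<Sum>w\<in>strings (Suc (Suc k)). p w * ln (p (butlast w)))
      + (\<Sum>w\<in>strings (Suc (Suc k)). p w * ln (p (tl w))) - (\<Sum>w\<in>strings (Suc (Suc k)). p w * ln (p (m w)))"
    by (simp add: sum.distrib sum_subtractf)
  also have "(\<Sum>w\<in>strings (Suc (Suc k)). p w * ln (p (butlast w))) = - block_entropy (Suc k) p"
    unfolding sum_strings_snoc[of _ "Suc k"] block_entropy_stationary[OF p]
    by (simp flip: sum_distrib_right add: stationary_snoc[OF p])
  also have "(\<Sum>w\<in>strings (Suc (Suc k)). p w * ln (p (tl w))) = - block_entropy (Suc k) p"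
    unfolding block_entropy_stationary[OF p]
    by (subst sum_strings_Cons, subst sum.swap)
       (simp flip: sum_distrib_right add: stationary_Cons[OF p])
  also have "(\<Sum>w\<in>strings (Suc (Suc k)). p w * ln (p (m w))) = - block_entropy k p"
    unfolding block_entropy_stationary[OF p] split'
    by (simp flip: sum_distrib_right add: m_def stationary_Cons[OF p] stationary_snoc[OF p])
  finally show ?thesis by simp
qed

definition entropy_rate :: "('a::finite list \<Rightarrow> real) \<Rightarrow> real" where
  "entropy_rate p = lim (\<lambda>k. block_entropy k p / real k)"

lemma entropy_eq_entropy_rate: "entropy \<nu> = entropy_rate (\<lambda>a. measure \<nu> (cylinder a))"
  by (simp add: entropy_def entropy_rate_def)

context
  fixes p :: "'a::finite list \<Rightarrow> real"
  assumes p: "stationary p"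
begin

lemma decseq_cond_entropy: "decseq (\<lambda>k. block_entropy (Suc k) p - block_entropy k p)"
  using cond_entropy_antimono[OF p] by (auto intro!: decseq_SucI)

lemma cond_entropy_nonneg: "0 \<le> block_entropy (Suc k) p - block_entropy k p"
  using block_entropy_mono_Suc[OF p, of k] by simp

lemma cond_entropy_sum: "(\<Sum>i<k. block_entropy (Suc i) p - block_entropy i p) = block_entropy k p"
  by (subst sum_lessThan_telescope) (simp add: block_entropy_0)

text \<open>
  The block entropy is the sum of the entropies of each letter given the preceding ones. These
  decrease to a limit, which is also the limit of their Cesaro means.
\<close>

lemma entropy_rate_limits:
  "(\<lambda>k. block_entropy k p / real k) \<longlonglongrightarrow> entropy_rate p"
  "entropy_rate p \<le> block_entropy (Suc k) p - block_entropy k p"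
proof -
  obtain L where L: "(\<lambda>k. block_entropy (Suc k) p - block_entropy k p) \<longlonglongrightarrow> L"
      and le: "\<And>k. L \<le> block_entropy (Suc k) p - block_entropy k p"
    using decseq_convergent[OF decseq_cond_entropy] cond_entropy_nonneg by blast
  have *: "(\<lambda>k. block_entropy k p / real k) \<longlonglongrightarrow> L"
    using cesaro_mean_tendsto[OF L] unfolding cond_entropy_sum by simp
  then have "entropy_rate p = L" unfolding entropy_rate_def by (rule limI)
  with * le show "(\<lambda>k. block_entropy k p / real k) \<longlonglongrightarrow> entropy_rate p"
    "entropy_rate p \<le> block_entropy (Suc k) p - block_entropy k p" by auto
qed

lemma cond_block_entropy_le_mean:
  assumes "0 < k" shows "block_entropy k p - block_entropy (k - 1) p \<le> block_entropy k p / real k"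
proof -
  have k: "Suc (k - 1) = k" using assms by simp
  have "real k * (block_entropy (Suc (k-1)) p - block_entropy (k - 1) p)
      = (\<Sum>i<k. block_entropy (Suc (k-1)) p - block_entropy (k - 1) p)"
    by (simp only: sum_constant card_lessThan)
  also have "\<dots> \<le> (\<Sum>i<k. block_entropy (Suc i) p - block_entropy i p)"
    by (intro sum_mono decseqD[OF decseq_cond_entropy]) auto
  also have "\<dots> = block_entropy k p" by (rule cond_entropy_sum)
  finally show ?thesis using assms unfolding k by (simp add: field_simps)
qed

lemma entropy_rate_le_mean: "0 < k \<Longrightarrow> entropy_rate p \<le> block_entropy k p / real k"
  using entropy_rate_limits(2)[of "k - 1"] cond_block_entropy_le_mean[of k] by simp

lemma entropy_rate_nonneg: "0 \<le> entropy_rate p"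
  by (rule LIMSEQ_le_const[OF entropy_rate_limits(1)]) (auto simp: block_entropy_nonneg[OF p])

lemma entropy_rate_le: "entropy_rate p \<le> ln (real CARD('a))"
  using entropy_rate_le_mean[of 1] block_entropy_le[OF p, of 1] by simp

end

lemma stationary_mixture:
  assumes "stationary p" "stationary q" "0 \<le> s" "0 \<le> t" "s + t = (1::real)"
  shows "stationary (\<lambda>a. s * p a + t * q a)"
  using assms unfolding stationary_def by (auto simp: sum.distrib simp flip: sum_distrib_left)

text \<open>
  Convexity of \<open>z * ln z\<close>, and the reverse inequality with an error that sums up to the entropy of the
  two-point distribution \<open>(s, t)\<close>. This error disappears on division by the block length, so that the
  entropy rate is affine.
\<close>

lemma mixture_mult_ln_bounds:
  fixes x y s t :: real
  assumes "0 \<le> x" "0 \<le> y" "0 < s" "0 < t" "s + t = 1"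
  shows "(s * x + t * y) * ln (s * x + t * y) \<le> s * (x * ln x) + t * (y * ln y)"
    and "s * (x * ln x) + t * (y * ln y) + x * (s * ln s) + y * (t * ln t)
       \<le> (s * x + t * y) * ln (s * x + t * y)"
proof -
  let ?z = "s * x + t * y"
  have A: "u * ln ?z \<le> u * ln u + ?z - u" if "0 \<le> u" "?z = 0 \<Longrightarrow> u = 0" for u
    using mult_ln_div_ge_hellinger[of u ?z] that assms
    by (smt (verit) mult_nonneg_nonneg right_diff_distrib zero_le_power2)
  have "?z = 0 \<Longrightarrow> x = 0" "?z = 0 \<Longrightarrow> y = 0" using assms
    by (smt (verit) mult_nonneg_nonneg mult_pos_pos)+
  note A = A[OF assms(1) this(1)] A[OF assms(2) this(2)]
  have "?z * ln ?z = s * (x * ln ?z) + t * (y * ln ?z)" by (simp add: algebra_simps)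
  also have "\<dots> \<le> s * (x * ln x + ?z - x) + t * (y * ln y + ?z - y)"
    using A assms by (intro add_mono mult_left_mono) auto
  also have "\<dots> = s * (x * ln x) + t * (y * ln y) + (s + t) * ?z - ?z" by (simp add: algebra_simps)
  finally show "?z * ln ?z \<le> s * (x * ln x) + t * (y * ln y)" using assms by simp
  have B: "w * u * ln u + u * (w * ln w) \<le> w * u * ln ?z"
    if "0 \<le> u" "0 < w" "w * u \<le> ?z" for u w :: real
  proof (cases "u = 0")
    case False
    then have "0 < w * u" using that by simp
    then have "ln (w * u) \<le> ln ?z" using that by (subst ln_le_cancel_iff) auto
    then have "w * u * ln (w * u) \<le> w * u * ln ?z" using \<open>0 < w * u\<close> by (intro mult_left_mono) auto
    moreover have "ln (w * u) = ln w + ln u" using that False by (simp add: ln_mult)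
    ultimately show ?thesis by (simp add: algebra_simps)
  qed simp
  from B[OF assms(1,3)] B[OF assms(2,4)] assms
  show "s * (x * ln x) + t * (y * ln y) + x * (s * ln s) + y * (t * ln t) \<le> ?z * ln ?z"
    by (simp add: algebra_simps)
qed

lemma entropy_rate_mixture:
  assumes p: "stationary p" and q: "stationary q" and st: "0 \<le> s" "0 \<le> t" "s + t = (1::real)"
  shows "entropy_rate (\<lambda>a. s * p a + t * q a) = s * entropy_rate p + t * entropy_rate q"
proof (cases "s = 0 \<or> t = 0")
  case True then show ?thesis using st by auto
next
  case False
  then have st': "0 < s" "0 < t" using st by auto
  note m = stationary_mixture[OF p q st]
  let ?m = "\<lambda>a. s * p a + t * q a"
  have nn: "0 \<le> p a" "0 \<le> q a" for a using p q by (simp_all add: stationary_nonneg)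
  define c where "c = - (s * ln s) - (t * ln t)"
  have lo: "s * block_entropy k p + t * block_entropy k q \<le> block_entropy k ?m" for k
  proof -
    have "(\<Sum>a\<in>strings k. ?m a * ln (?m a)) \<le> (\<Sum>a\<in>strings k. s * (p a * ln (p a)) + t * (q a * ln (q a)))"
      by (intro sum_mono mixture_mult_ln_bounds(1) nn st' st(3))
    then show ?thesis
      unfolding block_entropy_stationary[OF p] block_entropy_stationary[OF q] block_entropy_stationary[OF m]
      by (simp add: sum.distrib sum_distrib_left)
  qed
  have up: "block_entropy k ?m \<le> s * block_entropy k p + t * block_entropy k q + c" for k
  proof -
    have "(\<Sum>a\<in>strings k. s * (p a * ln (p a)) + t * (q a * ln (q a)) + p a * (s * ln s) + q a * (t * ln t))
        \<le> (\<Sum>a\<in>strings k. ?m a * ln (?m a))"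
      by (intro sum_mono mixture_mult_ln_bounds(2) nn st' st(3))
    then show ?thesis
      unfolding block_entropy_stationary[OF p] block_entropy_stationary[OF q] block_entropy_stationary[OF m]
      by (simp add: sum.distrib stationary_sum[OF p] stationary_sum[OF q] c_def
               flip: sum_distrib_left sum_distrib_right)
  qed
  have lim: "(\<lambda>k. s * (block_entropy k p / real k) + t * (block_entropy k q / real k))
     \<longlonglongrightarrow> s * entropy_rate p + t * entropy_rate q"
    by (intro tendsto_intros entropy_rate_limits(1) p q)
  have lim2: "(\<lambda>k. s * (block_entropy k p / real k) + t * (block_entropy k q / real k) + c / real k)
     \<longlonglongrightarrow> s * entropy_rate p + t * entropy_rate q + 0"
    by (intro tendsto_add lim lim_const_over_n)
  show ?thesis
  proof (rule LIMSEQ_unique[OF entropy_rate_limits(1)[OF m]])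
    show "(\<lambda>k. block_entropy k ?m / real k) \<longlonglongrightarrow> s * entropy_rate p + t * entropy_rate q"
    proof (rule tendsto_sandwich[OF _ _ lim])
      show "(\<lambda>k. s * (block_entropy k p / real k) + t * (block_entropy k q / real k) + c / real k)
     \<longlonglongrightarrow> s * entropy_rate p + t * entropy_rate q" using lim2 by simp
      show "\<forall>\<^sub>F k in sequentially. s * (block_entropy k p / real k) + t * (block_entropy k q / real k) \<le> block_entropy k ?m / real k"
        using divide_right_mono[OF lo] by (auto simp: add_divide_distrib)
      show "\<forall>\<^sub>F k in sequentially. block_entropy k ?m / real k \<le> s * (block_entropy k p / real k) + t * (block_entropy k q / real k) + c / real k"
        using divide_right_mono[OF up] by (auto simp: add_divide_distrib)
    qed
  qed
qed


section \<open>Stationary string functions are the invariant measures\<close>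

definition pad :: "'a list \<Rightarrow> nat \<Rightarrow> 'a" where
  "pad a i = (if i < length a then a ! i else undefined)"

definition pre :: "nat \<Rightarrow> (nat \<Rightarrow> 'a) \<Rightarrow> 'a list" where
  "pre n x = map x [0..<n]"

lemma length_pre [simp]: "length (pre n x) = n"
  by (simp add: pre_def)

lemma pre_strings [simp]: "pre n x \<in> strings n"
  by (simp add: strings_def)

lemma nth_pre [simp]: "i < n \<Longrightarrow> pre n x ! i = x i"
  by (simp add: pre_def)

lemma pre_pad [simp]: "a \<in> strings n \<Longrightarrow> pre n (pad a) = a"
  by (auto simp: strings_def pad_def intro!: nth_equalityI)

lemma cylinder_iff: "x \<in> cylinder a \<longleftrightarrow> pre (length a) x = a"
  by (auto simp: cylinder_def list_eq_iff_nth_eq)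

lemma pre_eq_iff: "pre n x = pre n y \<longleftrightarrow> (\<forall>i<n. x i = y i)"
  by (auto simp: list_eq_iff_nth_eq)

lemma cylinder_Nil [simp]: "cylinder [] = UNIV"
  by (simp add: cylinder_def)

lemma cylinder_snoc: "cylinder a = (\<Union>b. cylinder (a @ [b]))"
  by (auto simp: cylinder_def nth_append less_Suc_eq)

lemma cylinder_shift: "shift_map -` cylinder a = (\<Union>b. cylinder (b # a))"
  by (auto simp: cylinder_def shift_map_def nth_Cons' less_Suc_eq_0_disj)

lemma open_cylinder: "open (cylinder a :: (nat \<Rightarrow> 'a::discrete_topology) set)"
proof -
  have "cylinder a = (\<Pi>\<^sub>E i\<in>UNIV. if i < length a then {a ! i} else (UNIV :: 'a set))"
    by (auto simp: cylinder_def PiE_UNIV_domain split: if_splits)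
  moreover have "open (\<Pi>\<^sub>E i\<in>UNIV. if i < length a then {a ! i} else (UNIV :: 'a set))"
  proof (rule open_PiE)
    show "open (if i < length a then {a ! i} else (UNIV :: 'a set))" for i by (rule discrete_topology_class.open_discrete)
  qed auto
  ultimately show ?thesis by simp
qed

lemma open_contains_cylinder:
  fixes U :: "(nat \<Rightarrow> 'a::discrete_topology) set"
  assumes "open U" "x \<in> U" shows "\<exists>n. cylinder (pre n x) \<subseteq> U"
proof -
  have "openin (product_topology (\<lambda>i::nat. euclidean :: 'a topology) UNIV) U"
    using assms(1) by (simp add: euclidean_product_topology)
  from product_topology_open_contains_basis[OF this assms(2)]
  obtain X where X: "x \<in> (\<Pi>\<^sub>E i\<in>UNIV. X i)" "finite {i. X i \<noteq> (UNIV::'a set)}" "(\<Pi>\<^sub>E i\<in>UNIV. X i) \<subseteq> U"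
    by auto
  from X(2) obtain n where "\<forall>i\<in>{i. X i \<noteq> UNIV}. i < n"
    unfolding finite_nat_set_iff_bounded ..
  then have n: "\<And>i. X i \<noteq> UNIV \<Longrightarrow> i < n" by simp
  have "cylinder (pre n x) \<subseteq> (\<Pi>\<^sub>E i\<in>UNIV. X i)"
  proof
    fix y assume "y \<in> cylinder (pre n x)"
    then have y: "\<And>i. i < n \<Longrightarrow> y i = x i" by (simp add: cylinder_iff pre_eq_iff)
    have x: "x i \<in> X i" for i using X(1) by (simp add: PiE_UNIV_domain Pi_iff)
    have "y i \<in> X i" for i
    proof (cases "X i = UNIV")
      case False
      from y[OF n[OF this]] x[of i] show ?thesis by simp
    qed simp
    then show "y \<in> (\<Pi>\<^sub>E i\<in>UNIV. X i)" by (simp add: PiE_UNIV_domain Pi_iff)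
  qed
  with X(3) show ?thesis by blast
qed

lemma compact_sequences: "compact (UNIV :: (nat \<Rightarrow> 'a::{finite,discrete_topology}) set)"
proof -
  have "compact_space (euclidean :: 'a topology)"
    by (simp add: compact_space_def finite_imp_compact)
  then have "compact_space (product_topology (\<lambda>i::nat. euclidean :: 'a topology) UNIV)"
    by (simp add: compact_space_product_topology)
  then show ?thesis by (simp add: euclidean_product_topology compact_space_def)
qed

lemma sets_borel_cylinders:
  "sets (borel :: (nat \<Rightarrow> 'a::{finite,discrete_topology}) measure) = sigma_sets UNIV (range cylinder)"
proof
  show "sigma_sets UNIV (range cylinder) \<subseteq> sets (borel :: (nat \<Rightarrow> 'a) measure)"
    using sets.sigma_sets_subset[of "range cylinder" "borel :: (nat \<Rightarrow> 'a) measure"]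
    by (simp add: image_subset_iff open_cylinder)
  have "U \<in> sigma_sets UNIV (range cylinder)" if "open U" for U :: "(nat \<Rightarrow> 'a) set"
  proof -
    have "U = \<Union> (cylinder ` {a. cylinder a \<subseteq> U})"
      using open_contains_cylinder[OF that] by (auto simp: cylinder_iff) (metis cylinder_iff length_pre mem_Collect_eq)
    also have "\<dots> \<in> sigma_sets UNIV (range cylinder)"
    proof (rule sigma_sets_UNION)
      show "countable (cylinder ` {a. cylinder a \<subseteq> U})" by (intro countable_image countableI_type)
    qed auto
    finally show ?thesis .
  qed
  then show "sets (borel :: (nat \<Rightarrow> 'a) measure) \<subseteq> sigma_sets UNIV (range cylinder)"
    unfolding borel_def by (subst sets_measure_of) (auto intro!: sigma_sets_mono)
qed

lemma cylinder_in_borel [measurable, simp]: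
  "cylinder a \<in> sets (borel :: (nat \<Rightarrow> 'a::{finite,discrete_topology}) measure)"
  by (simp add: open_cylinder)

lemma shift_map_measurable:
  "shift_map \<in> measurable borel (borel :: (nat \<Rightarrow> 'a::{finite,discrete_topology}) measure)"
proof (rule measurable_sigma_sets[OF sets_borel_cylinders])
  show "shift_map -` A \<inter> space borel \<in> sets borel" if "A \<in> range cylinder" for A :: "(nat \<Rightarrow> 'a) set"
    using that by (auto simp: cylinder_shift)
qed auto

lemma measure_eq_cylinders:
  fixes M N :: "(nat \<Rightarrow> 'a::{finite,discrete_topology}) measure"
  assumes "prob_space M" "prob_space N" "sets M = sets borel" "sets N = sets borel"
    and "\<And>a. measure M (cylinder a) = measure N (cylinder a)"
  shows "M = N"
proof -
  interpret M: prob_space M by fact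
  interpret N: prob_space N by fact
  have meet: "cylinder a \<inter> cylinder b \<in> insert {} (range cylinder)" for a b :: "'a list"
  proof -
    have *: "cylinder a \<inter> cylinder b \<in> insert {} (range cylinder)" if "length a \<le> length b" for a b :: "'a list"
    proof (cases "a = take (length a) b")
      case True
      then have "\<forall>i<length a. b ! i = a ! i" by (metis nth_take)
      then have "cylinder b \<subseteq> cylinder a" using that by (auto simp: cylinder_def)
      then have "cylinder a \<inter> cylinder b = cylinder b" by auto
      then show ?thesis by auto
    next
      case False
      then have "\<exists>i<length a. a ! i \<noteq> b ! i" using that by (auto simp: list_eq_iff_nth_eq)
      then have "cylinder a \<inter> cylinder b = {}" using that by (force simp: cylinder_def)
      then show ?thesis by auto
    qed
    show ?thesis using *[of a b] *[of b a] by (metis Int_commute nat_le_linear)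
  qed
  show ?thesis
  proof (rule measure_eqI_generator_eq[where E = "insert {} (range cylinder)" and \<Omega> = UNIV and A = "\<lambda>_. UNIV"])
    show "Int_stable (insert {} (range (cylinder :: 'a list \<Rightarrow> _)))"
      using meet by (auto simp: Int_stable_def)
    have *: "sigma_sets UNIV (insert {} (range cylinder)) = sigma_sets UNIV (range (cylinder :: 'a list \<Rightarrow> _))"
      by (intro sigma_sets_eqI) (auto intro: sigma_sets.intros)
    show "sets M = sigma_sets UNIV (insert {} (range cylinder))" "sets N = sigma_sets UNIV (insert {} (range cylinder))"
      using assms * by (auto simp: sets_borel_cylinders)
    show "range (\<lambda>_::nat. UNIV) \<subseteq> insert {} (range (cylinder :: 'a list \<Rightarrow> _))"
      using cylinder_Nil by (metis insertI2 rangeI image_subset_iff)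
    show "emeasure M X = emeasure N X" if "X \<in> insert {} (range cylinder)" for X
      using that assms(5) by (auto simp: M.emeasure_eq_measure N.emeasure_eq_measure)
  qed (auto simp: M.emeasure_eq_measure)
qed

lemma invariant_stationary:
  fixes \<nu> :: "(nat \<Rightarrow> 'a::{finite,discrete_topology}) measure"
  assumes "\<nu> \<in> invariant_measures"
  shows "stationary (\<lambda>a. measure \<nu> (cylinder a))"
proof -
  interpret prob_space \<nu> using assms by (simp add: invariant_measures_def)
  have sets: "sets \<nu> = sets borel" and inv: "distr \<nu> borel shift_map = \<nu>"
    using assms by (auto simp: invariant_measures_def)
  have sp: "space \<nu> = UNIV" using sets_eq_imp_space_eq[OF sets] by simp
  have [measurable]: "cylinder a \<in> events" for a by (simp add: sets)
  have disj1: "disjoint_family (\<lambda>b. cylinder (a @ [b]))" "disjoint_family (\<lambda>b. cylinder (b # a))" for a :: "'a list"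
    by (auto simp: disjoint_family_on_def cylinder_iff)
  have 1: "(\<Sum>b\<in>UNIV. prob (cylinder (a @ [b]))) = prob (cylinder a)" for a
    unfolding cylinder_snoc[of a] by (rule finite_measure_finite_Union[symmetric]) (auto simp: disj1)
  have "(\<Sum>b\<in>UNIV. prob (cylinder (b # a))) = prob (shift_map -` cylinder a)" for a
    unfolding cylinder_shift by (rule finite_measure_finite_Union[symmetric]) (auto simp: disj1)
  also have "prob (shift_map -` cylinder a) = prob (cylinder a)" for a
  proof -
    have "prob (cylinder a) = measure (distr \<nu> borel shift_map) (cylinder a)" by (simp add: inv)
    also have "\<dots> = prob (shift_map -` cylinder a \<inter> space \<nu>)"
      by (rule measure_distr) (auto simp: measurable_cong_sets[OF sets refl] shift_map_measurable)
    finally show ?thesis by (simp add: sp)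
  qed
  finally show ?thesis using 1 prob_space sp by (auto simp: stationary_def)
qed

text \<open>
  A stationary function defines an additive set function on the algebra of sets that depend on
  finitely many coordinates. These sets are compact, so a decreasing sequence of them with empty
  intersection is eventually empty, and Caratheodory's extension theorem applies.
\<close>

lemma stationary_extension:
  fixes p :: "'a::{finite,discrete_topology} list \<Rightarrow> real"
  assumes p: "stationary p"
  shows "\<exists>\<nu>\<in>invariant_measures. \<forall>a. measure \<nu> (cylinder a) = p a"
proof -
  \<comment> \<open>\<open>lev n A\<close>: membership in \<open>A\<close> depends on the first \<open>n\<close> coordinates. Then \<open>m n A\<close> is the mass of \<open>A\<close>.\<close>
  define lev where "lev n A \<longleftrightarrow> (\<forall>x y. pre n x = pre n y \<longrightarrow> (x \<in> A \<longleftrightarrow> y \<in> A))" for n and A :: "(nat \<Rightarrow> 'a) set"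
  define F where "F = {A. \<exists>n. lev n A}"
  define m where "m n A = (\<Sum>a\<in>strings n. if pad a \<in> A then p a else 0)" for n A
  define \<mu> where "\<mu> A = m (SOME n. lev n A) A" for A
  have lev_mono: "lev n A \<Longrightarrow> n \<le> n' \<Longrightarrow> lev n' A" for n n' A
    unfolding lev_def pre_eq_iff by (meson less_le_trans)
  have m_Suc: "m (Suc n) A = m n A" if "lev n A" for n A
  proof -
    have "pad (a @ [b]) \<in> A \<longleftrightarrow> pad a \<in> A" if "a \<in> strings n" for a b
    proof -
      have "\<forall>i<n. pad (a @ [b]) i = pad a i"
        using that by (auto simp: pad_def nth_append strings_def)
      then have "pre n (pad (a @ [b])) = pre n (pad a)"
        unfolding pre_eq_iff .
      with \<open>lev n A\<close> show ?thesis unfolding lev_def by blast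
    qed
    then show ?thesis unfolding m_def sum_strings_snoc
      by (intro sum.cong refl) (simp add: stationary_snoc[OF p])
  qed
  have m_mono: "m n' A = m n A" if "lev n A" "n \<le> n'" for n n' A
    using that(2) by (induction n' rule: dec_induct) (auto simp: m_Suc lev_mono[OF that(1)])
  have \<mu>: "\<mu> A = m n A" if "lev n A" for n A
  proof -
    have "lev (SOME n. lev n A) A" using that by (rule someI)
    then show ?thesis unfolding \<mu>_def using m_mono[of _ A] that by (metis nat_le_linear)
  qed
  have common: "\<exists>n. lev n A \<and> lev n B" if "A \<in> F" "B \<in> F" for A B
  proof -
    from that obtain i j where "lev i A" "lev j B" by (auto simp: F_def)
    then show ?thesis using lev_mono[of i A "max i j"] lev_mono[of j B "max i j"] by auto
  qed
  have lev_cyl: "lev (length a) (cylinder a)" for a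
    by (auto simp: lev_def cylinder_iff)
  have cylF: "cylinder a \<in> F" for a using lev_cyl by (auto simp: F_def)
  have alg: "algebra UNIV F"
  proof (subst algebra_iff_Un, intro conjI ballI)
    show "F \<subseteq> Pow UNIV" by simp
    show "{} \<in> F" by (auto simp: F_def lev_def)
    show "UNIV - A \<in> F" if "A \<in> F" for A using that by (auto simp: F_def lev_def)
    show "A \<union> B \<in> F" if "A \<in> F" "B \<in> F" for A B
    proof -
      from common[OF that] obtain n where "lev n A" "lev n B" by auto
      then have "lev n (A \<union> B)" unfolding lev_def by blast
      then show ?thesis by (auto simp: F_def)
    qed
  qed
  then interpret algebra UNIV F .
  have nn: "0 \<le> m n A" for n A unfolding m_def by (intro sum_nonneg) (auto simp: stationary_nonneg[OF p])
  have add: "m n (A \<union> B) = m n A + m n B" if "A \<inter> B = {}" for n A B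
    unfolding m_def sum.distrib[symmetric] using that by (intro sum.cong) auto
  have pos: "positive F (\<lambda>A. ennreal (\<mu> A))"
    by (simp add: positive_def \<mu>_def m_def)
  have Un: "lev n (A \<union> B)" if "lev n A" "lev n B" for n A B using that unfolding lev_def by blast
  have additive: "additive F (\<lambda>A. ennreal (\<mu> A))"
  proof (unfold additive_def, intro ballI impI)
    fix A B assume AB: "A \<in> F" "B \<in> F" "A \<inter> B = {}"
    from common[OF AB(1,2)] obtain n where n: "lev n A" "lev n B" by auto
    show "ennreal (\<mu> (A \<union> B)) = ennreal (\<mu> A) + ennreal (\<mu> B)"
      unfolding \<mu>[OF n(1)] \<mu>[OF n(2)] \<mu>[OF Un[OF n]] add[OF AB(3)] by (simp add: nn)
  qed
  have closedF: "closed A" if "A \<in> F" for A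
  proof -
    from that obtain n where n: "lev n (-A)" by (auto simp: F_def lev_def)
    have "open (-A)"
    proof (subst open_subopen, intro ballI)
      fix x assume "x \<in> -A"
      with n have "cylinder (pre n x) \<subseteq> -A" unfolding lev_def by (metis cylinder_iff length_pre subsetI)
      then show "\<exists>T. open T \<and> x \<in> T \<and> T \<subseteq> -A" using open_cylinder by (intro exI[of _ "cylinder (pre n x)"]) (auto simp: cylinder_iff)
    qed
    then show ?thesis by (simp add: closed_def)
  qed
  have cont: "(\<lambda>i. ennreal (\<mu> (A i))) \<longlonglongrightarrow> 0"
    if A: "range A \<subseteq> F" "decseq A" "(\<Inter>i. A i) = {}" for A :: "nat \<Rightarrow> (nat \<Rightarrow> 'a) set"
  proof -
    have "\<exists>i. A i = {}"
    proof (rule ccontr)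
      assume "\<not> ?thesis"
      then have "UNIV \<inter> \<Inter>(range A) \<noteq> {}"
      proof (rule_tac compact_imp_fip[OF compact_sequences])
        fix T assume T: "T \<in> range A" then show "closed T" using A(1) closedF by auto
      next
        fix F' assume F': "finite F'" "F' \<subseteq> range A"
        then obtain I where I: "finite I" "F' = A ` I" by (metis finite_subset_image)
        obtain N where N: "\<forall>i\<in>I. i \<le> N" using I(1) finite_nat_set_iff_bounded_le by auto
        have "A N \<subseteq> \<Inter>F'" using I N decseqD[OF A(2)] by auto
        moreover assume "\<not> (\<exists>i. A i = {})"
        ultimately show "UNIV \<inter> \<Inter>F' \<noteq> {}" by blast
      qed
      with A(3) show False by simp
    qed
    then obtain i where i: "A i = {}" by auto
    then have "A j = {}" if "j \<ge> i" for j using decseqD[OF A(2) that] by auto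
    then have "\<forall>j\<ge>i. ennreal (\<mu> (A j)) = 0" using pos by (auto simp: positive_def)
    then show ?thesis by (auto intro!: tendsto_eventually eventually_sequentiallyI[of i])
  qed
  have "\<exists>\<mu>' :: (nat \<Rightarrow> 'a) set \<Rightarrow> ennreal. (\<forall>s\<in>F. \<mu>' s = ennreal (\<mu> s)) \<and> measure_space UNIV (sigma_sets UNIV F) \<mu>'"
    by (rule caratheodory_empty_continuous[OF pos additive _ cont]) simp_all
  then obtain \<mu>' where \<mu>': "\<forall>s\<in>F. \<mu>' s = ennreal (\<mu> s)" "measure_space UNIV (sigma_sets UNIV F) \<mu>'"
    by blast
  define N where "N = measure_of UNIV F \<mu>'"
  have setsN: "sets N = sets borel"
  proof -
    have "sigma_sets UNIV F = sigma_sets UNIV (range cylinder)"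
    proof (rule sigma_sets_eqI)
      fix A assume "A \<in> F"
      then have "A \<in> sets borel" using closedF by simp
      then show "A \<in> sigma_sets UNIV (range cylinder)" by (simp add: sets_borel_cylinders)
    qed (use cylF in \<open>auto intro: sigma_sets.Basic\<close>)
    then show ?thesis by (simp add: N_def sets_borel_cylinders)
  qed
  have em: "emeasure N A = ennreal (\<mu> A)" if "A \<in> F" for A
  proof -
    have "sets N = sigma_sets UNIV F" by (simp add: N_def)
    then have "emeasure N A = \<mu>' A"
      using \<mu>'(2) that by (intro emeasure_measure_of[OF N_def]) (auto simp: measure_space_def)
    then show ?thesis using \<mu>'(1) that by simp
  qed
  have \<mu>cyl: "\<mu> (cylinder a) = p a" for a
  proof -
    have "m (length a) (cylinder a) = (\<Sum>b\<in>strings (length a). if a = b then p b else 0)"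
      unfolding m_def by (intro sum.cong refl) (auto simp: cylinder_iff strings_def)
    also have "\<dots> = p a" by (simp add: strings_def[of "length a"] finite_strings[unfolded strings_def])
    finally show ?thesis using \<mu>[OF lev_cyl] by simp
  qed
  have spN: "space N = UNIV" using sets_eq_imp_space_eq[OF setsN] by simp
  have mN: "measure N (cylinder a) = p a" for a
    using em[OF cylF] by (simp add: measure_def \<mu>cyl stationary_nonneg[OF p])
  interpret N: prob_space N
    by (rule prob_spaceI) (use em[OF cylF[of "[]"]] \<mu>cyl[of "[]"] in \<open>simp add: spN stationary_Nil[OF p]\<close>)
  have meas: "shift_map \<in> measurable N borel"
    by (simp add: measurable_cong_sets[OF setsN refl] shift_map_measurable)
  have "distr N borel shift_map = N"
  proof (rule measure_eq_cylinders)
    fix a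
    have "measure (distr N borel shift_map) (cylinder a) = measure N (shift_map -` cylinder a)"
      by (subst measure_distr[OF meas]) (auto simp: spN)
    also have "\<dots> = (\<Sum>b\<in>UNIV. measure N (cylinder (b # a)))"
      unfolding cylinder_shift
      by (rule N.finite_measure_finite_Union) (auto simp: disjoint_family_on_def cylinder_iff setsN)
    also have "\<dots> = measure N (cylinder a)" by (simp add: mN stationary_Cons[OF p])
    finally show "measure (distr N borel shift_map) (cylinder a) = measure N (cylinder a)" .
  qed (auto simp: setsN N.prob_space_axioms N.prob_space_distr[OF meas])
  then show ?thesis using mN setsN N.prob_space_axioms by (auto simp: invariant_measures_def)
qed


section \<open>Almost additive functions of strings\<close>

text \<open>
  The logarithm of the cylinder probabilities of an equilibrium state and the Birkhoff sums of
  \<open>ln g\<close> are of this kind. As \<open>c\<close> is monotone, both parts of a string that is cut in two can be estimated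
  by the length of the whole.
\<close>

definition almost_additive :: "(nat \<Rightarrow> real) \<Rightarrow> ('a::finite list \<Rightarrow> real) \<Rightarrow> bool" where
  "almost_additive c L \<longleftrightarrow> mono c \<and> (\<lambda>m. c m / real m) \<longlonglongrightarrow> 0 \<and>
     (\<forall>a b. \<bar>L (a @ b) - L a - L b\<bar> \<le> c (length a))"

definition block_mean :: "('a::finite list \<Rightarrow> real) \<Rightarrow> ('a list \<Rightarrow> real) \<Rightarrow> nat \<Rightarrow> real" where
  "block_mean L p k = (\<Sum>a\<in>strings k. p a * L a)"

definition mean_rate :: "('a::finite list \<Rightarrow> real) \<Rightarrow> ('a list \<Rightarrow> real) \<Rightarrow> real" where
  "mean_rate L p = lim (\<lambda>k. block_mean L p k / real k)"

lemma almost_additiveD: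
  assumes "almost_additive c L"
  shows "\<bar>L (a @ b) - L a - L b\<bar> \<le> c (length a)" "mono c" "(\<lambda>m. c m / real m) \<longlonglongrightarrow> 0" "0 \<le> c m"
proof -
  show *: "\<bar>L (a @ b) - L a - L b\<bar> \<le> c (length a)" "mono c" "(\<lambda>m. c m / real m) \<longlonglongrightarrow> 0" for a b
    using assms by (auto simp: almost_additive_def)
  have "0 \<le> c 0" using *(1)[of "[]" "[]"] by simp
  also have "c 0 \<le> c m" using *(2) by (rule monoD) simp
  finally show "0 \<le> c m" .
qed

text \<open>
  A version of Fekete's lemma: division of \<open>n\<close> by \<open>m\<close> with remainder shows that \<open>s n\<close> differs from
  \<open>(n / m) * s m\<close> by at most \<open>(n / m) * c m\<close> plus a constant that depends on \<open>m\<close> only.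
\<close>

lemma almost_additive_sequence:
  fixes s c :: "nat \<Rightarrow> real"
  assumes c: "(\<lambda>m. c m / real m) \<longlonglongrightarrow> 0" and s: "\<And>m n. \<bar>s (m + n) - s m - s n\<bar> \<le> c m"
  obtains e where "(\<lambda>m. s m / real m) \<longlonglongrightarrow> e" "\<And>m. 0 < m \<Longrightarrow> \<bar>e - s m / real m\<bar> \<le> c m / real m"
proof -
  have dev: "\<exists>B. \<forall>n. \<bar>s n - real n * (s m / real m)\<bar> \<le> real n * (c m / real m) + B" if m: "0 < m" for m
  proof -
    define B where "B = (\<Sum>r<m. \<bar>s r - real r * (s m / real m)\<bar>)"
    have cm: "0 \<le> c m" using s[of m 0] by (smt (verit))
    have "\<bar>s n - real n * (s m / real m)\<bar> \<le> real n * (c m / real m) + B" for n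
    proof (induction n rule: less_induct)
      case (less n)
      show ?case
      proof (cases "n < m")
        case True
        then have "\<bar>s n - real n * (s m / real m)\<bar> \<le> B"
          unfolding B_def by (intro member_le_sum[where f = "\<lambda>r. \<bar>s r - real r * (s m / real m)\<bar>"]) auto
        moreover have "0 \<le> real n * (c m / real m)" using cm by simp
        ultimately show ?thesis by linarith
      next
        case False
        define n' where "n' = n - m"
        have n: "n = m + n'" using False by (simp add: n'_def)
        have IH: "\<bar>s n' - real n' * (s m / real m)\<bar> \<le> real n' * (c m / real m) + B"
          using less[of n'] m by (simp add: n)
        have "real n * (s m / real m) = s m + real n' * (s m / real m)"
          "real n * (c m / real m) = c m + real n' * (c m / real m)"
          using m by (simp_all add: n field_simps)
        with IH s[of m n'] show ?thesis unfolding n by linarith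
      qed
    qed
    then show ?thesis by blast
  qed
  have dev': "\<exists>N. \<forall>n\<ge>N. \<bar>s n / real n - s m / real m\<bar> \<le> c m / real m + e" if m: "0 < m" and e: "0 < e" for m and e :: real
  proof -
    from dev[OF m] obtain B where B: "\<And>n. \<bar>s n - real n * (s m / real m)\<bar> \<le> real n * (c m / real m) + B" by auto
    obtain N :: nat where N: "B / e < real N" using reals_Archimedean2 by blast
    have "\<bar>s n / real n - s m / real m\<bar> \<le> c m / real m + e" if n: "n \<ge> Suc N" for n
    proof -
      have n0: "real n > 0" using n by simp
      have "\<bar>s n / real n - s m / real m\<bar> = \<bar>s n - real n * (s m / real m)\<bar> / real n"
      proof -
        have "s n / real n - s m / real m = (s n - real n * (s m / real m)) / real n"
          using n0 by (simp add: diff_divide_distrib)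
        then show ?thesis using n0 by (simp add: abs_divide)
      qed
      also have "\<dots> \<le> (real n * (c m / real m) + B) / real n"
        using B n0 by (intro divide_right_mono) auto
      also have "\<dots> = c m / real m + B / real n" using n0 by (simp add: add_divide_distrib)
      also have "B / real n \<le> e"
      proof -
        have "B < e * real N" using N e by (simp add: field_simps)
        also have "\<dots> \<le> e * real n" using e n by (intro mult_left_mono) auto
        finally show ?thesis using n0 by (simp add: field_simps)
      qed
      finally show ?thesis by simp
    qed
    then show ?thesis by blast
  qed
  have "Cauchy (\<lambda>n. s n / real n)"
  proof (rule metric_CauchyI)
    fix e :: real assume e: "0 < e"
    then have "\<forall>\<^sub>F m in sequentially. c m / real m < e / 8"
      using order_tendstoD(2)[OF c, of "e/8"] by simp
    then obtain m0 where m0: "\<And>m. m \<ge> m0 \<Longrightarrow> c m / real m < e / 8" by (auto simp: eventually_sequentially)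
    define m where "m = Suc m0"
    have m: "0 < m" "c m / real m < e / 8" using m0[of m] by (auto simp: m_def)
    from dev'[OF m(1), of "e/8"] e obtain N where
      N: "\<And>n. n \<ge> N \<Longrightarrow> \<bar>s n / real n - s m / real m\<bar> \<le> c m / real m + e/8" by auto
    show "\<exists>M. \<forall>i\<ge>M. \<forall>j\<ge>M. dist (s i / real i) (s j / real j) < e"
    proof (intro exI[of _ N] allI impI)
      fix i j assume "i \<ge> N" "j \<ge> N"
      with N[of i] N[of j] m(2) e show "dist (s i / real i) (s j / real j) < e"
        unfolding dist_real_def by linarith
    qed
  qed
  then obtain e where e: "(\<lambda>m. s m / real m) \<longlonglongrightarrow> e"
    using Cauchy_convergent_iff convergent_def by blast
  have "\<bar>e - s m / real m\<bar> \<le> c m / real m" if m: "0 < m" for m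
  proof (rule field_le_epsilon)
    fix d :: real assume d: "0 < d"
    from dev'[OF m d] have "\<forall>\<^sub>F n in sequentially. \<bar>s n / real n - s m / real m\<bar> \<le> c m / real m + d"
      by (auto simp: eventually_sequentially)
    moreover have "(\<lambda>n. \<bar>s n / real n - s m / real m\<bar>) \<longlonglongrightarrow> \<bar>e - s m / real m\<bar>"
      by (intro tendsto_intros e)
    ultimately show "\<bar>e - s m / real m\<bar> \<le> c m / real m + d"
      by (intro tendsto_upperbound) auto
  qed
  with e that show ?thesis by blast
qed

lemma block_mean_almost_additive:
  fixes p :: "'a::finite list \<Rightarrow> real"
  assumes p: "stationary p" and L: "almost_additive c L"
  shows "\<bar>block_mean L p (m + n) - block_mean L p m - block_mean L p n\<bar> \<le> c m"
proof -
  have "block_mean L p (m + n) - block_mean L p m - block_mean L p n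
    = (\<Sum>a\<in>strings m. \<Sum>b\<in>strings n. p (a @ b) * (L (a @ b) - L a - L b))"
  proof -
    have "(\<Sum>a\<in>strings m. \<Sum>b\<in>strings n. p (a @ b) * L a) = block_mean L p m"
      by (simp add: block_mean_def stationary_append_right[OF p] flip: sum_distrib_right)
    moreover have "(\<Sum>a\<in>strings m. \<Sum>b\<in>strings n. p (a @ b) * L b) = block_mean L p n"
      by (subst sum.swap) (simp add: block_mean_def stationary_append_left[OF p] flip: sum_distrib_right)
    ultimately show ?thesis
      by (simp add: block_mean_def sum_strings_append right_diff_distrib sum_subtractf)
  qed
  also have "\<bar>\<dots>\<bar> \<le> (\<Sum>a\<in>strings m. \<Sum>b\<in>strings n. p (a @ b) * c m)"
  proof (intro order_trans[OF sum_abs] sum_mono)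
    fix a b :: "'a list" assume "a \<in> strings m" "b \<in> strings n"
    with almost_additiveD(1)[OF L, of a b] show "\<bar>p (a @ b) * (L (a @ b) - L a - L b)\<bar> \<le> p (a @ b) * c m"
      by (simp add: abs_mult stationary_nonneg[OF p] mult_left_mono length_strings)
  qed
  also have "\<dots> = c m"
    by (simp add: stationary_append_right[OF p] stationary_sum[OF p] flip: sum_distrib_right)
  finally show ?thesis .
qed

lemma mean_rate:
  assumes p: "stationary p" and L: "almost_additive c L"
  shows mean_rate_tendsto: "(\<lambda>k. block_mean L p k / real k) \<longlonglongrightarrow> mean_rate L p"
    and mean_rate_bound: "0 < m \<Longrightarrow> \<bar>mean_rate L p - block_mean L p m / real m\<bar> \<le> c m / real m"
proof -
  obtain e where e: "(\<lambda>k. block_mean L p k / real k) \<longlonglongrightarrow> e"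
    and b: "\<And>m. 0 < m \<Longrightarrow> \<bar>e - block_mean L p m / real m\<bar> \<le> c m / real m"
    using almost_additive_sequence[OF almost_additiveD(3)[OF L] block_mean_almost_additive[OF p L]] by blast
  have "mean_rate L p = e" unfolding mean_rate_def using e by (rule limI)
  with e b show "(\<lambda>k. block_mean L p k / real k) \<longlonglongrightarrow> mean_rate L p"
    "0 < m \<Longrightarrow> \<bar>mean_rate L p - block_mean L p m / real m\<bar> \<le> c m / real m" by auto
qed

lemma mean_rate_mixture:
  assumes p: "stationary p" and q: "stationary q" and L: "almost_additive c L"
    and st: "0 \<le> s" "0 \<le> t" "s + t = (1::real)"
  shows "mean_rate L (\<lambda>a. s * p a + t * q a) = s * mean_rate L p + t * mean_rate L q"
proof (rule LIMSEQ_unique[OF mean_rate_tendsto[OF stationary_mixture[OF p q st] L]])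
  have "block_mean L (\<lambda>a. s * p a + t * q a) k = s * block_mean L p k + t * block_mean L q k" for k
    by (simp add: block_mean_def distrib_right sum.distrib sum_distrib_left mult.assoc)
  then have "(\<lambda>k. block_mean L (\<lambda>a. s * p a + t * q a) k / real k)
     = (\<lambda>k. s * (block_mean L p k / real k) + t * (block_mean L q k / real k))"
    by (simp add: add_divide_distrib)
  also have "\<dots> \<longlonglongrightarrow> s * mean_rate L p + t * mean_rate L q"
    by (intro tendsto_intros mean_rate_tendsto[OF _ L] p q)
  finally show "(\<lambda>k. block_mean L (\<lambda>a. s * p a + t * q a) k / real k)
     \<longlonglongrightarrow> s * mean_rate L p + t * mean_rate L q" .
qed


section \<open>Concatenating independent blocks\<close>

definition block_dist :: "nat \<Rightarrow> ('a::finite list \<Rightarrow> real) \<Rightarrow> bool" where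
  "block_dist N p \<longleftrightarrow> 0 < N \<and> (\<forall>a. 0 \<le> p a) \<and> (\<Sum>a\<in>strings N. p a) = 1"

text \<open>
  The law of a sequence of independent blocks, seen from the beginning of a block. The letters of
  an unfinished last block have the corresponding marginal of \<open>p\<close>.
\<close>

function iid_blocks :: "nat \<Rightarrow> ('a::finite list \<Rightarrow> real) \<Rightarrow> 'a list \<Rightarrow> real" where
  "iid_blocks N p a =
     (if N = 0 \<or> length a < N then \<Sum>b\<in>strings (N - length a). p (a @ b)
      else p (take N a) * iid_blocks N p (drop N a))"
  by pat_completeness auto
termination by (relation "Wellfounded.measure (\<lambda>(N, p, a). length a)") auto

declare iid_blocks.simps [simp del]

text \<open>
  The law of independent blocks is invariant under shifts by \<open>N\<close>; the average over the position
  inside a block at which the observation starts is invariant under all shifts.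
\<close>

definition block_process :: "nat \<Rightarrow> ('a::finite list \<Rightarrow> real) \<Rightarrow> 'a list \<Rightarrow> real" where
  "block_process N p a = (\<Sum>j<N. \<Sum>b\<in>strings j. iid_blocks N p (b @ a)) / real N"

context
  fixes N :: nat and p :: "'a::finite list \<Rightarrow> real"
  assumes bd: "block_dist N p"
begin

lemma block_length_pos: "0 < N" and block_weight_nonneg: "0 \<le> p a" and block_weight_sum: "(\<Sum>a\<in>strings N. p a) = 1"
  using bd by (auto simp: block_dist_def)

lemma iid_blocks_Nil: "iid_blocks N p [] = 1"
  using block_length_pos block_weight_sum by (simp add: iid_blocks.simps)

lemma iid_blocks_nonneg: "0 \<le> iid_blocks N p a"
proof (induction "length a" arbitrary: a rule: less_induct)
  case less
  then show ?case using block_length_pos by (subst iid_blocks.simps) (auto intro!: sum_nonneg block_weight_nonneg mult_nonneg_nonneg)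
qed

lemma iid_blocks_append: "b \<in> strings N \<Longrightarrow> iid_blocks N p (b @ a) = p b * iid_blocks N p a"
  using block_length_pos by (subst iid_blocks.simps) (simp add: length_strings)

lemma iid_blocks_snoc: "(\<Sum>c\<in>UNIV. iid_blocks N p (a @ [c])) = iid_blocks N p a"
proof (induction "length a" arbitrary: a rule: less_induct)
  case less
  consider "Suc (length a) < N" | "Suc (length a) = N" | "N \<le> length a" by linarith
  then show ?case
  proof cases
    case 1
    then have "N - length a = Suc (N - Suc (length a))" by simp
    with 1 show ?thesis by (simp add: iid_blocks.simps sum_strings_Cons)
  next
    case 2
    then have "N - length a = Suc 0" by simp
    with 2 show ?thesis
      by (simp add: iid_blocks.simps[of _ _ a] iid_blocks.simps[of _ _ "a @ [_]"] iid_blocks_Nil sum_strings_Cons)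
  next
    case 3
    have "(\<Sum>c\<in>UNIV. iid_blocks N p (a @ [c])) = p (take N a) * (\<Sum>c\<in>UNIV. iid_blocks N p (drop N a @ [c]))"
      using 3 block_length_pos by (subst iid_blocks.simps) (simp add: sum_distrib_left)
    also have "\<dots> = p (take N a) * iid_blocks N p (drop N a)"
      using less[of "drop N a"] 3 block_length_pos by simp
    finally show ?thesis using 3 block_length_pos by (simp add: iid_blocks.simps[of _ _ a])
  qed
qed

lemma iid_blocks_append_right: "(\<Sum>b\<in>strings n. iid_blocks N p (a @ b)) = iid_blocks N p a"
proof (induction n)
  case (Suc n)
  have "(\<Sum>b\<in>strings (Suc n). iid_blocks N p (a @ b))
      = (\<Sum>b\<in>strings n. \<Sum>c\<in>UNIV. iid_blocks N p ((a @ b) @ [c]))"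
    by (simp add: sum_strings_snoc)
  with Suc show ?case by (simp only: iid_blocks_snoc)
qed simp

lemma iid_blocks_le: "iid_blocks N p (a @ b) \<le> iid_blocks N p a"
proof -
  have "iid_blocks N p (a @ b) \<le> (\<Sum>b\<in>strings (length b). iid_blocks N p (a @ b))"
    by (rule le_sum_strings) (rule iid_blocks_nonneg)
  then show ?thesis by (simp add: iid_blocks_append_right)
qed

lemma iid_blocks_sum: "(\<Sum>a\<in>strings n. iid_blocks N p a) = 1"
  using iid_blocks_append_right[of "[]" n] by (simp add: iid_blocks_Nil)

lemma stationary_block_process: "stationary (block_process N p)"
  unfolding stationary_def
proof (intro conjI allI)
  show "block_process N p [] = 1" using block_length_pos by (simp add: block_process_def iid_blocks_sum)
  show "0 \<le> block_process N p a" for a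
    unfolding block_process_def by (intro divide_nonneg_nonneg sum_nonneg iid_blocks_nonneg) auto
  show "(\<Sum>c\<in>UNIV. block_process N p (a @ [c])) = block_process N p a" for a
  proof -
    have "(\<Sum>c\<in>UNIV. \<Sum>j<N. \<Sum>b\<in>strings j. iid_blocks N p (b @ a @ [c]))
       = (\<Sum>j<N. \<Sum>b\<in>strings j. \<Sum>c\<in>UNIV. iid_blocks N p ((b @ a) @ [c]))"
      by (subst sum.swap, rule sum.cong[OF refl], subst sum.swap) simp
    then show ?thesis
      unfolding block_process_def by (simp only: sum_divide_distrib[symmetric] iid_blocks_snoc)
  qed
  show "(\<Sum>c\<in>UNIV. block_process N p (c # a)) = block_process N p a" for a
  proof -
    let ?f = "\<lambda>j. \<Sum>b\<in>strings j. iid_blocks N p (b @ a)"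
    have "(\<Sum>c\<in>UNIV. \<Sum>j<N. \<Sum>b\<in>strings j. iid_blocks N p (b @ c # a)) = (\<Sum>j<N. ?f (Suc j))"
      by (subst sum.swap, rule sum.cong[OF refl], subst sum.swap) (simp add: sum_strings_snoc)
    also have "\<dots> = (\<Sum>j<N. ?f j) + ?f N - ?f 0"
      using sum.lessThan_Suc[of ?f N] sum.lessThan_Suc_shift[of ?f N] by simp
    also have "?f N = ?f 0"
      by (simp add: iid_blocks_append block_weight_sum flip: sum_distrib_right)
    finally show ?thesis
      unfolding block_process_def by (simp add: sum_divide_distrib[symmetric])
  qed
qed

text \<open>
  Entropy is concave, so the average over the starting position \<open>j\<close> has at least the average of the
  entropies. Starting \<open>j\<close> letters late costs at most the entropy of these \<open>j\<close> letters.
\<close>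

lemma block_entropy_block_process_ge:
  "- real m * (\<Sum>a\<in>strings N. p a * ln (p a)) - real N * ln (real CARD('a))
     \<le> block_entropy (m * N) (block_process N p)"
proof -
  let ?Q = "iid_blocks N p" and ?B = "block_process N p" and ?n = "m * N"
  define D where "D j a = (\<Sum>b\<in>strings j. ?Q (b @ a))" for j a
  note nn = iid_blocks_nonneg
  have Dnn: "0 \<le> D j a" for j a unfolding D_def by (intro sum_nonneg nn)
  have B: "?B a = (\<Sum>j<N. D j a) / real N" for a by (simp add: block_process_def D_def)
  have sumD: "(\<Sum>a\<in>strings n. D j a) = 1" for j n
    unfolding D_def by (subst sum.swap) (simp add: iid_blocks_append_right iid_blocks_sum)
  have QD: "?Q (b @ a) \<le> D (length b) a" for a b
    unfolding D_def by (rule le_sum_strings[where f = "\<lambda>b. ?Q (b @ a)"]) (rule nn)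
  have blocks: "(\<Sum>a\<in>strings (m * N). ?Q a * ln (?Q a)) = real m * (\<Sum>a\<in>strings N. p a * ln (p a))" for m
  proof (induction m)
    case 0 then show ?case by (simp add: iid_blocks_Nil)
  next
    case (Suc m)
    have "(\<Sum>a\<in>strings (Suc m * N). ?Q a * ln (?Q a))
        = (\<Sum>a\<in>strings N. \<Sum>b\<in>strings (m * N). (p a * ln (p a)) * ?Q b + p a * (?Q b * ln (?Q b)))"
      unfolding mult_Suc sum_strings_append
    proof (intro sum.cong refl)
      fix a b :: "'a list" assume a: "a \<in> strings N"
      show "?Q (a @ b) * ln (?Q (a @ b)) = (p a * ln (p a)) * ?Q b + p a * (?Q b * ln (?Q b))"
        by (cases "p a = 0 \<or> ?Q b = 0") (auto simp: iid_blocks_append[OF a] ln_mult algebra_simps)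
    qed
    also have "\<dots> = (\<Sum>a\<in>strings N. p a * ln (p a)) + (\<Sum>b\<in>strings (m * N). ?Q b * ln (?Q b))"
      by (simp add: sum.distrib iid_blocks_sum block_weight_sum flip: sum_distrib_left sum_distrib_right)
    finally show ?case using Suc by (simp add: algebra_simps)
  qed
  have D_ge: "(\<Sum>a\<in>strings ?n. D j a * ln (D j a))
      \<le> real m * (\<Sum>a\<in>strings N. p a * ln (p a)) + real N * ln (real CARD('a))" if j: "j < N" for j
  proof -
    let ?A = "real CARD('a)"
    \<comment> \<open>The \<open>j\<close> letters that were skipped are coded uniformly.\<close>
    define q where "q w = D j (drop j w) / ?A ^ j" for w
    have q: "q (b @ a) = D j a / ?A ^ j" if "b \<in> strings j" for a b
      using that by (simp add: q_def length_strings)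
    have "(\<Sum>w\<in>strings (j + ?n). ?Q w * ln (q w)) \<le> (\<Sum>w\<in>strings (j + ?n). ?Q w * ln (?Q w))"
    proof (rule gibbs)
      have "(\<Sum>w\<in>strings (j + ?n). q w) = (\<Sum>b\<in>(strings j :: 'a list set). \<Sum>a\<in>strings ?n. D j a / ?A ^ j)"
        unfolding sum_strings_append by (intro sum.cong refl) (rule q)
      also have "\<dots> = 1" by (simp add: sumD card_strings flip: sum_divide_distrib)
      finally show "sum q (strings (j + ?n)) \<le> sum ?Q (strings (j + ?n))" by (simp add: iid_blocks_sum)
      fix w :: "'a list" assume w: "w \<in> strings (j + ?n)"
      show "0 \<le> q w" by (simp add: q_def Dnn)
      assume "q w = 0"
      then have "D j (drop j w) = 0" by (simp add: q_def)
      with QD[of "take j w" "drop j w"] nn[of w] w show "?Q w = 0" by (simp add: length_strings)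
    qed (rule nn)
    also have "(\<Sum>w\<in>strings (j + ?n). ?Q w * ln (q w))
        = (\<Sum>b\<in>strings j. \<Sum>a\<in>strings ?n. ?Q (b @ a) * ln (D j a) - ?Q (b @ a) * (real j * ln ?A))"
      unfolding sum_strings_append
    proof (intro sum.cong refl)
      fix a b :: "'a list" assume b: "b \<in> strings j"
      show "?Q (b @ a) * ln (q (b @ a)) = ?Q (b @ a) * ln (D j a) - ?Q (b @ a) * (real j * ln ?A)"
      proof (cases "D j a = 0")
        case True then show ?thesis using QD[of b a] nn[of "b @ a"] b by (simp add: length_strings)
      next
        case False then show ?thesis by (simp add: q[OF b] ln_div ln_realpow right_diff_distrib)
      qed
    qed
    also have "\<dots> = (\<Sum>a\<in>strings ?n. D j a * ln (D j a)) - real j * ln ?A"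
    proof -
      have "(\<Sum>b\<in>strings j. \<Sum>a\<in>strings ?n. ?Q (b @ a) * (real j * ln ?A)) = real j * ln ?A"
        by (simp add: iid_blocks_append_right iid_blocks_sum flip: sum_distrib_right)
      moreover have "(\<Sum>b\<in>strings j. \<Sum>a\<in>strings ?n. ?Q (b @ a) * ln (D j a)) = (\<Sum>a\<in>strings ?n. D j a * ln (D j a))"
        by (subst sum.swap) (simp add: D_def flip: sum_distrib_right)
      ultimately show ?thesis by (simp add: sum_subtractf)
    qed
    also have "(\<Sum>w\<in>strings (j + ?n). ?Q w * ln (?Q w)) \<le> (\<Sum>a\<in>strings ?n. \<Sum>b\<in>strings j. ?Q (a @ b) * ln (?Q a))"
      unfolding add.commute[of j] sum_strings_append
    proof (intro sum_mono)
      fix a b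
      show "?Q (a @ b) * ln (?Q (a @ b)) \<le> ?Q (a @ b) * ln (?Q a)"
        using nn[of "a @ b"] iid_blocks_le[of a b] by (cases "?Q (a @ b) = 0") (auto intro!: mult_left_mono)
    qed
    also have "\<dots> = (\<Sum>a\<in>strings ?n. ?Q a * ln (?Q a))"
      by (simp add: iid_blocks_append_right flip: sum_distrib_right)
    finally have "(\<Sum>a\<in>strings ?n. D j a * ln (D j a)) \<le> real m * (\<Sum>a\<in>strings N. p a * ln (p a)) + real j * ln ?A"
      by (simp add: blocks)
    moreover have "real j * ln ?A \<le> real N * ln ?A"
      using j by (intro mult_right_mono) (auto simp: Suc_leI)
    ultimately show ?thesis by linarith
  qed
  have "(\<Sum>a\<in>strings ?n. ?B a * ln (?B a)) = (\<Sum>j<N. \<Sum>a\<in>strings ?n. D j a * ln (?B a)) / real N"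
    unfolding B by (subst sum.swap) (simp add: sum_divide_distrib sum_distrib_right)
  also have "\<dots> \<le> (\<Sum>j<N. real m * (\<Sum>a\<in>strings N. p a * ln (p a)) + real N * ln (real CARD('a))) / real N"
  proof (intro divide_right_mono sum_mono)
    fix j assume j: "j \<in> {..<N}"
    have "(\<Sum>a\<in>strings ?n. D j a * ln (?B a)) \<le> (\<Sum>a\<in>strings ?n. D j a * ln (D j a))"
    proof (rule gibbs)
      show "sum ?B (strings ?n) \<le> sum (D j) (strings ?n)"
        by (simp add: sumD stationary_sum[OF stationary_block_process])
      fix a :: "'a list" assume "?B a = 0"
      then have "(\<Sum>j<N. D j a) = 0" using block_length_pos by (simp add: B)
      then show "D j a = 0" using j by (subst (asm) sum_nonneg_eq_0_iff) (auto simp: Dnn)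
    qed (auto simp: Dnn stationary_nonneg[OF stationary_block_process])
    also have "\<dots> \<le> real m * (\<Sum>a\<in>strings N. p a * ln (p a)) + real N * ln (real CARD('a))"
      using D_ge j by simp
    finally show "(\<Sum>a\<in>strings ?n. D j a * ln (?B a)) \<le> real m * (\<Sum>a\<in>strings N. p a * ln (p a)) + real N * ln (real CARD('a))" .
  qed simp
  also have "\<dots> = real m * (\<Sum>a\<in>strings N. p a * ln (p a)) + real N * ln (real CARD('a))"
    using block_length_pos by simp
  finally show ?thesis
    unfolding block_entropy_stationary[OF stationary_block_process] by simp
qed

lemma filterlim_mult_block_length: "filterlim (\<lambda>m. m * N) sequentially sequentially"
  using block_length_pos by (intro filterlim_subseq) (auto simp: strict_mono_def)

lemma entropy_rate_block_process_ge:
  "- (\<Sum>a\<in>strings N. p a * ln (p a)) / real N \<le> entropy_rate (block_process N p)"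
proof -
  let ?H = "- (\<Sum>a\<in>strings N. p a * ln (p a))" and ?K = "real N * ln (real CARD('a))"
  have "(\<lambda>m. ?H / real N - ?K / real (m * N)) \<longlonglongrightarrow> ?H / real N - 0"
    by (intro tendsto_intros filterlim_compose[OF lim_const_over_n filterlim_mult_block_length])
  moreover have "(\<lambda>m. block_entropy (m * N) (block_process N p) / real (m * N)) \<longlonglongrightarrow> entropy_rate (block_process N p)"
    by (rule filterlim_compose[OF entropy_rate_limits(1)[OF stationary_block_process] filterlim_mult_block_length])
  moreover have "\<forall>\<^sub>F m in sequentially. ?H / real N - ?K / real (m * N) \<le> block_entropy (m * N) (block_process N p) / real (m * N)"
  proof (rule eventually_sequentiallyI[of 1])
    fix m :: nat assume m: "1 \<le> m"
    have "(real m * ?H - ?K) / real (m * N) \<le> block_entropy (m * N) (block_process N p) / real (m * N)"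
      using block_entropy_block_process_ge[of m] by (intro divide_right_mono) auto
    moreover have "(real m * ?H - ?K) / real (m * N) = ?H / real N - ?K / real (m * N)"
      using m block_length_pos unfolding diff_divide_distrib by simp
    ultimately show "?H / real N - ?K / real (m * N) \<le> block_entropy (m * N) (block_process N p) / real (m * N)"
      by simp
  qed
  ultimately show ?thesis by (intro tendsto_le[of sequentially]) (auto simp: trivial_limit_sequentially)
qed

text \<open>
  Cutting off each block in turn costs \<open>c N\<close>. The unfinished blocks at both ends contribute an amount
  that is bounded, or sublinear in the length of the string.
\<close>

lemma mean_rate_block_process_ge:
  assumes L: "almost_additive c L"
  shows "((\<Sum>a\<in>strings N. p a * L a) - c N) / real N \<le> mean_rate L (block_process N p)"
proof -
  let ?Q = "iid_blocks N p" and ?B = "block_process N p"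
  note LD = almost_additiveD[OF L] and nn = iid_blocks_nonneg
  define K where "K = (\<Sum>j<N. \<Sum>b\<in>strings j. \<bar>L b\<bar>) + c N"
  define M where "M = (\<Sum>a\<in>strings N. p a * L a) - c N"
  have K: "\<bar>L b\<bar> + c (length b) \<le> K" if "length b < N" for b
  proof -
    have "\<bar>L b\<bar> \<le> (\<Sum>b\<in>strings (length b). \<bar>L b\<bar>)"
      by (rule le_sum_strings[where f = "\<lambda>b. \<bar>L b\<bar>"]) simp
    also have "\<dots> \<le> (\<Sum>j<N. \<Sum>b\<in>strings j. \<bar>L b\<bar>)"
      using that by (intro member_le_sum[where f = "\<lambda>j. \<Sum>b\<in>strings j. \<bar>L b\<bar>"]) (auto intro!: sum_nonneg)
    finally show ?thesis using monoD[OF LD(2), of "length b" N] that by (simp add: K_def)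
  qed
  have blocks: "real m * M - K \<le> (\<Sum>a\<in>strings (m * N). ?Q a * L a)" for m
  proof (induction m)
    case 0
    then show ?case using K[of "[]"] LD(4)[of 0] block_length_pos by (simp add: iid_blocks_Nil)
  next
    case (Suc m)
    have "M + (\<Sum>b\<in>strings (m * N). ?Q b * L b)
       = (\<Sum>a\<in>strings N. \<Sum>b\<in>strings (m * N). p a * L a * ?Q b + p a * (?Q b * L b) - p a * ?Q b * c N)"
      by (simp add: sum.distrib sum_subtractf M_def block_weight_sum iid_blocks_sum flip: sum_distrib_left sum_distrib_right)
    also have "\<dots> \<le> (\<Sum>a\<in>strings N. \<Sum>b\<in>strings (m * N). ?Q (a @ b) * L (a @ b))"
    proof (intro sum_mono)
      fix a b :: "'a list" assume a: "a \<in> strings N"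
      have "p a * ?Q b * (L a + L b - c N) \<le> p a * ?Q b * L (a @ b)"
        using LD(1)[of a b] a by (intro mult_left_mono mult_nonneg_nonneg nn block_weight_nonneg) (auto simp: length_strings)
      then show "p a * L a * ?Q b + p a * (?Q b * L b) - p a * ?Q b * c N \<le> ?Q (a @ b) * L (a @ b)"
        by (simp add: iid_blocks_append[OF a] algebra_simps)
    qed
    also have "\<dots> = (\<Sum>a\<in>strings (Suc m * N). ?Q a * L a)" by (simp add: sum_strings_append)
    finally show ?case using Suc by (simp add: algebra_simps)
  qed
  have mean: "real m * M - 3 * K - c (m * N) \<le> block_mean L ?B (m * N)" for m
  proof -
    let ?n = "m * N"
    have "real m * M - 3 * K - c ?n \<le> (\<Sum>b\<in>strings j. \<Sum>a\<in>strings ?n. ?Q (b @ a) * L a)" if j: "j < N" for j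
    proof -
      have "(\<Sum>a\<in>strings ?n. ?Q a * L a) - K - c ?n
          = (\<Sum>a\<in>strings ?n. \<Sum>b\<in>strings j. ?Q (a @ b) * (L a - K - c ?n))"
        by (simp add: iid_blocks_append_right right_diff_distrib sum_subtractf iid_blocks_sum flip: sum_distrib_right)
      also have "\<dots> \<le> (\<Sum>a\<in>strings ?n. \<Sum>b\<in>strings j. ?Q (a @ b) * L (a @ b))"
      proof (intro sum_mono mult_left_mono nn)
        fix a b :: "'a list" assume "a \<in> strings ?n" "b \<in> strings j"
        with LD(1)[of a b] K[of b] LD(4)[of "length b"] j show "L a - K - c ?n \<le> L (a @ b)"
          by (simp add: length_strings)
      qed
      also have "\<dots> = (\<Sum>b\<in>strings j. \<Sum>a\<in>strings ?n. ?Q (b @ a) * L (b @ a))"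
        unfolding sum_strings_append[symmetric, where f = "\<lambda>w. ?Q w * L w"] by (simp only: add.commute)
      also have "\<dots> \<le> (\<Sum>b\<in>strings j. \<Sum>a\<in>strings ?n. ?Q (b @ a) * (L a + K))"
      proof (intro sum_mono mult_left_mono nn)
        fix a b :: "'a list" assume "a \<in> strings ?n" "b \<in> strings j"
        with LD(1)[of b a] K[of b] j show "L (b @ a) \<le> L a + K"
          by (simp add: length_strings)
      qed
      also have "\<dots> = (\<Sum>b\<in>strings j. \<Sum>a\<in>strings ?n. ?Q (b @ a) * L a) + K"
        by (simp add: iid_blocks_append_right distrib_left sum.distrib iid_blocks_sum flip: sum_distrib_right)
      finally show ?thesis using blocks[of m] by simp
    qed
    then have "(\<Sum>j<N. real m * M - 3 * K - c ?n) / real N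
        \<le> (\<Sum>j<N. \<Sum>b\<in>strings j. \<Sum>a\<in>strings ?n. ?Q (b @ a) * L a) / real N"
      by (intro divide_right_mono sum_mono) auto
    also have "(\<Sum>j<N. \<Sum>b\<in>strings j. \<Sum>a\<in>strings ?n. ?Q (b @ a) * L a) / real N = block_mean L ?B ?n"
    proof -
      have "block_mean L ?B ?n = (\<Sum>a\<in>strings ?n. \<Sum>j<N. \<Sum>b\<in>strings j. ?Q (b @ a) * L a) / real N"
        by (simp add: block_mean_def block_process_def sum_distrib_right sum_divide_distrib)
      also have "(\<Sum>a\<in>strings ?n. \<Sum>j<N. \<Sum>b\<in>strings j. ?Q (b @ a) * L a)
         = (\<Sum>j<N. \<Sum>b\<in>strings j. \<Sum>a\<in>strings ?n. ?Q (b @ a) * L a)"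
        by (subst sum.swap) (intro sum.cong refl sum.swap)
      finally show ?thesis by simp
    qed
    finally show ?thesis using block_length_pos by simp
  qed
  have "(\<lambda>m. M / real N - 3 * K / real (m * N) - c (m * N) / real (m * N)) \<longlonglongrightarrow> M / real N - 0 - 0"
    by (intro tendsto_intros filterlim_compose[OF lim_const_over_n filterlim_mult_block_length]
        filterlim_compose[OF LD(3) filterlim_mult_block_length])
  moreover have "(\<lambda>m. block_mean L ?B (m * N) / real (m * N)) \<longlonglongrightarrow> mean_rate L ?B"
    by (rule filterlim_compose[OF mean_rate_tendsto[OF stationary_block_process L] filterlim_mult_block_length])
  moreover have "\<forall>\<^sub>F m in sequentially. M / real N - 3 * K / real (m * N) - c (m * N) / real (m * N)
      \<le> block_mean L ?B (m * N) / real (m * N)"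
  proof (rule eventually_sequentiallyI[of 1])
    fix m :: nat assume m: "1 \<le> m"
    have "(real m * M - 3 * K - c (m * N)) / real (m * N) \<le> block_mean L ?B (m * N) / real (m * N)"
      using mean[of m] by (intro divide_right_mono) auto
    moreover have "(real m * M - 3 * K - c (m * N)) / real (m * N) = M / real N - 3 * K / real (m * N) - c (m * N) / real (m * N)"
      using m block_length_pos unfolding diff_divide_distrib by simp
    ultimately show "M / real N - 3 * K / real (m * N) - c (m * N) / real (m * N)
      \<le> block_mean L ?B (m * N) / real (m * N)" by simp
  qed
  ultimately show ?thesis unfolding M_def by (intro tendsto_le[of sequentially]) (auto simp: trivial_limit_sequentially)
qed

end


section \<open>Empirical measures\<close>

definition window :: "'a list \<Rightarrow> nat \<Rightarrow> nat \<Rightarrow> 'a list" where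
  "window x i k = map (periodic_extension x) [i..<i + k]"

lemma length_window [simp]: "length (window x i k) = k"
  by (simp add: window_def)

lemma window_strings [simp]: "window x i k \<in> strings k"
  by (simp add: strings_def)

lemma window_snoc: "window x i (Suc k) = window x i k @ [periodic_extension x (i + k)]"
  by (simp add: window_def)

lemma window_Cons: "window x i (Suc k) = periodic_extension x i # window x (Suc i) k"
  by (simp add: window_def upt_rec)

lemma nth_window [simp]: "j < k \<Longrightarrow> window x i k ! j = periodic_extension x (i + j)"
  by (simp add: window_def)

lemma window_period: "window x (length x) k = window x 0 k"
  by (intro nth_equalityI) (auto simp: periodic_extension_def)

lemma take_drop_window: "i + k \<le> m \<Longrightarrow> take k (drop i (window x 0 m)) = window x i k"
  by (intro nth_equalityI) auto

lemma window_full: "window x 0 (length x) = x"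
  by (intro nth_equalityI) (auto simp: periodic_extension_def)

lemma window_take_drop: "i + k \<le> length x \<Longrightarrow> window x i k = take k (drop i x)"
  using take_drop_window[of i k "length x" x] by (simp add: window_full)

lemma window_rotate:
  assumes "i < length x" shows "window x i (length x) = drop i x @ take i x"
proof (intro nth_equalityI)
  fix j assume "j < length (window x i (length x))"
  then have j: "j < length x" by simp
  show "window x i (length x) ! j = (drop i x @ take i x) ! j"
  proof (cases "i + j < length x")
    case True
    then have "j < length x - i" by simp
    with True show ?thesis using assms by (simp add: periodic_extension_def nth_append)
  next
    case False
    have "(i + j) mod length x = (i + j - length x) mod length x"
      using False by (intro le_mod_geq) simp
    also have "\<dots> = i + j - length x"
      by (rule mod_less) (use assms j in linarith)
    finally have "(i + j) mod length x = i + j - length x" .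
    moreover have "(drop i x @ take i x) ! j = x ! (j - (length x - i))"
    proof -
      have "j - (length x - i) < i" "\<not> j < length x - i" using False assms j by linarith+
      then show ?thesis by (simp add: nth_append)
    qed
    moreover have "j - (length x - i) = i + j - length x" using assms by linarith
    ultimately show ?thesis using j by (simp add: periodic_extension_def)
  qed
qed (use assms in simp)

lemma empirical_eq_sum:
  "empirical x a = (\<Sum>i<length x. if window x i (length a) = a then 1 else 0) / real (length x)"
proof -
  have "{i. i < length x \<and> window x i (length a) = a} = {i\<in>{..<length x}. window x i (length a) = a}" by auto
  then have "real (card {i. i < length x \<and> window x i (length a) = a})
      = (\<Sum>i<length x. if window x i (length a) = a then 1 else 0)"
    by (simp add: sum.If_cases Int_def)
  then show ?thesis by (simp add: empirical_def window_def)
qed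

lemma empirical_sum:
  fixes x :: "'a::finite list"
  shows "(\<Sum>a\<in>strings k. empirical x a * f a) = (\<Sum>i<length x. f (window x i k)) / real (length x)"
proof -
  have "(\<Sum>a\<in>strings k. empirical x a * f a)
      = (\<Sum>a\<in>strings k. \<Sum>i<length x. (if window x i k = a then f a else 0)) / real (length x)"
    unfolding empirical_eq_sum sum_divide_distrib
    by (intro sum.cong refl) (auto simp: sum_distrib_right length_strings sum_divide_distrib intro!: sum.cong)
  also have "(\<Sum>a\<in>strings k. \<Sum>i<length x. (if window x i k = a then f a else 0))
      = (\<Sum>i<length x. f (window x i k))"
    by (subst sum.swap) simp
  finally show ?thesis .
qed

text \<open>
  The windows are taken cyclically, so each position also has a predecessor: this is consistency on
  the left.
\<close>

lemma stationary_empirical: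
  fixes x :: "'a::finite list"
  assumes "x \<noteq> []" shows "stationary (empirical x)"
  unfolding stationary_def
proof (intro conjI allI)
  show "empirical x [] = 1" using assms by (simp add: empirical_eq_sum window_def)
  show "0 \<le> empirical x a" for a by (simp add: empirical_def)
  show "(\<Sum>b\<in>UNIV. empirical x (a @ [b])) = empirical x a" for a
  proof -
    have "(\<Sum>b\<in>UNIV. if window x i (length a) = a \<and> periodic_extension x (i + length a) = b then 1 else (0::real))
        = (if window x i (length a) = a then 1 else 0)" for i
      by (cases "window x i (length a) = a") simp_all
    then show ?thesis
      unfolding empirical_eq_sum sum_divide_distrib[symmetric]
      by (subst sum.swap) (simp add: window_snoc)
  qed
  show "(\<Sum>b\<in>UNIV. empirical x (b # a)) = empirical x a" for a
  proof -
    let ?f = "\<lambda>i. if window x i (length a) = a then 1 else (0::real)"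
    have "(\<Sum>b\<in>UNIV. if window x i (Suc (length a)) = b # a then 1 else (0::real)) = ?f (Suc i)" for i
      by (simp add: window_Cons)
    then have "(\<Sum>b\<in>UNIV. empirical x (b # a)) = (\<Sum>i<length x. ?f (Suc i)) / real (length x)"
      unfolding empirical_eq_sum sum_divide_distrib[symmetric] by (subst sum.swap) simp
    also have "(\<Sum>i<length x. ?f (Suc i)) = (\<Sum>i<length x. ?f i)"
      using sum.lessThan_Suc[of ?f "length x"] sum.lessThan_Suc_shift[of ?f "length x"] by (simp add: window_period)
    finally show ?thesis by (simp add: empirical_eq_sum)
  qed
qed

lemma empirical_window_pos: "i < length x \<Longrightarrow> 1 / real (length x) \<le> empirical x (window x i k)"
proof -
  assume i: "i < length x"
  let ?I = "{i'. i' < length x \<and> map (periodic_extension x) [i'..<i' + length (window x i k)] = window x i k}"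
  have "i \<in> ?I" using i by (simp add: window_def)
  then have "1 \<le> card ?I" by (auto simp: Suc_le_eq card_gt_0_iff)
  then show ?thesis unfolding empirical_def by (intro divide_right_mono) auto
qed

lemma cond_empirical_entropy_eq:
  "x \<noteq> [] \<Longrightarrow> cond_empirical_entropy k x = block_entropy k (empirical x) - block_entropy (k - 1) (empirical x)"
  by (simp add: cond_empirical_entropy_def cond_block_entropy_stationary stationary_empirical)

text \<open>
  A window that occurs has empirical probability at least \<open>1 / length x\<close>, so the block entropies stay
  below \<open>ln (length x)\<close>.
\<close>

lemma entropy_rate_empirical:
  assumes x: "x \<noteq> []" shows "entropy_rate (empirical x) = 0"
proof -
  note st = stationary_empirical[OF x]
  have n: "1 \<le> real (length x)" using x by (cases x) auto
  have "block_entropy k (empirical x) \<le> ln (real (length x))" for k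
  proof -
    have "- (\<Sum>a\<in>strings k. empirical x a * ln (empirical x a)) = - (\<Sum>i<length x. ln (empirical x (window x i k))) / real (length x)"
      by (simp add: empirical_sum)
    also have "\<dots> \<le> (\<Sum>i<length x. ln (real (length x))) / real (length x)"
      unfolding sum_negf[symmetric]
    proof (intro divide_right_mono sum_mono)
      fix i assume "i \<in> {..<length x}"
      then have "1 / real (length x) \<le> empirical x (window x i k)" by (simp add: empirical_window_pos)
      then have "ln (1 / real (length x)) \<le> ln (empirical x (window x i k))"
      proof (subst ln_le_cancel_iff)
        show pos: "0 < 1 / real (length x)" using n by (intro divide_pos_pos) linarith+
        with \<open>1 / real (length x) \<le> empirical x (window x i k)\<close>
        show "0 < empirical x (window x i k)" by linarith
      qed
      then show "- ln (empirical x (window x i k)) \<le> ln (real (length x))" using n x by (simp add: ln_div)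
    qed simp
    finally show ?thesis using n x by (simp add: block_entropy_stationary[OF st])
  qed
  then have "\<forall>k\<ge>0. block_entropy k (empirical x) / real k \<le> ln (real (length x)) / real k"
    by (auto intro: divide_right_mono)
  then have "entropy_rate (empirical x) \<le> 0"
    by (intro LIMSEQ_le[OF entropy_rate_limits(1)[OF st] lim_const_over_n]) blast
  with entropy_rate_nonneg[OF st] show ?thesis by simp
qed

text \<open>
  The windows of length \<open>n\<close> are the rotations of \<open>x\<close>. To cut a rotation into two pieces and to reassemble
  \<open>x\<close> costs at most \<open>2 * c n\<close>; a further \<open>c n / n\<close> is the distance of the mean over \<open>n\<close>-blocks from its
  limit.
\<close>

lemma mean_rate_empirical:
  assumes x: "x \<in> strings n" "0 < n" and L: "almost_additive c L"
  shows "\<bar>mean_rate L (empirical x) - L x / real n\<bar> \<le> 3 * c n / real n"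
proof -
  have len: "length x = n" "x \<noteq> []" using x by (auto simp: strings_def)
  note st = stationary_empirical[OF len(2)] and LD = almost_additiveD[OF L]
  have rot: "\<bar>L (window x i n) - L x\<bar> \<le> 2 * c n" if i: "i < n" for i
  proof -
    let ?u = "take i x" and ?v = "drop i x"
    have "window x i n = ?v @ ?u" using window_rotate[of i x] i len by simp
    moreover have "x = ?u @ ?v" by simp
    moreover have "\<bar>L (?v @ ?u) - L ?v - L ?u\<bar> \<le> c n" "\<bar>L (?u @ ?v) - L ?u - L ?v\<bar> \<le> c n"
      using LD(1)[of ?v ?u] LD(1)[of ?u ?v] monoD[OF LD(2), of "length ?v" n] monoD[OF LD(2), of "length ?u" n] len
      by auto
    ultimately show ?thesis by (smt (verit))
  qed
  have "block_mean L (empirical x) n - L x = (\<Sum>i<n. L (window x i n) - L x) / real n"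
    using x(2) by (simp add: block_mean_def empirical_sum len sum_subtractf diff_divide_distrib)
  also have "\<bar>\<dots>\<bar> \<le> (\<Sum>i<n. 2 * c n) / real n"
    unfolding abs_divide using rot by (intro divide_mono order_trans[OF sum_abs] sum_mono) (auto simp: x)
  also have "\<dots> = 2 * c n" using x(2) by simp
  finally have "\<bar>block_mean L (empirical x) n - L x\<bar> / real n \<le> 2 * c n / real n"
    by (rule divide_right_mono) simp
  moreover have "block_mean L (empirical x) n / real n - L x / real n = (block_mean L (empirical x) n - L x) / real n"
    by (simp add: diff_divide_distrib)
  ultimately have "\<bar>block_mean L (empirical x) n / real n - L x / real n\<bar> \<le> 2 * c n / real n"
    by (simp add: abs_divide)
  with mean_rate_bound[OF st L x(2)] show ?thesis by (simp add: abs_le_iff)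
qed

text \<open>
  The process of independent \<open>k\<close>-blocks, distributed like those of \<open>x\<close>, has entropy at least that of
  a block divided by \<open>k\<close>, and nearly the same mean of \<open>L\<close> as the periodic orbit of \<open>x\<close>, whose entropy is 0.
  A mixture of the two has any prescribed entropy in between.
\<close>

lemma invariant_measure_of_string:
  fixes x :: "'a::{finite,discrete_topology} list"
  assumes x: "x \<in> strings n" "0 < n" and k: "0 < k" and L: "almost_additive c L"
    and u: "0 \<le> u" "u \<le> block_entropy k (empirical x) / real k"
  shows "\<exists>\<nu>\<in>invariant_measures. entropy \<nu> = u \<and>
     L x / real n - 3 * c n / real n - 2 * c k / real k \<le> mean_rate L (\<lambda>a. measure \<nu> (cylinder a))"
proof -
  have xne: "x \<noteq> []" using x by (auto simp: strings_def)
  note E = stationary_empirical[OF xne]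
  let ?B = "block_process k (empirical x)"
  have bd: "block_dist k (empirical x)"
    using k by (auto simp: block_dist_def stationary_nonneg[OF E] stationary_sum[OF E])
  note B = stationary_block_process[OF bd]
  have hB: "u \<le> entropy_rate ?B"
    using u(2) entropy_rate_block_process_ge[OF bd] by (simp add: block_entropy_stationary[OF E])
  have mB: "mean_rate L (empirical x) - 2 * c k / real k \<le> mean_rate L ?B"
    using mean_rate_block_process_ge[OF bd L] mean_rate_bound[OF E L k]
    by (simp add: block_mean_def diff_divide_distrib abs_le_iff)
  define t where "t = (if entropy_rate ?B = 0 then 0 else u / entropy_rate ?B)"
  have t: "0 \<le> t" "t \<le> 1" "t * entropy_rate ?B = u"
    using hB u(1) entropy_rate_nonneg[OF B] by (auto simp: t_def)
  let ?m = "\<lambda>a. t * ?B a + (1 - t) * empirical x a"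
  have m: "stationary ?m" using t by (intro stationary_mixture B E) auto
  have "entropy_rate ?m = u"
    using t entropy_rate_mixture[OF B E, of t "1 - t"] by (simp add: entropy_rate_empirical[OF xne])
  moreover have "mean_rate L (empirical x) - 2 * c k / real k \<le> mean_rate L ?m"
  proof -
    let ?e = "mean_rate L (empirical x) - 2 * c k / real k"
    have "0 \<le> 2 * c k / real k" using almost_additiveD(4)[OF L, of k] by simp
    then have "t * ?e + (1 - t) * ?e \<le> t * mean_rate L ?B + (1 - t) * mean_rate L (empirical x)"
      using mB t by (intro add_mono mult_left_mono) auto
    moreover have "t * ?e + (1 - t) * ?e = ?e" by (simp only: distrib_right[symmetric]) simp
    ultimately show ?thesis using t by (subst mean_rate_mixture[OF B E L]) auto
  qed
  moreover obtain \<nu> where "\<nu> \<in> invariant_measures" and \<nu>: "\<And>a. measure \<nu> (cylinder a) = ?m a"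
    using stationary_extension[OF m] by auto
  ultimately show ?thesis
    using mean_rate_empirical[OF x L] by (intro bexI[of _ \<nu>]) (auto simp: entropy_eq_entropy_rate \<nu> abs_le_iff)
qed


section \<open>Counting strings by empirical measure\<close>

text \<open>
  The empirical probability of a block is one of the \<open>n + 1\<close> multiples of \<open>1 / n\<close>, for each of the
  \<open>CARD('a) ^ k\<close> blocks.
\<close>

lemma card_types:
  "real (card ((\<lambda>x. \<lambda>a\<in>strings k. empirical x a) ` (strings n :: 'a::finite list set)))
     \<le> real (n + 1) ^ (CARD('a) ^ k)"
proof -
  let ?V = "(\<lambda>i. real i / real n) ` {0..n}"
  have sub: "(\<lambda>x. \<lambda>a\<in>strings k. empirical x a) ` (strings n :: 'a list set) \<subseteq> (\<Pi>\<^sub>E a\<in>strings k. ?V)"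
  proof (intro image_subsetI restrict_PiE_iff[THEN iffD2] ballI)
    fix x a :: "'a list" assume "x \<in> strings n"
    then have len: "length x = n" by (simp add: strings_def)
    have "card {i. i < length x \<and> map (periodic_extension x) [i..<i + length a] = a} \<le> card {..<n}"
      by (intro card_mono) (auto simp: len)
    then show "empirical x a \<in> ?V" unfolding empirical_def len by (intro imageI) simp
  qed
  have "card ((\<lambda>x. \<lambda>a\<in>strings k. empirical x a) ` (strings n :: 'a list set)) \<le> card (\<Pi>\<^sub>E a\<in>(strings k :: 'a list set). ?V)"
    by (intro card_mono sub finite_PiE) auto
  also have "\<dots> = card ?V ^ (CARD('a) ^ k)"
    by (simp add: card_PiE card_strings)
  also have "\<dots> \<le> (n + 1) ^ (CARD('a) ^ k)"
    using card_image_le[of "{0..n}" "\<lambda>i. real i / real n"] by (intro power_mono) auto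
  finally show ?thesis by (metis of_nat_le_iff of_nat_power)
qed

lemma sum_strings_transitions_le:
  fixes q :: "'a::finite list \<Rightarrow> real"
  assumes q: "\<And>w. 0 \<le> q w" "\<And>u. u \<in> strings l \<Longrightarrow> (\<Sum>b\<in>UNIV. q (u @ [b])) \<le> 1"
  shows "(\<Sum>a\<in>strings (l + m). \<Prod>i<m. q (take (Suc l) (drop i a))) \<le> real CARD('a) ^ l"
proof (induction m)
  case 0 then show ?case by (simp add: card_strings)
next
  case (Suc m)
  have "(\<Sum>a\<in>strings (l + Suc m). \<Prod>i<Suc m. q (take (Suc l) (drop i a)))
      = (\<Sum>a\<in>strings (l + m). \<Sum>b\<in>UNIV. (\<Prod>i<m. q (take (Suc l) (drop i a))) * q (drop m a @ [b]))"
    unfolding add_Suc_right sum_strings_snoc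
  proof (intro sum.cong refl)
    fix a :: "'a list" and b assume "a \<in> strings (l + m)"
    then have "length a = l + m" by (simp add: strings_def)
    then show "(\<Prod>i<Suc m. q (take (Suc l) (drop i (a @ [b])))) = (\<Prod>i<m. q (take (Suc l) (drop i a))) * q (drop m a @ [b])"
      by (simp add: prod.lessThan_Suc)
  qed
  also have "\<dots> = (\<Sum>a\<in>strings (l + m). (\<Prod>i<m. q (take (Suc l) (drop i a))) * (\<Sum>b\<in>UNIV. q (drop m a @ [b])))"
    by (simp add: sum_distrib_left)
  also have "\<dots> \<le> (\<Sum>a\<in>strings (l + m). (\<Prod>i<m. q (take (Suc l) (drop i a))) * 1)"
    by (intro sum_mono mult_left_mono q prod_nonneg) (auto simp: strings_def q)
  finally show ?case using Suc by simp
qed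

text \<open>
  Consider the Markov chain of order \<open>k - 1\<close> with the transition probabilities of the empirical measure
  of \<open>x\<close>. A string \<open>y\<close> with the same empirical measure, continued cyclically by \<open>k - 1\<close> letters, has
  transition probabilities whose product is the summand. For each of the \<open>CARD('a) ^ (k - 1)\<close> initial
  states of the chain these products sum up to at most 1.
\<close>

lemma sum_type_class_le:
  fixes x :: "'a::finite list"
  assumes x: "x \<in> strings n" "0 < n" and k: "0 < k"
    and T: "T \<subseteq> strings n" "\<And>y a. y \<in> T \<Longrightarrow> a \<in> strings k \<Longrightarrow> empirical y a = empirical x a"
  shows "(\<Sum>y\<in>T. exp (- real n * cond_empirical_entropy k y)) \<le> real CARD('a) ^ (k - 1)"
proof -
  obtain l where l: "k = Suc l" using k by (cases k) auto
  have xne: "x \<noteq> []" using x by (auto simp: strings_def)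
  let ?p = "empirical x"
  note E = stationary_empirical[OF xne]
  define q where "q w = ?p w / ?p (butlast w)" for w
  have q0: "0 \<le> q w" for w by (simp add: q_def stationary_nonneg[OF E])
  have q1: "(\<Sum>b\<in>UNIV. q (u @ [b])) \<le> 1" for u
    by (simp add: q_def stationary_snoc[OF E] flip: sum_divide_distrib)
  have val: "(\<Prod>i<n. q (take (Suc l) (drop i (window y 0 (l + n))))) = exp (- real n * cond_empirical_entropy k y)"
    if y: "y \<in> T" for y
  proof -
    have ylen: "length y = n" "y \<noteq> []" using y T(1) x by (auto simp: strings_def)
    note Ey = stationary_empirical[OF ylen(2)]
    have eq: "empirical y w = ?p w" if "w \<in> strings (Suc l)" for w using T(2)[OF y] that l by simp
    have eq': "empirical y u = ?p u" if "u \<in> strings l" for u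
    proof -
      have "empirical y u = (\<Sum>b\<in>UNIV. empirical y (u @ [b]))" by (simp add: stationary_snoc[OF Ey])
      also have "\<dots> = (\<Sum>b\<in>UNIV. ?p (u @ [b]))"
        using that by (intro sum.cong refl eq) (simp add: strings_def)
      finally show ?thesis by (simp add: stationary_snoc[OF E])
    qed
    have pos: "0 < ?p (window y i (Suc l))" "0 < ?p (butlast (window y i (Suc l)))" if "i < n" for i
    proof -
      have "0 < 1 / real (length y)" using x(2) ylen(1) by simp
      also have "\<dots> \<le> ?p (window y i (Suc l))"
        using empirical_window_pos[of i y "Suc l"] that ylen eq by simp
      finally show *: "0 < ?p (window y i (Suc l))" .
      show "0 < ?p (butlast (window y i (Suc l)))"
        using less_le_trans[OF *[unfolded window_snoc] stationary_le_right[OF E]] by (simp add: window_snoc)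
    qed
    have "(\<Prod>i<n. q (take (Suc l) (drop i (window y 0 (l + n))))) = (\<Prod>i<n. q (window y i (Suc l)))"
      by (intro prod.cong refl) (simp add: take_drop_window)
    also have "\<dots> = exp (\<Sum>i<n. ln (q (window y i (Suc l))))"
      unfolding exp_sum[OF finite_lessThan] using pos by (intro prod.cong refl) (simp add: q_def)
    also have "(\<Sum>i<n. ln (q (window y i (Suc l))))
        = (\<Sum>i<n. ln (?p (window y i (Suc l))) - ln (?p (butlast (window y i (Suc l)))))"
    proof (intro sum.cong refl)
      fix i assume "i \<in> {..<n}"
      then have "i < n" by simp
      from pos[OF this] show "ln (q (window y i (Suc l))) = ln (?p (window y i (Suc l))) - ln (?p (butlast (window y i (Suc l))))"
        by (simp add: q_def ln_div)
    qed
    also have "\<dots> = real n * (\<Sum>w\<in>strings (Suc l). empirical y w * (ln (?p w) - ln (?p (butlast w))))"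
      using x(2) by (simp add: empirical_sum ylen)
    also have "(\<Sum>w\<in>strings (Suc l). empirical y w * (ln (?p w) - ln (?p (butlast w))))
        = (\<Sum>w\<in>strings (Suc l). empirical y w * ln (empirical y w)) - (\<Sum>w\<in>strings (Suc l). empirical y w * ln (empirical y (butlast w)))"
      unfolding sum_subtractf[symmetric]
      by (intro sum.cong refl) (simp add: eq eq' strings_def right_diff_distrib)
    also have "(\<Sum>w\<in>strings (Suc l). empirical y w * ln (empirical y (butlast w))) = - block_entropy l (empirical y)"
      unfolding sum_strings_snoc block_entropy_stationary[OF Ey]
      by (simp add: stationary_snoc[OF Ey] flip: sum_distrib_right)
    finally show ?thesis
      by (simp add: cond_empirical_entropy_eq[OF ylen(2)] l block_entropy_stationary[OF Ey, of "Suc l"] algebra_simps)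
  qed
  have inj: "inj_on (\<lambda>y. window y 0 (l + n)) T"
  proof (rule inj_onI)
    fix y z assume yz: "y \<in> T" "z \<in> T" and eq: "window y 0 (l + n) = window z 0 (l + n)"
    have "length y = n" "length z = n" using yz T(1) by (auto simp: strings_def)
    then show "y = z"
      using arg_cong[OF eq, of "\<lambda>w. take n (drop 0 w)"] window_full[of y] window_full[of z]
      by (simp only: take_drop_window)
  qed
  have "(\<Sum>y\<in>T. exp (- real n * cond_empirical_entropy k y))
     = (\<Sum>a\<in>(\<lambda>y. window y 0 (l + n)) ` T. \<Prod>i<n. q (take (Suc l) (drop i a)))"
    unfolding sum.reindex[OF inj] by (intro sum.cong refl) (simp add: val)
  also have "\<dots> \<le> (\<Sum>a\<in>strings (l + n). \<Prod>i<n. q (take (Suc l) (drop i a)))"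
    by (intro sum_mono2 prod_nonneg q0) auto
  also have "\<dots> \<le> real CARD('a) ^ l" by (rule sum_strings_transitions_le[OF q0 q1])
  finally show ?thesis by (simp add: l)
qed

text \<open>
  The preceding bound for each empirical measure, added up over all of them. With \<open>w = 1\<close> it counts
  strings of small conditional entropy; with the cylinder probabilities for \<open>w\<close> it gives the upper bound.
\<close>

lemma sum_le_type_count:
  fixes S :: "'a::finite list set"
  assumes S: "S \<subseteq> strings n" and n: "0 < n" and k: "0 < k"
    and w: "\<And>x. x \<in> S \<Longrightarrow> w x \<le> D * exp (- real n * cond_empirical_entropy k x)" and D: "0 \<le> D"
  shows "sum w S \<le> real (n + 1) ^ (CARD('a) ^ k) * real CARD('a) ^ (k - 1) * D"
proof -
  let ?A = "strings n :: 'a list set"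
  let ?f = "\<lambda>x. \<lambda>a\<in>strings k. empirical x a"
  let ?e = "\<lambda>x. exp (- real n * cond_empirical_entropy k x)"
  have "sum w S \<le> (\<Sum>x\<in>S. D * ?e x)" by (intro sum_mono w)
  also have "\<dots> \<le> (\<Sum>x\<in>?A. D * ?e x)" using S D by (intro sum_mono2) auto
  also have "\<dots> = D * (\<Sum>t\<in>?f ` ?A. \<Sum>y\<in>{y\<in>?A. ?f y = t}. ?e y)"
    by (simp add: sum_distrib_left flip: sum.image_gen)
  also have "\<dots> \<le> D * (\<Sum>t\<in>?f ` ?A. real CARD('a) ^ (k - 1))"
  proof (intro mult_left_mono sum_mono D)
    fix t assume "t \<in> ?f ` ?A"
    then obtain x where x: "x \<in> ?A" "t = ?f x" by auto
    show "(\<Sum>y\<in>{y\<in>?A. ?f y = t}. ?e y) \<le> real CARD('a) ^ (k - 1)"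
      proof (rule sum_type_class_le[OF x(1) n k])
      fix y a :: "'a list" assume "y \<in> {y\<in>?A. ?f y = t}" and a: "a \<in> strings k"
      then have "?f y a = ?f x a" by (simp add: x(2))
      then show "empirical y a = empirical x a" using a by simp
    qed auto
  qed
  also have "\<dots> \<le> D * (real (n + 1) ^ (CARD('a) ^ k) * real CARD('a) ^ (k - 1))"
    using card_types[of k n, where 'a = 'a] D by (auto intro!: mult_left_mono mult_right_mono simp del: of_nat_Suc)
  finally show ?thesis by (simp add: algebra_simps)
qed


section \<open>Typical words of an independent source\<close>

definition words :: "'b set \<Rightarrow> nat \<Rightarrow> 'b list set" where
  "words B M = {w. set w \<subseteq> B \<and> length w = M}"

lemma words_0: "words B 0 = {[]}"
  by (auto simp: words_def)

lemma finite_words: "finite B \<Longrightarrow> finite (words B M)"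
  unfolding words_def by (rule finite_lists_length_eq)

lemma sum_words_Suc:
  fixes f :: "'b list \<Rightarrow> real"
  assumes "finite B"
  shows "(\<Sum>w\<in>words B (Suc M). f w) = (\<Sum>b\<in>B. \<Sum>w\<in>words B M. f (b # w))"
proof -
  have "(\<Sum>b\<in>B. \<Sum>w\<in>words B M. f (b # w)) = (\<Sum>(b,w)\<in>B \<times> words B M. f (b # w))"
    by (simp add: sum.cartesian_product)
  also have "\<dots> = (\<Sum>w\<in>words B (Suc M). f w)"
    by (rule sum.reindex_bij_witness[where i = "\<lambda>w. (hd w, tl w)" and j = "\<lambda>(b,w). b # w"])
       (auto simp: words_def length_Suc_conv)
  finally show ?thesis by simp
qed

context
  fixes B :: "'b set" and p :: "'b \<Rightarrow> real"
  assumes B: "finite B" and p_nn: "\<And>b. 0 \<le> p b" and p_sum: "sum p B = 1"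
begin

abbreviation (input) "weight \<equiv> \<lambda>w. prod_list (map p w)"

lemma weight_nonneg: "0 \<le> weight w"
  by (induction w) (auto simp: p_nn)

lemma sum_prod_words: "(\<Sum>w\<in>words B M. weight w) = 1"
proof (induction M)
  case (Suc M)
  then show ?case by (simp add: sum_words_Suc[OF B] p_sum flip: sum_distrib_left)
qed (simp add: words_0)

lemma word_moments:
  assumes g: "(\<Sum>b\<in>B. p b * g b) = 0"
  shows "(\<Sum>w\<in>words B M. weight w * sum_list (map g w)) = 0"
    and "(\<Sum>w\<in>words B M. weight w * (sum_list (map g w))\<^sup>2) = real M * (\<Sum>b\<in>B. p b * (g b)\<^sup>2)"
proof -
  show 1: "(\<Sum>w\<in>words B M. weight w * sum_list (map g w)) = 0" for M
  proof (induction M)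
    case (Suc M)
    have "(\<Sum>w\<in>words B (Suc M). weight w * sum_list (map g w))
        = (\<Sum>b\<in>B. \<Sum>w\<in>words B M. (p b * g b) * weight w + p b * (weight w * sum_list (map g w)))"
      by (simp add: sum_words_Suc[OF B] algebra_simps)
    also have "\<dots> = 0"
      by (simp add: sum.distrib Suc g sum_prod_words flip: sum_distrib_left sum_distrib_right)
    finally show ?case .
  qed (simp add: words_0)
  show "(\<Sum>w\<in>words B M. weight w * (sum_list (map g w))\<^sup>2) = real M * (\<Sum>b\<in>B. p b * (g b)\<^sup>2)"
  proof (induction M)
    case (Suc M)
    have "(\<Sum>w\<in>words B (Suc M). weight w * (sum_list (map g w))\<^sup>2)
        = (\<Sum>b\<in>B. \<Sum>w\<in>words B M. (p b * (g b)\<^sup>2) * weight w + 2 * (p b * g b) * (weight w * sum_list (map g w))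
            + p b * (weight w * (sum_list (map g w))\<^sup>2))"
      by (simp add: sum_words_Suc[OF B] algebra_simps power2_eq_square)
    also have "\<dots> = (\<Sum>b\<in>B. p b * (g b)\<^sup>2) + real M * (\<Sum>b\<in>B. p b * (g b)\<^sup>2)"
      by (simp add: sum.distrib Suc 1 sum_prod_words p_sum flip: sum_distrib_left sum_distrib_right)
    finally show ?case by (simp add: algebra_simps)
  qed (simp add: words_0)
qed

lemma word_chebyshev:
  fixes f :: "'b \<Rightarrow> real"
  assumes eta: "0 < \<eta>" and M: "0 < M"
  defines "\<mu> \<equiv> \<Sum>b\<in>B. p b * f b"
  shows "(\<Sum>w | w \<in> words B M \<and> real M * \<eta> < \<bar>sum_list (map f w) - real M * \<mu>\<bar>. weight w)
    \<le> (\<Sum>b\<in>B. p b * (f b - \<mu>)\<^sup>2) / (real M * \<eta>\<^sup>2)"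
proof -
  let ?g = "\<lambda>b. f b - \<mu>"
  let ?Bad = "{w. w \<in> words B M \<and> real M * \<eta> < \<bar>sum_list (map f w) - real M * \<mu>\<bar>}"
  have g: "(\<Sum>b\<in>B. p b * ?g b) = 0"
    by (simp add: right_diff_distrib sum_subtractf \<mu>_def p_sum flip: sum_distrib_right)
  have sg: "sum_list (map ?g w) = sum_list (map f w) - real (length w) * \<mu>" for w
    by (induction w) (auto simp: algebra_simps)
  have "(\<Sum>w\<in>?Bad. weight w) * (real M * \<eta>)\<^sup>2 \<le> (\<Sum>w\<in>?Bad. weight w * (sum_list (map ?g w))\<^sup>2)"
    unfolding sum_distrib_right
  proof (intro sum_mono mult_left_mono weight_nonneg)
    fix w assume "w \<in> ?Bad"
    then have "real M * \<eta> \<le> \<bar>sum_list (map ?g w)\<bar>" by (simp add: sg words_def)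
    moreover have "0 \<le> real M * \<eta>" using eta by simp
    ultimately show "(real M * \<eta>)\<^sup>2 \<le> (sum_list (map ?g w))\<^sup>2" by (metis abs_of_nonneg abs_le_square_iff)
  qed
  also have "\<dots> \<le> (\<Sum>w\<in>words B M. weight w * (sum_list (map ?g w))\<^sup>2)"
    by (intro sum_mono2 finite_words B mult_nonneg_nonneg weight_nonneg) auto
  also have "\<dots> = real M * (\<Sum>b\<in>B. p b * (?g b)\<^sup>2)" by (rule word_moments(2)[OF g])
  finally have "(\<Sum>w\<in>?Bad. weight w) * (real M * \<eta>\<^sup>2) * real M \<le> (\<Sum>b\<in>B. p b * (?g b)\<^sup>2) * real M"
    by (simp add: power2_eq_square algebra_simps)
  then have "(\<Sum>w\<in>?Bad. weight w) * (real M * \<eta>\<^sup>2) \<le> (\<Sum>b\<in>B. p b * (?g b)\<^sup>2)"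
    using M by (simp add: mult.commute)
  then show ?thesis using eta M by (subst pos_le_divide_eq) auto
qed

text \<open>
  By Chebyshev's inequality, words whose averages of \<open>f\<close> and \<open>ln p\<close> are close to the expectations have
  probability at least 1/2. Each of them has probability at most \<open>exp (M * (\<eta> - H))\<close>, where \<open>H\<close> is the
  entropy of \<open>p\<close>, so there must be many of them.
\<close>

lemma typical_words:
  fixes f :: "'b \<Rightarrow> real"
  assumes eta: "0 < \<eta>"
  shows "\<exists>M0. \<forall>M\<ge>M0. \<exists>W\<subseteq>words B M.
     exp (real M * (- (\<Sum>b\<in>B. p b * ln (p b)) - 2 * \<eta>)) \<le> real (card W) \<and>
     (\<forall>w\<in>W. (\<forall>b\<in>set w. 0 < p b) \<and>
        real M * ((\<Sum>b\<in>B. p b * f b) - \<eta>) \<le> sum_list (map f w) \<and>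
        real M * ((\<Sum>b\<in>B. p b * ln (p b)) - \<eta>) \<le> sum_list (map (\<lambda>b. ln (p b)) w))"
proof -
  let ?\<mu> = "\<Sum>b\<in>B. p b * f b" and ?h = "\<Sum>b\<in>B. p b * ln (p b)"
  define V where "V = (\<Sum>b\<in>B. p b * (f b - ?\<mu>)\<^sup>2) + (\<Sum>b\<in>B. p b * (ln (p b) - ?h)\<^sup>2)"
  obtain M0 :: nat where M0: "max (2 * V / \<eta>\<^sup>2) (ln 2 / \<eta>) < real M0" using reals_Archimedean2 by blast
  show ?thesis
  proof (intro exI[of _ "Suc M0"] allI impI)
    fix M assume M: "Suc M0 \<le> M"
    then have Mp: "0 < M" by simp
    have M1: "2 * V / \<eta>\<^sup>2 \<le> real M" "ln 2 / \<eta> \<le> real M" using M0 M by auto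
    define B1 where "B1 = {w. w \<in> words B M \<and> real M * \<eta> < \<bar>sum_list (map f w) - real M * ?\<mu>\<bar>}"
    define B2 where "B2 = {w. w \<in> words B M \<and> real M * \<eta> < \<bar>sum_list (map (\<lambda>b. ln (p b)) w) - real M * ?h\<bar>}"
    define W where "W = {w\<in>words B M. 0 < weight w} - B1 - B2"
    have fin: "finite (words B M)" by (rule finite_words[OF B])
    have sub: "W \<subseteq> words B M" by (auto simp: W_def)
    have Wf: "finite W" using sub fin finite_subset by blast
    have "1 = (\<Sum>w\<in>words B M. weight w)" by (simp add: sum_prod_words)
    also have "\<dots> = (\<Sum>w\<in>{w\<in>words B M. 0 < weight w}. weight w)"
      using fin weight_nonneg by (intro sum.mono_neutral_right) (auto simp: order.order_iff_strict)
    also have "\<dots> \<le> (\<Sum>w\<in>W \<union> (B1 \<union> B2). weight w)"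
      using fin by (intro sum_mono2 weight_nonneg) (auto simp: W_def B1_def B2_def)
    also have "\<dots> \<le> (\<Sum>w\<in>W. weight w) + (\<Sum>w\<in>B1. weight w) + (\<Sum>w\<in>B2. weight w)"
    proof -
      have "(\<Sum>w\<in>X \<union> Y. weight w) \<le> (\<Sum>w\<in>X. weight w) + (\<Sum>w\<in>Y. weight w)" if "finite X" "finite Y" for X Y
        using sum.union_inter[OF that, of weight] sum_nonneg[of "X \<inter> Y" weight] weight_nonneg by fastforce
      from this[of W "B1 \<union> B2"] this[of B1 B2] show ?thesis
        using Wf fin by (fastforce simp: B1_def B2_def)
    qed
    also have "(\<Sum>w\<in>B1. weight w) \<le> (\<Sum>b\<in>B. p b * (f b - ?\<mu>)\<^sup>2) / (real M * \<eta>\<^sup>2)"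
      unfolding B1_def by (rule word_chebyshev[OF eta Mp])
    also have "(\<Sum>w\<in>B2. weight w) \<le> (\<Sum>b\<in>B. p b * (ln (p b) - ?h)\<^sup>2) / (real M * \<eta>\<^sup>2)"
      unfolding B2_def by (rule word_chebyshev[OF eta Mp])
    finally have "1 \<le> (\<Sum>w\<in>W. weight w) + V / (real M * \<eta>\<^sup>2)"
      by (simp add: V_def add_divide_distrib)
    moreover have "V / (real M * \<eta>\<^sup>2) \<le> 1 / 2"
    proof -
      have "2 * V \<le> real M * \<eta>\<^sup>2" using M1(1) eta by (simp add: pos_divide_le_eq)
      then show ?thesis using Mp eta by (simp add: divide_simps)
    qed
    ultimately have half: "1 / 2 \<le> (\<Sum>w\<in>W. weight w)" by linarith
    have pos: "0 < p b" if "w \<in> W" "b \<in> set w" for w b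
    proof -
      have "weight w \<noteq> 0" using that by (auto simp: W_def)
      then have "p b \<noteq> 0" using that(2) by (auto simp: prod_list_zero_iff)
      then show ?thesis using p_nn[of b] by simp
    qed
    have lnP: "ln (weight w) = sum_list (map (\<lambda>b. ln (p b)) w)" if "\<forall>b\<in>set w. 0 < p b" for w
      using that
    proof (induction w)
      case (Cons b w)
      from Cons.prems have "\<forall>b\<in>set w. 0 < p b" by simp
      then have "0 < weight w" by (induction w) auto
      with Cons show ?case by (simp add: ln_mult)
    qed simp
    have "(\<Sum>w\<in>W. weight w) \<le> (\<Sum>w\<in>W. exp (real M * (?h + \<eta>)))"
    proof (intro sum_mono)
      fix w assume w: "w \<in> W"
      then have "0 < weight w" by (simp add: W_def)
      then have "weight w = exp (ln (weight w))" by simp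
      also have "\<dots> \<le> exp (real M * (?h + \<eta>))"
        using w lnP[of w] pos[OF w] by (auto simp: W_def B2_def algebra_simps)
      finally show "weight w \<le> exp (real M * (?h + \<eta>))" .
    qed
    with half have "1 / 2 \<le> real (card W) * exp (real M * (?h + \<eta>))" by simp
    then have "1 / 2 * exp (- (real M * (?h + \<eta>))) \<le> real (card W) * (exp (real M * (?h + \<eta>)) * exp (- (real M * (?h + \<eta>))))"
      by (simp add: mult_right_mono flip: mult.assoc)
    then have "1 / 2 * exp (- (real M * (?h + \<eta>))) \<le> real (card W)" by (simp flip: exp_add)
    moreover have "exp (real M * (- ?h - 2 * \<eta>)) \<le> 1 / 2 * exp (- (real M * (?h + \<eta>)))"
    proof -
      have "ln 2 \<le> real M * \<eta>" using M1(2) eta by (simp add: pos_divide_le_eq)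
      then have "exp (real M * (- ?h - 2 * \<eta>)) \<le> exp (- (real M * (?h + \<eta>)) - ln 2)"
        by (simp add: algebra_simps)
      then show ?thesis by (simp add: exp_diff)
    qed
    ultimately have card: "exp (real M * (- ?h - 2 * \<eta>)) \<le> real (card W)" by linarith
    show "\<exists>W\<subseteq>words B M. exp (real M * (- ?h - 2 * \<eta>)) \<le> real (card W) \<and>
     (\<forall>w\<in>W. (\<forall>b\<in>set w. 0 < p b) \<and> real M * (?\<mu> - \<eta>) \<le> sum_list (map f w) \<and>
        real M * (?h - \<eta>) \<le> sum_list (map (\<lambda>b. ln (p b)) w))"
      using sub card pos by (intro exI[of _ W]) (auto simp: W_def B1_def B2_def algebra_simps)
  qed
qed

end


section \<open>Concatenations of typical blocks\<close>

lemma concat_blocks: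
  assumes "\<forall>b\<in>set w. length b = N"
  shows "length (concat w) = length w * N"
    and "take (m * N) (concat w) = concat (take m w)"
    and "drop (m * N) (concat w) = concat (drop m w)"
proof -
  show "length (concat w) = length w * N" using assms by (induction w) auto
  show "take (m * N) (concat w) = concat (take m w)"
    using assms
  proof (induction w arbitrary: m)
    case (Cons b w) then show ?case by (cases m) auto
  qed simp
  show "drop (m * N) (concat w) = concat (drop m w)"
    using assms
  proof (induction w arbitrary: m)
    case (Cons b w) then show ?case by (cases m) auto
  qed simp
qed

lemma iid_blocks_concat:
  assumes "block_dist N p" "\<forall>b\<in>set w. b \<in> strings N"
  shows "iid_blocks N p (concat w) = prod_list (map p w)"
  using assms(2) by (induction w) (auto simp: iid_blocks_append[OF assms(1)] iid_blocks_Nil[OF assms(1)])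

text \<open>
  The condition on \<open>j\<close> says that the window from \<open>i\<close> to \<open>i + k\<close> meets block \<open>j\<close>. The concatenation of
  these blocks extends the window to the left and to the right. One summand of the block process,
  namely that of the true offset \<open>i mod N\<close> and the true letters before the window, is at least the
  product of the probabilities of these blocks.
\<close>

lemma block_process_window_ge:
  fixes p :: "'a::finite list \<Rightarrow> real"
  assumes bd: "block_dist N p" and w: "\<forall>b\<in>set w. b \<in> strings N \<and> 0 < p b"
    and k: "0 < k" and i: "i + k \<le> length w * N"
  shows "- ln (block_process N p (take k (drop i (concat w))))
     \<le> ln (real N) - (\<Sum>j | j < length w \<and> j * N < i + k \<and> i < j * N + N. ln (p (w ! j)))"
    and "0 < block_process N p (take k (drop i (concat w)))"
proof -
  have N: "0 < N" by (rule block_length_pos[OF bd])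
  have wN: "\<forall>b\<in>set w. length b = N" using w by (auto simp: strings_def)
  note cb = concat_blocks[OF wN]
  let ?y = "concat w" and ?a = "take k (drop i (concat w))"
  let ?J = "{j. j < length w \<and> j * N < i + k \<and> i < j * N + N}"
  define j0 j1 where "j0 = i div N" and "j1 = (i + k - 1) div N"
  define s where "s = i mod N"
  have i_eq: "i = j0 * N + s" and s: "s < N" using N by (auto simp: j0_def s_def)
  have j01: "j0 \<le> j1" unfolding j0_def j1_def using k by (intro div_le_mono) simp
  have j1lt: "j1 < length w"
    unfolding j1_def using i k N by (subst div_less_iff_less_mult) auto
  have j1N: "i + k \<le> (Suc j1) * N"
  proof -
    have "i + k - 1 < Suc j1 * N"
      unfolding j1_def using N dividend_less_div_times[of N "i + k - 1"] by simp
    then show ?thesis using k by linarith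
  qed
  have J: "?J = {j0..<Suc j1}"
  proof (intro set_eqI iffI)
    fix j assume j: "j \<in> ?J"
    then have "i div N < Suc j" using N by (subst div_less_iff_less_mult) auto
    moreover have "j \<le> j1" unfolding j1_def using j k N by (subst less_eq_div_iff_mult_less_eq) auto
    ultimately show "j \<in> {j0..<Suc j1}" by (simp add: j0_def)
  next
    fix j assume j: "j \<in> {j0..<Suc j1}"
    have "j * N \<le> j1 * N" using j by (intro mult_right_mono) auto
    also have "j1 * N \<le> i + k - 1" unfolding j1_def by (simp add: div_times_less_eq_dividend)
    finally have 1: "j * N < i + k" using k by linarith
    have "j0 * N \<le> j * N" using j by (intro mult_right_mono) auto
    then have "i < j * N + N" using i_eq s by linarith
    with 1 j j1lt show "j \<in> ?J" by auto
  qed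
  let ?ws = "take (Suc j1 - j0) (drop j0 w)"
  let ?c = "concat ?ws"
  have c: "?c = take ((Suc j1 - j0) * N) (drop (j0 * N) ?y)"
  proof -
    have "\<forall>b\<in>set (drop j0 w). length b = N" using wN by (auto dest: in_set_dropD)
    from concat_blocks(2)[OF this, of "Suc j1 - j0"] show ?thesis unfolding cb(3)[of j0] by (rule sym)
  qed
  define b where "b = take s (drop (j0 * N) ?y)"
  have ba: "b @ ?a = take (s + k) (drop (j0 * N) ?y)"
    unfolding b_def i_eq take_add drop_drop by (simp only: add.commute)
  have len: "s + k \<le> (Suc j1 - j0) * N"
    using j1N i_eq j01 by (simp add: diff_mult_distrib)
  have pre: "?c = (b @ ?a) @ drop (s + k) ?c"
  proof -
    have "take (s + k) ?c = b @ ?a"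
      unfolding ba c take_take by (simp only: min_absorb1[OF len])
    then show ?thesis using append_take_drop_id[of "s + k" ?c] by (simp only:)
  qed
  have bl: "b \<in> strings s"
  proof -
    have "j0 * N + s \<le> length w * N" using i i_eq by linarith
    then show ?thesis by (simp add: b_def strings_def cb(1))
  qed
  have wset: "set ?ws \<subseteq> set w" by (rule subset_trans[OF set_take_subset set_drop_subset])
  have Qc: "iid_blocks N p ?c = prod_list (map p ?ws)"
    using w wset by (intro iid_blocks_concat[OF bd]) auto
  have ws_eq: "?ws = map (\<lambda>j. w ! j) [j0..<Suc j1]"
    by (rule nth_equalityI) (use j1lt j01 in \<open>auto simp del: upt_Suc\<close>)
  have prodpos: "0 < p (w ! j)" if "j \<in> {j0..<Suc j1}" for j
    using that j1lt w by auto
  have "prod_list (map p ?ws) = (\<Prod>j\<in>{j0..<Suc j1}. p (w ! j))"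
    unfolding ws_eq map_map comp_def by (rule prod.distinct_set_conv_list[symmetric, of "[j0..<Suc j1]", simplified set_upt]) (rule distinct_upt)
  then have Qprod: "iid_blocks N p ?c = (\<Prod>j\<in>{j0..<Suc j1}. p (w ! j))" unfolding Qc .
  have lnQ: "ln (iid_blocks N p ?c) = (\<Sum>j\<in>{j0..<Suc j1}. ln (p (w ! j)))"
    unfolding Qprod by (rule ln_prod) (metis finite_atLeastLessThan order_less_irrefl prodpos)+
  have Qpos: "0 < iid_blocks N p ?c"
    unfolding Qprod by (rule prod_pos) (auto intro: prodpos)
  have "iid_blocks N p ?c \<le> iid_blocks N p (b @ ?a)"
    by (subst pre) (rule iid_blocks_le[OF bd])
  also have "\<dots> \<le> (\<Sum>b\<in>strings s. iid_blocks N p (b @ ?a))"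
    by (rule member_le_sum) (auto simp: bl iid_blocks_nonneg[OF bd])
  also have "\<dots> \<le> (\<Sum>j<N. \<Sum>b\<in>strings j. iid_blocks N p (b @ ?a))"
    using s by (intro member_le_sum[where f = "\<lambda>j. \<Sum>b\<in>strings j. iid_blocks N p (b @ ?a)"])
       (auto intro!: sum_nonneg iid_blocks_nonneg[OF bd])
  finally have "iid_blocks N p ?c / real N \<le> block_process N p ?a"
    unfolding block_process_def by (rule divide_right_mono) simp
  moreover have pos: "0 < iid_blocks N p ?c / real N" using Qpos N by simp
  ultimately show *: "0 < block_process N p ?a" by linarith
  have "ln (iid_blocks N p ?c / real N) \<le> ln (block_process N p ?a)"
    using \<open>iid_blocks N p ?c / real N \<le> block_process N p ?a\<close> pos * by simp
  then show "- ln (block_process N p ?a) \<le> ln (real N) - (\<Sum>j\<in>?J. ln (p (w ! j)))"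
    unfolding J lnQ[symmetric] using Qpos N by (simp add: ln_div)
qed

text \<open>
  Windows are coded by the equal mixture of the block process and the uniform distribution. The
  first is efficient for windows inside the concatenated blocks; the at most \<open>k + N\<close> other windows,
  which meet the tail or wrap around, use the second. Each block is met by at most \<open>k + N\<close> windows.
\<close>

lemma block_entropy_concat_le:
  fixes p :: "'a::finite list \<Rightarrow> real"
  assumes bd: "block_dist N p" and w: "\<forall>b\<in>set w. b \<in> strings N \<and> 0 < p b"
    and k: "0 < k" and t: "length t \<le> N" and n: "length (concat w @ t) = n" "0 < n"
  shows "real n * block_entropy k (empirical (concat w @ t)) \<le>
     real n * (ln 2 + ln (real N)) + real (k + N) * (real k * ln (real CARD('a)))
     - real (k + N) * sum_list (map (\<lambda>b. ln (p b)) w)"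
proof -
  let ?x = "concat w @ t" and ?B = "block_process N p" and ?A = "real CARD('a)"
  let ?M = "length w"
  have N: "0 < N" by (rule block_length_pos[OF bd])
  have wN: "\<forall>b\<in>set w. length b = N" using w by (auto simp: strings_def)
  have lc: "length (concat w) = ?M * N" by (rule concat_blocks(1)[OF wN])
  have xne: "?x \<noteq> []" using n by auto
  note E = stationary_empirical[OF xne] and SB = stationary_block_process[OF bd]
  define m where "m a = ?B a / 2 + 1 / (2 * ?A ^ k)" for a
  define cost where "cost j = - ln (p (w ! j))" for j
  have cost0: "0 \<le> cost j" if "j < ?M" for j
  proof -
    have wj: "w ! j \<in> strings N" "0 < p (w ! j)" using w that by auto
    have "p (w ! j) \<le> (\<Sum>a\<in>strings N. p a)" by (rule member_le_sum) (auto simp: wj block_weight_nonneg[OF bd])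
    then show ?thesis using wj(2) by (simp add: cost_def block_weight_sum[OF bd])
  qed
  have A: "1 \<le> ?A" by simp
  have mpos: "1 / (2 * ?A ^ k) \<le> m a" "0 < 1 / (2 * ?A ^ k)" "?B a / 2 \<le> m a" for a
    using stationary_nonneg[OF SB, of a] by (auto simp: m_def)
  then have mpos': "0 < m a" for a by (metis less_le_trans)
  have "block_entropy k (empirical ?x) \<le> - (\<Sum>a\<in>strings k. empirical ?x a * ln (m a))"
  proof (rule block_entropy_le_cross_entropy[OF E])
    show "0 \<le> m a" "m a = 0 \<Longrightarrow> empirical ?x a = 0" for a using mpos'[of a] by auto
    show "(\<Sum>a\<in>strings k. m a) \<le> 1"
      by (simp add: m_def sum.distrib card_strings stationary_sum[OF SB] flip: sum_divide_distrib)
  qed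
  also have "\<dots> = (\<Sum>i<n. - ln (m (window ?x i k))) / real n"
    unfolding empirical_sum n(1) by (simp add: sum_negf)
  finally have "real n * block_entropy k (empirical ?x) \<le> (\<Sum>i<n. - ln (m (window ?x i k)))"
    using n(2) by (simp add: pos_le_divide_eq mult.commute)
  also have "\<dots> \<le> (\<Sum>i<n. ln 2 + ln (real N) + (if i + k \<le> ?M * N then 0 else real k * ln ?A)
        + (\<Sum>j<?M. if j * N < i + k \<and> i < j * N + N then cost j else 0))"
  proof (intro sum_mono)
    fix i
    let ?S = "\<Sum>j<?M. if j * N < i + k \<and> i < j * N + N then cost j else 0"
    have S: "?S = - (\<Sum>j | j < ?M \<and> j * N < i + k \<and> i < j * N + N. ln (p (w ! j)))"
      unfolding cost_def sum_negf[symmetric]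
      by (subst sum.inter_filter[symmetric]) (auto intro!: sum.cong)
    have S0: "0 \<le> ?S" using cost0 by (intro sum_nonneg) auto
    show "- ln (m (window ?x i k)) \<le> ln 2 + ln (real N) + (if i + k \<le> ?M * N then 0 else real k * ln ?A) + ?S"
    proof (cases "i + k \<le> ?M * N")
      case True
      have win: "window ?x i k = take k (drop i (concat w))"
        using True lc by (subst window_take_drop) auto
      note ge = block_process_window_ge[OF bd w k True]
      have "ln (?B (window ?x i k) / 2) \<le> ln (m (window ?x i k))"
        using ge(2) mpos(3)[of "window ?x i k"] mpos'[of "window ?x i k"] by (subst ln_le_cancel_iff) (auto simp: win)
      then show ?thesis using ge True by (simp add: S win ln_div)
    next
      case False
      have "ln (1 / (2 * ?A ^ k)) \<le> ln (m (window ?x i k))"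
        using mpos mpos' by (subst ln_le_cancel_iff) auto
      moreover have "0 \<le> ln (real N)" using N by simp
      ultimately show ?thesis using False S0 by (simp add: ln_div ln_mult ln_realpow)
    qed
  qed
  also have "\<dots> = real n * (ln 2 + ln (real N)) + (\<Sum>i<n. if i + k \<le> ?M * N then 0 else real k * ln ?A)
      + (\<Sum>i<n. \<Sum>j<?M. if j * N < i + k \<and> i < j * N + N then cost j else 0)"
    by (simp add: sum.distrib algebra_simps)
  also have "(\<Sum>i<n. if i + k \<le> ?M * N then 0 else real k * ln ?A) \<le> real (k + N) * (real k * ln ?A)"
  proof -
    have "(\<Sum>i<n. if i + k \<le> ?M * N then 0 else real k * ln ?A)
        = (\<Sum>i\<in>{i\<in>{..<n}. \<not> i + k \<le> ?M * N}. real k * ln ?A)"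
      by (subst sum.inter_filter) (auto intro!: sum.cong)
    also have "\<dots> = real (card {i\<in>{..<n}. \<not> i + k \<le> ?M * N}) * (real k * ln ?A)" by simp
    also have "\<dots> \<le> real (k + N) * (real k * ln ?A)"
    proof (intro mult_right_mono)
      have "{i\<in>{..<n}. \<not> i + k \<le> ?M * N} \<subseteq> {?M * N - k..<?M * N + N}"
        using n(1) lc t by auto
      then have "card {i\<in>{..<n}. \<not> i + k \<le> ?M * N} \<le> card {?M * N - k..<?M * N + N}"
        by (intro card_mono) auto
      then show "real (card {i\<in>{..<n}. \<not> i + k \<le> ?M * N}) \<le> real (k + N)" by simp
    qed simp
    finally show ?thesis .
  qed
  also have "(\<Sum>i<n. \<Sum>j<?M. if j * N < i + k \<and> i < j * N + N then cost j else 0)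
      \<le> (\<Sum>j<?M. real (k + N) * cost j)"
  proof (subst sum.swap, intro sum_mono)
    fix j assume j: "j \<in> {..<?M}"
    have "(\<Sum>i<n. if j * N < i + k \<and> i < j * N + N then cost j else 0)
        = (\<Sum>i\<in>{i\<in>{..<n}. j * N < i + k \<and> i < j * N + N}. cost j)"
      by (rule sum.inter_filter[symmetric]) simp
    also have "\<dots> = real (card {i\<in>{..<n}. j * N < i + k \<and> i < j * N + N}) * cost j" by simp
    also have "\<dots> \<le> real (k + N) * cost j"
    proof (intro mult_right_mono cost0)
      have "card {i\<in>{..<n}. j * N < i + k \<and> i < j * N + N} \<le> card {j * N - k..<j * N + N}"
        by (intro card_mono) auto
      then show "real (card {i\<in>{..<n}. j * N < i + k \<and> i < j * N + N}) \<le> real (k + N)" by simp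
    qed (use j in simp)
    finally show "(\<Sum>i<n. if j * N < i + k \<and> i < j * N + N then cost j else 0) \<le> real (k + N) * cost j" .
  qed
  also have "(\<Sum>j<?M. real (k + N) * cost j) = - (real (k + N) * sum_list (map (\<lambda>b. ln (p b)) w))"
    by (simp add: cost_def sum_list_sum_nth sum_negf sum_distrib_left atLeast0LessThan)
  finally show ?thesis by simp
qed

lemma almost_additive_concat_ge:
  fixes L :: "'a::finite list \<Rightarrow> real"
  assumes L: "almost_additive c L" and "\<forall>b\<in>set w. length b = N"
  shows "sum_list (map L w) - real (length w) * c N + L t \<le> L (concat w @ t)"
  using assms(2)
proof (induction w)
  case (Cons b w)
  then show ?case using almost_additiveD(1)[OF L, of b "concat w @ t"] by (simp add: algebra_simps)
qed simp

text \<open>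
  For large \<open>n\<close>, concatenate a typical word of \<open>n div N\<close> blocks of length \<open>N\<close> and fill up to length \<open>n\<close> by
  a fixed tail. The number of such strings and their values of \<open>L\<close> are read off the typical words,
  and the bound on the block entropy is that for concatenations.
\<close>

lemma typical_strings:
  fixes p :: "'a::finite list \<Rightarrow> real" and k :: "nat \<Rightarrow> nat"
  assumes p: "stationary p" and L: "almost_additive c L" and N: "0 < N" and d: "0 < \<delta>"
    and k: "filterlim k at_top sequentially" "(\<lambda>n. real (k n) / real n) \<longlonglongrightarrow> 0"
  shows "\<forall>\<^sub>F n in sequentially. \<exists>G\<subseteq>strings n.
     exp (real n * (block_entropy N p / real N - \<delta>)) \<le> real (card G) \<and>
     (\<forall>x\<in>G. real n * ((block_mean L p N - c N) / real N - \<delta>) \<le> L x \<and>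
        block_entropy (k n) (empirical x) / real (k n) \<le> block_entropy N p / real N + \<delta>)"
proof -
  define \<eta> where "\<eta> = \<delta> / 4"
  have eta: "0 < \<eta>" using d by (simp add: \<eta>_def)
  define H \<mu> where "H = block_entropy N p" and "\<mu> = block_mean L p N"
  have bd: "block_dist N p"
    using N by (simp add: block_dist_def stationary_nonneg[OF p] stationary_sum[OF p])
  have H_eq: "(\<Sum>b\<in>strings N. p b * ln (p b)) = - H" by (simp add: H_def block_entropy_stationary[OF p])
  have H0: "0 \<le> H" unfolding H_def by (rule block_entropy_nonneg[OF p])
  have mu_eq: "(\<Sum>b\<in>strings N. p b * L b) = \<mu>" by (simp add: \<mu>_def block_mean_def)
  from typical_words[OF finite_strings stationary_nonneg[OF p] stationary_sum[OF p] eta, of N L]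
  obtain M0 where M0: "\<And>M. M \<ge> M0 \<Longrightarrow> \<exists>W\<subseteq>words (strings N) M. exp (real M * (H - 2 * \<eta>)) \<le> real (card W) \<and>
     (\<forall>w\<in>W. (\<forall>b\<in>set w. 0 < p b) \<and> real M * (\<mu> - \<eta>) \<le> sum_list (map L w) \<and>
        real M * (- H - \<eta>) \<le> sum_list (map (\<lambda>b. ln (p b)) w))"
    unfolding H_eq mu_eq by auto
  \<comment> \<open>\<open>K\<close> bounds \<open>L\<close> on the tail, and \<open>y\<close> is the guaranteed gain of \<open>L\<close> per block.\<close>
  define K where "K = (\<Sum>r<N. \<bar>L (replicate r undefined)\<bar>)"
  define y where "y = \<mu> - c N - \<eta>"
  have ev1: "\<forall>\<^sub>F n in sequentially. M0 \<le> n div N"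
    using N by (intro eventually_sequentiallyI[of "M0 * N"]) (simp add: less_eq_div_iff_mult_less_eq)
  have ev2: "\<forall>\<^sub>F n in sequentially. C \<le> real n * \<eta>" for C
  proof -
    obtain n0 :: nat where "C / \<eta> < real n0" using reals_Archimedean2 by blast
    then have "C \<le> real n * \<eta>" if "n \<ge> n0" for n
      using that eta by (metis less_imp_le less_le_trans of_nat_le_iff pos_divide_le_eq)
    then show ?thesis by (rule eventually_sequentiallyI)
  qed
  have k': "(\<lambda>n. C / real (k n)) \<longlonglongrightarrow> 0" for C
    by (rule filterlim_compose[OF lim_const_over_n k(1)])
  \<comment> \<open>The terms of the entropy bound that vanish as \<open>n\<close> grows, after division by \<open>n * k n\<close>.\<close>
  define R where "R n = (ln 2 + ln (real N)) / real (k n) + (real (k n) / real n + real N / real n) * ln (real CARD('a))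
      + (H + \<eta>) / real (k n)" for n
  have "R \<longlonglongrightarrow> 0 + (0 + 0) * ln (real CARD('a)) + 0"
    unfolding R_def by (intro tendsto_intros k' k(2) lim_const_over_n)
  then have ev3: "\<forall>\<^sub>F n in sequentially. R n < \<eta>"
    using eta by (intro order_tendstoD(2)[of R 0]) simp_all
  have ev4: "\<forall>\<^sub>F n in sequentially. 1 \<le> k n"
    using k(1) by (simp add: filterlim_at_top)
  show ?thesis
    using ev1 ev2[of "2 * H"] ev2[of "\<bar>y\<bar> + K"] ev3 ev4 eventually_gt_at_top[of 0]
  proof eventually_elim
    case (elim n)
    define M r where "M = n div N" and "r = n mod N"
    have n_eq: "n = M * N + r" and r: "r < N" using N by (auto simp: M_def r_def)
    have n0: "0 < real n" using elim by simp
    have Mn: "real M * real N \<le> real n" "real n \<le> real M * real N + real N"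
      using n_eq r by (metis of_nat_add of_nat_le_iff of_nat_mult le_add1, metis add_left_mono less_imp_le of_nat_add of_nat_le_iff of_nat_mult)
    have Mn': "real M \<le> real n / real N" "real n / real N - 1 \<le> real M"
      using Mn N by (auto simp: field_simps)
    from M0[of M] elim(1) obtain W where W: "W \<subseteq> words (strings N) M"
      "exp (real M * (H - 2 * \<eta>)) \<le> real (card W)"
      "\<And>w. w \<in> W \<Longrightarrow> (\<forall>b\<in>set w. 0 < p b) \<and> real M * (\<mu> - \<eta>) \<le> sum_list (map L w) \<and>
        real M * (- H - \<eta>) \<le> sum_list (map (\<lambda>b. ln (p b)) w)"
      unfolding M_def by blast
    define t :: "'a list" where "t = replicate r undefined"
    let ?f = "\<lambda>w. concat w @ t"
    have wprop: "set w \<subseteq> strings N" "length w = M" "\<forall>b\<in>set w. length b = N" if "w \<in> W" for w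
      using that W(1) by (auto simp: words_def strings_def)
    have len: "length (?f w) = n" if "w \<in> W" for w
      using concat_blocks(1)[OF wprop(3)[OF that]] wprop(2)[OF that] by (simp add: t_def n_eq)
    have inj: "inj_on ?f W"
    proof (rule inj_onI)
      fix v w assume vw: "v \<in> W" "w \<in> W" "?f v = ?f w"
      have "\<forall>(x, y)\<in>set (zip v w). length x = length y"
        using wprop(3)[OF vw(1)] wprop(3)[OF vw(2)] by (auto simp: set_zip)
      with vw show "v = w" using wprop(2)[OF vw(1)] wprop(2)[OF vw(2)] concat_eq_concat_iff[of v w] by simp
    qed
    have lt: "- K \<le> L t"
    proof -
      have "\<bar>L t\<bar> \<le> K" unfolding K_def t_def
        using r by (intro member_le_sum[where f = "\<lambda>r. \<bar>L (replicate r undefined)\<bar>"]) auto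
      then show ?thesis by linarith
    qed
    show ?case
    proof (intro exI[of _ "?f ` W"] conjI ballI)
      show "?f ` W \<subseteq> strings n" using len by (auto simp: strings_def)
      have "real n * (H / real N - \<delta>) \<le> real M * (H - 2 * \<eta>)"
      proof -
        have "real n / real N * H - H \<le> real M * H"
          using mult_right_mono[OF Mn'(2) H0] by (simp add: algebra_simps)
        moreover have "real M * (2 * \<eta>) \<le> real n * (2 * \<eta>)"
        proof (intro mult_right_mono)
          show "real M \<le> real n" using n_eq N by (cases N) auto
        qed (use eta in simp)
        moreover have "real n * (H / real N - \<delta>) = real n / real N * H - 4 * (real n * \<eta>)"
          by (simp add: \<eta>_def algebra_simps)
        moreover have "real M * (H - 2 * \<eta>) = real M * H - real M * (2 * \<eta>)"
          by (simp add: algebra_simps)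
        moreover have "0 \<le> real n * \<eta>" using eta by simp
        ultimately show ?thesis using elim(2) by linarith
      qed
      then have "exp (real n * (H / real N - \<delta>)) \<le> exp (real M * (H - 2 * \<eta>))" by simp
      also have "\<dots> \<le> real (card (?f ` W))" using W(2) by (simp add: card_image[OF inj])
      finally show "exp (real n * (block_entropy N p / real N - \<delta>)) \<le> real (card (?f ` W))"
        by (simp add: H_def)
    next
      fix x assume "x \<in> ?f ` W"
      then obtain w where w: "w \<in> W" "x = ?f w" by auto
      have "real M * y - K \<le> sum_list (map L w) - real (length w) * c N + L t"
        using W(3)[OF w(1)] lt wprop(2)[OF w(1)] by (simp add: y_def algebra_simps)
      also have "\<dots> \<le> L x" unfolding w(2) by (rule almost_additive_concat_ge[OF L wprop(3)[OF w(1)]])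
      finally have Lx: "real M * y - K \<le> L x" .
      have y1: "real n / real N * y - \<bar>y\<bar> \<le> real M * y"
      proof (cases "0 \<le> y")
        case True
        then show ?thesis using mult_right_mono[OF Mn'(2) True] by (simp add: algebra_simps)
      next
        case False
        then show ?thesis using mult_right_mono_neg[OF Mn'(1), of y] by simp
      qed
      have y2: "real n / real N * y = real n * ((\<mu> - c N) / real N) - real n / real N * \<eta>"
        by (simp add: y_def algebra_simps diff_divide_distrib add_divide_distrib)
      have y3: "real n / real N * \<eta> \<le> real n * \<eta>"
        using N eta n0 by (intro mult_right_mono) (auto simp: divide_le_eq Suc_le_eq)
      have "real n * ((block_mean L p N - c N) / real N - \<delta>) = real n * ((\<mu> - c N) / real N) - 4 * (real n * \<eta>)"
        by (simp add: \<mu>_def \<eta>_def algebra_simps)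
      moreover have "0 \<le> real n * \<eta>" using eta by simp
      ultimately show "real n * ((block_mean L p N - c N) / real N - \<delta>) \<le> L x"
        using y1 y2 y3 Lx elim(3) by linarith
    next
      fix x assume "x \<in> ?f ` W"
      then obtain w where w: "w \<in> W" "x = ?f w" by auto
      let ?k = "k n"
      have k0: "0 < ?k" "0 < real ?k" using elim(5) by auto
      have "real n * block_entropy ?k (empirical x) \<le> real n * (ln 2 + ln (real N)) + real (?k + N) * (real ?k * ln (real CARD('a)))
     - real (?k + N) * sum_list (map (\<lambda>b. ln (p b)) w)"
        unfolding w(2)
        using W(3)[OF w(1)] wprop(1)[OF w(1)] len[OF w(1)] r elim(6) k0
        by (intro block_entropy_concat_le[OF bd]) (auto simp: t_def)
      also have "\<dots> \<le> real n * (ln 2 + ln (real N)) + real (?k + N) * (real ?k * ln (real CARD('a)))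
         + real (?k + N) * (real n / real N * (H + \<eta>))"
      proof -
        have "- sum_list (map (\<lambda>b. ln (p b)) w) \<le> real M * (H + \<eta>)"
          using W(3)[OF w(1)] by (simp add: algebra_simps)
        also have "\<dots> \<le> real n / real N * (H + \<eta>)" using Mn'(1) H0 eta by (intro mult_right_mono) auto
        finally have "real (?k + N) * (- sum_list (map (\<lambda>b. ln (p b)) w)) \<le> real (?k + N) * (real n / real N * (H + \<eta>))"
          by (rule mult_left_mono) simp
        then show ?thesis by simp
      qed
      finally have "real n * block_entropy ?k (empirical x) / (real n * real ?k)
          \<le> (real n * (ln 2 + ln (real N)) + real (?k + N) * (real ?k * ln (real CARD('a)))
         + real (?k + N) * (real n / real N * (H + \<eta>))) / (real n * real ?k)"
        by (rule divide_right_mono) simp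
      also have "\<dots> = R n + (H + \<eta>) / real N"
        using n0 k0 N by (simp add: R_def field_simps)
      also have "\<dots> \<le> H / real N + \<delta>"
      proof -
        have "\<eta> / real N \<le> \<eta>" using N eta by (simp add: divide_le_eq Suc_le_eq)
        then show ?thesis using elim(4) d by (simp add: \<eta>_def add_divide_distrib)
      qed
      finally show "block_entropy ?k (empirical x) / real ?k \<le> block_entropy N p / real N + \<delta>"
        using n0 by (simp add: H_def)
    qed
  qed
qed


section \<open>Weak Gibbs property of equilibrium states\<close>

definition modulus :: "((nat \<Rightarrow> 'a) \<Rightarrow> real) \<Rightarrow> nat \<Rightarrow> real" where
  "modulus \<phi> n = Sup {\<bar>\<phi> x - \<phi> y\<bar> | x y. pre n x = pre n y}"

lemma continuous_bounded:
  fixes \<phi> :: "(nat \<Rightarrow> 'a::{finite,discrete_topology}) \<Rightarrow> real"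
  assumes "continuous_on UNIV \<phi>" obtains C where "\<And>x. \<bar>\<phi> x\<bar> \<le> C"
proof -
  have "bounded (range \<phi>)"
    by (rule compact_imp_bounded[OF compact_continuous_image[OF assms compact_sequences]])
  then show ?thesis using that by (auto simp: bounded_iff)
qed

text \<open>
  That the modulus tends to 0 is uniform continuity: by compactness, finitely many cylinders on which
  \<open>\<phi>\<close> oscillates by less than \<open>e\<close> cover the space.
\<close>

lemma modulus:
  fixes \<phi> :: "(nat \<Rightarrow> 'a::{finite,discrete_topology}) \<Rightarrow> real"
  assumes cont: "continuous_on UNIV \<phi>"
  shows modulus_bound: "pre n x = pre n y \<Longrightarrow> \<bar>\<phi> x - \<phi> y\<bar> \<le> modulus \<phi> n"
    and antimono_modulus: "antimono (modulus \<phi>)"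
    and modulus_tendsto: "modulus \<phi> \<longlonglongrightarrow> 0"
    and modulus_nonneg: "0 \<le> modulus \<phi> n"
proof -
  let ?D = "\<lambda>n. {\<bar>\<phi> x - \<phi> y\<bar> | x y. pre n x = pre n y}"
  obtain C where C: "\<And>x. \<bar>\<phi> x\<bar> \<le> C" using continuous_bounded[OF cont] by blast
  have "d \<le> 2 * C" if "d \<in> ?D n" for d n
  proof -
    from that obtain x y where "d = \<bar>\<phi> x - \<phi> y\<bar>" by auto
    with C[of x] C[of y] show ?thesis by linarith
  qed
  then have bdd: "bdd_above (?D n)" for n by (rule bdd_aboveI)
  show bound: "\<bar>\<phi> x - \<phi> y\<bar> \<le> modulus \<phi> n" if "pre n x = pre n y" for x y n
    unfolding modulus_def using that by (intro cSup_upper bdd) auto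
  show nn: "0 \<le> modulus \<phi> n" for n
    using bound[of n undefined undefined] by simp
  show anti: "antimono (modulus \<phi>)"
  proof (rule antimonoI)
    fix m n :: nat assume "m \<le> n"
    then show "modulus \<phi> n \<le> modulus \<phi> m"
      unfolding modulus_def
    proof (intro cSup_subset_mono bdd)
      show "?D n \<subseteq> ?D m" using \<open>m \<le> n\<close> unfolding pre_eq_iff by (smt (verit) Collect_mono less_le_trans)
    qed auto
  qed
  have small: "\<exists>n. modulus \<phi> n \<le> e" if e: "0 < e" for e
  proof -
    have "\<forall>x. \<exists>n. cylinder (pre n x) \<subseteq> {y. \<bar>\<phi> y - \<phi> x\<bar> < e / 2}"
    proof
      fix x
      have "open (\<phi> -` ball (\<phi> x) (e/2))"
        using cont by (intro open_vimage) auto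
      moreover have "x \<in> \<phi> -` ball (\<phi> x) (e/2)" using e by simp
      ultimately obtain n where "cylinder (pre n x) \<subseteq> \<phi> -` ball (\<phi> x) (e/2)"
        using open_contains_cylinder by blast
      then show "\<exists>n. cylinder (pre n x) \<subseteq> {y. \<bar>\<phi> y - \<phi> x\<bar> < e / 2}"
        by (intro exI[of _ n]) (auto simp: dist_real_def abs_minus_commute)
    qed
    then obtain N where N: "\<And>x. cylinder (pre (N x) x) \<subseteq> {y. \<bar>\<phi> y - \<phi> x\<bar> < e / 2}" by metis
    have "UNIV \<subseteq> (\<Union>x\<in>UNIV. cylinder (pre (N x) x))" by (auto simp: cylinder_iff)
    then obtain D where D: "finite D" "UNIV \<subseteq> (\<Union>x\<in>D. cylinder (pre (N x) x))"
      using compactE_image[OF compact_sequences, of UNIV "\<lambda>x. cylinder (pre (N x) x)"] open_cylinder by auto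
    obtain n where n: "\<forall>x\<in>D. N x \<le> n"
      using D(1) finite_nat_set_iff_bounded_le[of "N ` D"] by auto
    have "\<bar>\<phi> x - \<phi> y\<bar> \<le> e" if xy: "pre n x = pre n y" for x y
    proof -
      obtain z where z: "z \<in> D" "x \<in> cylinder (pre (N z) z)" using D(2) by auto
      then have "y \<in> cylinder (pre (N z) z)"
        using xy n by (auto simp: cylinder_iff pre_eq_iff)
      with z N[of z] have "\<bar>\<phi> x - \<phi> z\<bar> < e/2" "\<bar>\<phi> y - \<phi> z\<bar> < e/2" by auto
      then show ?thesis by linarith
    qed
    then have "modulus \<phi> n \<le> e" unfolding modulus_def by (intro cSup_least) auto
    then show ?thesis ..
  qed
  show "modulus \<phi> \<longlonglongrightarrow> 0"
  proof (rule LIMSEQ_I)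
    fix e :: real assume "0 < e"
    then obtain n0 where "modulus \<phi> n0 \<le> e / 2" using small[of "e/2"] by auto
    then have "norm (modulus \<phi> n - 0) < e" if "n \<ge> n0" for n
      using antimonoD[OF anti that] nn[of n] \<open>0 < e\<close> by simp
    then show "\<exists>no. \<forall>n\<ge>no. norm (modulus \<phi> n - 0) < e" by blast
  qed
qed

lemma pre_pad_append: "pre (length a) (pad (a @ b)) = pre (length a) (pad a)"
  by (auto simp: pre_eq_iff pad_def nth_append)

text \<open>
  The Birkhoff sum of \<open>\<phi>\<close> over the first \<open>length a\<close> points of the orbit of \<open>pad a\<close>, as the shift of
  \<open>pad (b # a)\<close> is \<open>pad a\<close>.
\<close>

primrec birkhoff :: "((nat \<Rightarrow> 'a) \<Rightarrow> real) \<Rightarrow> 'a list \<Rightarrow> real" where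
  "birkhoff \<phi> [] = 0"
| "birkhoff \<phi> (b # a) = \<phi> (pad (b # a)) + birkhoff \<phi> a"

definition sum_modulus :: "((nat \<Rightarrow> 'a) \<Rightarrow> real) \<Rightarrow> nat \<Rightarrow> real" where
  "sum_modulus \<phi> m = (\<Sum>i<m. modulus \<phi> (Suc i))"

context
  fixes \<phi> :: "(nat \<Rightarrow> 'a::{finite,discrete_topology}) \<Rightarrow> real"
  assumes cont: "continuous_on UNIV \<phi>"
begin

lemma mono_sum_modulus: "mono (sum_modulus \<phi>)"
  unfolding sum_modulus_def by (intro monoI sum_mono2 modulus_nonneg[OF cont]) auto

lemma sum_modulus_tendsto: "(\<lambda>m. sum_modulus \<phi> m / real m) \<longlonglongrightarrow> 0"
  unfolding sum_modulus_def by (intro cesaro_mean_tendsto LIMSEQ_Suc modulus_tendsto[OF cont])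

lemma birkhoff_append: "\<bar>birkhoff \<phi> (a @ b) - birkhoff \<phi> a - birkhoff \<phi> b\<bar> \<le> sum_modulus \<phi> (length a)"
proof (induction a)
  case (Cons x a)
  have "\<bar>\<phi> (pad ((x # a) @ b)) - \<phi> (pad (x # a))\<bar> \<le> modulus \<phi> (length (x # a))"
    by (rule modulus_bound[OF cont pre_pad_append])
  with Cons show ?case by (simp add: sum_modulus_def)
qed (simp add: sum_modulus_def)

lemma almost_additive_birkhoff: "almost_additive (sum_modulus \<phi>) (birkhoff \<phi>)"
  by (simp add: almost_additive_def mono_sum_modulus sum_modulus_tendsto birkhoff_append)

lemma integral_cylinder_sum:
  assumes \<nu>: "\<nu> \<in> invariant_measures"
  shows "\<bar>integral\<^sup>L \<nu> \<phi> - (\<Sum>a\<in>strings n. measure \<nu> (cylinder a) * \<phi> (pad a))\<bar> \<le> modulus \<phi> n"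
proof -
  interpret prob_space \<nu> using \<nu> by (simp add: invariant_measures_def)
  have sets: "sets \<nu> = sets borel" using \<nu> by (simp add: invariant_measures_def)
  have cyl: "cylinder a \<in> sets \<nu>" for a by (simp add: sets)
  define f where "f x = (\<Sum>a\<in>strings n. \<phi> (pad a) * indicator (cylinder a) x)" for x
  have f: "f x = \<phi> (pad (pre n x))" for x
  proof -
    have "f x = (\<Sum>a\<in>strings n. if a = pre n x then \<phi> (pad a) else 0)"
      unfolding f_def by (intro sum.cong refl) (auto simp: indicator_def cylinder_iff strings_def)
    then show ?thesis by simp
  qed
  obtain C where C: "\<And>x. \<bar>\<phi> x\<bar> \<le> C" using continuous_bounded[OF cont] by blast
  have "\<phi> \<in> borel_measurable borel" by (rule borel_measurable_continuous_onI[OF cont])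
  then have m: "\<phi> \<in> borel_measurable \<nu>" by (simp add: measurable_cong_sets[OF sets refl])
  have int: "integrable \<nu> \<phi>" by (rule integrable_const_bound[of _ C]) (auto simp: C m)
  have fi: "has_bochner_integral \<nu> f (\<Sum>a\<in>strings n. \<phi> (pad a) * prob (cylinder a))"
    unfolding f_def
    by (intro has_bochner_integral_sum has_bochner_integral_mult_right has_bochner_integral_real_indicator cyl)
       (auto simp: emeasure_eq_measure)
  have close: "\<bar>\<phi> x - f x\<bar> \<le> modulus \<phi> n" for x
    unfolding f by (rule modulus_bound[OF cont]) (simp add: pre_pad[of _ n])
  have "\<bar>integral\<^sup>L \<nu> \<phi> - integral\<^sup>L \<nu> f\<bar> = \<bar>\<integral>x. \<phi> x - f x \<partial>\<nu>\<bar>"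
    using int fi by (simp add: has_bochner_integral_iff)
  also have "\<dots> \<le> (\<integral>x. \<bar>\<phi> x - f x\<bar> \<partial>\<nu>)" by (rule integral_abs_bound)
  also have "\<dots> \<le> (\<integral>x. modulus \<phi> n \<partial>\<nu>)"
    using int fi close by (intro integral_mono) (auto simp: has_bochner_integral_iff)
  also have "\<dots> = modulus \<phi> n" by (simp add: prob_space)
  finally show ?thesis
    using has_bochner_integral_integral_eq[OF fi] by (simp add: mult.commute)
qed

text \<open>
  By consistency on the left, the means of the Birkhoff sums over \<open>n\<close>-blocks and over \<open>(n + 1)\<close>-blocks differ by
  an approximation of the integral. Hence the mean rate is a limit of Cesaro means.
\<close>

lemma mean_rate_birkhoff:
  assumes \<nu>: "\<nu> \<in> invariant_measures"
  shows "mean_rate (birkhoff \<phi>) (\<lambda>a. measure \<nu> (cylinder a)) = integral\<^sup>L \<nu> \<phi>"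
proof -
  let ?p = "\<lambda>a. measure \<nu> (cylinder a)"
  note p = invariant_stationary[OF \<nu>]
  define d where "d n = (\<Sum>a\<in>strings n. ?p a * \<phi> (pad a))" for n
  have "d \<longlonglongrightarrow> integral\<^sup>L \<nu> \<phi>"
  proof (rule LIM_zero_cancel, rule Lim_null_comparison[OF _ modulus_tendsto[OF cont]])
    show "\<forall>\<^sub>F n in sequentially. norm (d n - integral\<^sup>L \<nu> \<phi>) \<le> modulus \<phi> n"
      using integral_cylinder_sum[OF \<nu>] by (simp add: d_def abs_minus_commute)
  qed
  then have "(\<lambda>n. (\<Sum>i<n. d (Suc i)) / real n) \<longlonglongrightarrow> integral\<^sup>L \<nu> \<phi>"
    by (intro cesaro_mean_tendsto LIMSEQ_Suc)
  moreover have "(\<Sum>i<n. d (Suc i)) = block_mean (birkhoff \<phi>) ?p n" for n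
  proof (induction n)
    case 0 then show ?case by (simp add: block_mean_def)
  next
    case (Suc n)
    have "block_mean (birkhoff \<phi>) ?p (Suc n)
       = d (Suc n) + (\<Sum>b\<in>UNIV. \<Sum>a\<in>strings n. ?p (b # a) * birkhoff \<phi> a)"
      by (simp add: block_mean_def d_def sum_strings_Cons distrib_left sum.distrib)
    also have "(\<Sum>b\<in>UNIV. \<Sum>a\<in>strings n. ?p (b # a) * birkhoff \<phi> a) = block_mean (birkhoff \<phi>) ?p n"
      by (subst sum.swap) (simp add: block_mean_def stationary_Cons[OF p] flip: sum_distrib_right)
    finally show ?case using Suc by simp
  qed
  ultimately show ?thesis unfolding mean_rate_def by (intro limI) simp
qed

end

lemma pad_Cons_preimages: "{y. shift_map y = pad a} = (\<lambda>b. pad (b # a)) ` UNIV"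
proof (intro set_eqI iffI)
  fix y assume "y \<in> {y. shift_map y = pad a}"
  then have y: "\<And>i. y (Suc i) = pad a i" by (auto simp: shift_map_def fun_eq_iff)
  have "y = pad (y 0 # a)"
  proof
    fix i show "y i = pad (y 0 # a) i" by (cases i) (auto simp: y pad_def)
  qed
  then show "y \<in> (\<lambda>b. pad (b # a)) ` UNIV" by blast
qed (auto simp: shift_map_def pad_def)

context
  fixes g :: "(nat \<Rightarrow> 'a::{finite,discrete_topology}) \<Rightarrow> real"
  assumes g: "g_function g"
begin

abbreviation (input) "\<phi> \<equiv> \<lambda>x. ln (g x)"

lemma g_pos: "0 < g x" using g by (simp add: g_function_def)

lemma cont_ln_g: "continuous_on UNIV \<phi>"
  using g by (intro continuous_on_ln) (auto simp: g_function_def less_imp_neq[symmetric])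

lemma g_sum: "(\<Sum>b\<in>UNIV. g (pad (b # a))) = 1"
proof -
  have inj: "inj (\<lambda>b. pad (b # a))"
    by (rule injI) (auto simp: pad_def fun_eq_iff dest!: spec[of _ 0])
  have "(\<Sum>y\<in>{y. shift_map y = pad a}. g y) = 1" using g by (simp add: g_function_def)
  then show ?thesis unfolding pad_Cons_preimages by (simp add: sum.reindex[OF inj])
qed

lemma exp_birkhoff_sum: "(\<Sum>a\<in>strings n. exp (birkhoff \<phi> a)) = 1"
proof (induction n)
  case (Suc n)
  have "(\<Sum>a\<in>strings (Suc n). exp (birkhoff \<phi> a)) = (\<Sum>a\<in>strings n. \<Sum>b\<in>UNIV. g (pad (b # a)) * exp (birkhoff \<phi> a))"
    unfolding sum_strings_Cons by (subst sum.swap) (simp add: exp_add g_pos)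
  also have "\<dots> = 1" by (simp add: g_sum Suc flip: sum_distrib_right)
  finally show ?case .
qed simp

text \<open>
  The exponentials of the Birkhoff sums form a probability distribution on strings of length \<open>N\<close>,
  and its entropy is minus the mean of the Birkhoff sums. The corresponding block process is an invariant
  measure for which the two terms cancel up to \<open>sum_modulus \<phi> N / N\<close>.
\<close>

lemma pressure_nonneg:
  assumes eq: "equilibrium_state \<phi> \<rho>"
  shows "0 \<le> integral\<^sup>L \<rho> \<phi> + entropy \<rho>"
proof -
  have "- (sum_modulus \<phi> N / real N) \<le> integral\<^sup>L \<rho> \<phi> + entropy \<rho>" if N: "0 < N" for N
  proof -
    let ?q = "\<lambda>a. exp (birkhoff \<phi> a)"
    have bd: "block_dist N ?q" using N by (simp add: block_dist_def exp_birkhoff_sum)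
    obtain \<eta> where \<eta>: "\<eta> \<in> invariant_measures" "\<And>a. measure \<eta> (cylinder a) = block_process N ?q a"
      using stationary_extension[OF stationary_block_process[OF bd]] by auto
    have "integral\<^sup>L \<eta> \<phi> = mean_rate (birkhoff \<phi>) (block_process N ?q)"
      unfolding mean_rate_birkhoff[OF cont_ln_g \<eta>(1), symmetric] by (simp add: \<eta>(2))
    moreover have "entropy \<eta> = entropy_rate (block_process N ?q)"
      by (simp add: entropy_eq_entropy_rate \<eta>(2))
    moreover have "integral\<^sup>L \<eta> \<phi> + entropy \<eta> \<le> integral\<^sup>L \<rho> \<phi> + entropy \<rho>"
      using eq \<eta>(1) by (simp add: equilibrium_state_def)
    ultimately show ?thesis
      using entropy_rate_block_process_ge[OF bd] mean_rate_block_process_ge[OF bd almost_additive_birkhoff[OF cont_ln_g]]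
      by (simp add: diff_divide_distrib)
  qed
  moreover have "(\<lambda>N. - (sum_modulus \<phi> N / real N)) \<longlonglongrightarrow> - 0"
    by (intro tendsto_minus sum_modulus_tendsto[OF cont_ln_g])
  ultimately show ?thesis
    by (intro LIMSEQ_le_const2[of "\<lambda>N. - (sum_modulus \<phi> N / real N)"]) (auto intro!: exI[of _ 1])
qed

text \<open>
  The entropy of a letter given the next \<open>k\<close> letters is at least the entropy of \<open>\<rho>\<close>. Hence
  the conditional relative entropy of this letter with respect to \<open>g\<close> is at most minus the pressure,
  which is at most 0, plus the error of replacing \<open>\<phi>\<close> by a function of \<open>k + 1\<close> letters.
\<close>

lemma equilibrium_hellinger:
  assumes eq: "equilibrium_state \<phi> \<rho>"
  shows "(\<Sum>a\<in>strings k. \<Sum>b\<in>UNIV. (sqrt (measure \<rho> (cylinder (b # a)))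
      - sqrt (measure \<rho> (cylinder a) * g (pad (b # a))))\<^sup>2) \<le> modulus \<phi> (Suc k)"
proof -
  let ?r = "\<lambda>a. measure \<rho> (cylinder a)"
  have \<rho>: "\<rho> \<in> invariant_measures" using eq by (simp add: equilibrium_state_def)
  note r = invariant_stationary[OF \<rho>]
  note nn = stationary_nonneg[OF r]
  have "(\<Sum>a\<in>strings k. \<Sum>b\<in>UNIV. ?r (b # a) - ?r a * g (pad (b # a))) = 0"
    by (simp add: sum_subtractf stationary_Cons[OF r] g_sum flip: sum_distrib_left)
  then have "(\<Sum>a\<in>strings k. \<Sum>b\<in>UNIV. (sqrt (?r (b # a)) - sqrt (?r a * g (pad (b # a))))\<^sup>2)
     = (\<Sum>a\<in>strings k. \<Sum>b\<in>UNIV. ?r (b # a) - ?r a * g (pad (b # a)) + (sqrt (?r (b # a)) - sqrt (?r a * g (pad (b # a))))\<^sup>2)"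
    by (simp add: sum.distrib)
  also have "\<dots> \<le> (\<Sum>a\<in>strings k. \<Sum>b\<in>UNIV. ?r (b # a) * (ln (?r (b # a)) - (ln (?r a) + \<phi> (pad (b # a)))))"
  proof (intro sum_mono)
    fix a :: "'a list" and b :: 'a
    have le: "?r (b # a) \<le> ?r a" using stationary_le_left[OF r, of "[b]" a] by simp
    show "?r (b # a) - ?r a * g (pad (b # a)) + (sqrt (?r (b # a)) - sqrt (?r a * g (pad (b # a))))\<^sup>2
        \<le> ?r (b # a) * (ln (?r (b # a)) - (ln (?r a) + \<phi> (pad (b # a))))"
    proof (cases "?r a = 0")
      case True
      then show ?thesis using le nn[of "b # a"] by simp
    next
      case False
      then have "0 < ?r a" by (simp add: zero_less_measure_iff)
      then have lne: "ln (?r a * g (pad (b # a))) = ln (?r a) + \<phi> (pad (b # a))"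
        using g_pos[of "pad (b # a)"] by (simp add: ln_mult)
      have q: "0 < ?r a * g (pad (b # a))" using \<open>0 < ?r a\<close> g_pos by simp
      show ?thesis unfolding lne[symmetric]
        by (rule mult_ln_div_ge_hellinger) (use q nn[of "b # a"] in linarith)+
    qed
  qed
  also have "\<dots> = (\<Sum>a\<in>strings (Suc k). ?r a * ln (?r a)) - (\<Sum>a\<in>strings k. ?r a * ln (?r a))
      - (\<Sum>a\<in>strings (Suc k). ?r a * \<phi> (pad a))"
  proof -
    have "(\<Sum>a\<in>strings k. \<Sum>b\<in>UNIV. ?r (b # a) * ln (?r a)) = (\<Sum>a\<in>strings k. ?r a * ln (?r a))"
      by (simp add: stationary_Cons[OF r] flip: sum_distrib_right)
    moreover have "(\<Sum>a\<in>strings k. \<Sum>b\<in>UNIV. f (b # a)) = (\<Sum>a\<in>strings (Suc k). f a)" for f :: "'a list \<Rightarrow> real"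
      unfolding sum_strings_Cons by (rule sum.swap)
    note this[of "\<lambda>a. ?r a * ln (?r a)"] this[of "\<lambda>a. ?r a * \<phi> (pad a)"]
    ultimately show ?thesis by (simp add: right_diff_distrib distrib_left sum_subtractf sum.distrib)
  qed
  also have "\<dots> \<le> modulus \<phi> (Suc k)"
  proof -
    have "entropy \<rho> \<le> block_entropy (Suc k) ?r - block_entropy k ?r"
      unfolding entropy_eq_entropy_rate by (rule entropy_rate_limits(2)[OF r])
    then show ?thesis
      using pressure_nonneg[OF eq] integral_cylinder_sum[OF cont_ln_g \<rho>, of "Suc k"]
      unfolding block_entropy_stationary[OF r] by linarith
  qed
  finally show ?thesis .
qed

text \<open>
  Conditioned on \<open>k\<close> letters, the law of the preceding letter is close to \<open>g\<close> in total variation as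
  \<open>k\<close> tends to infinity. Averaging over the continuations of \<open>a\<close> shows that \<open>\<rho>\<close> has \<open>g\<close> as its conditional
  probability.
\<close>

lemma equilibrium_conditional_probability:
  assumes eq: "equilibrium_state \<phi> \<rho>"
  defines "w a \<equiv> modulus \<phi> (Suc (length a))"
  shows "measure \<rho> (cylinder a) * exp (\<phi> (pad (b # a)) - w a) \<le> measure \<rho> (cylinder (b # a))"
    and "measure \<rho> (cylinder (b # a)) \<le> measure \<rho> (cylinder a) * exp (\<phi> (pad (b # a)) + w a)"
proof -
  let ?r = "\<lambda>a. measure \<rho> (cylinder a)"
  have \<rho>: "\<rho> \<in> invariant_measures" using eq by (simp add: equilibrium_state_def)
  note r = invariant_stationary[OF \<rho>]
  note nn = stationary_nonneg[OF r]
  have g0: "0 \<le> g x" for x using g_pos[of x] by simp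
  have L1: "(\<Sum>a\<in>strings k. \<Sum>b\<in>UNIV. \<bar>?r (b # a) - ?r a * g (pad (b # a))\<bar>) \<le> modulus \<phi> (Suc k) / (2 * l) + 2 * l"
    if l: "0 < l" for k l
  proof -
    let ?q = "\<lambda>a b. ?r a * g (pad (b # a))"
    \<comment> \<open>A Cauchy-Schwarz inequality with free parameter \<open>l\<close>, applied to \<open>s - t = (sqrt s - sqrt t) * (sqrt s + sqrt t)\<close>.\<close>
    have "\<bar>s - t\<bar> \<le> (sqrt s - sqrt t)\<^sup>2 / (2 * l) + l * (s + t)" if "0 \<le> s" "0 \<le> t" for s t
    proof -
      let ?x = "sqrt s - sqrt t" and ?y = "sqrt s + sqrt t"
      have "s - t = ?x * ?y" using that by (simp add: algebra_simps flip: power2_eq_square)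
      then have "\<bar>s - t\<bar> = \<bar>?x\<bar> * ?y" using that by (simp add: abs_mult)
      moreover have "2 * l * (u * y) \<le> u\<^sup>2 + l\<^sup>2 * y\<^sup>2" for u y
        using zero_le_power2[of "u - l * y"] by (simp add: power2_eq_square algebra_simps)
      from this[of "\<bar>?x\<bar>" ?y] have "2 * l * (\<bar>?x\<bar> * ?y) \<le> ?x\<^sup>2 + l\<^sup>2 * ?y\<^sup>2" by simp
      moreover have "?y\<^sup>2 \<le> 2 * (s + t)"
      proof -
        have "0 \<le> ?x\<^sup>2" by simp
        then show ?thesis using that by (simp add: power2_diff power2_sum)
      qed
      then have "l\<^sup>2 * ?y\<^sup>2 \<le> l\<^sup>2 * (2 * (s + t))" by (intro mult_left_mono) auto
      ultimately have "2 * l * \<bar>s - t\<bar> \<le> ?x\<^sup>2 + 2 * l * (l * (s + t))" by (simp add: power2_eq_square algebra_simps)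
      then show ?thesis using l by (simp add: field_simps)
    qed
    then have "(\<Sum>a\<in>strings k. \<Sum>b\<in>UNIV. \<bar>?r (b # a) - ?q a b\<bar>)
       \<le> (\<Sum>a\<in>strings k. \<Sum>b\<in>UNIV. (sqrt (?r (b # a)) - sqrt (?q a b))\<^sup>2 / (2 * l) + l * (?r (b # a) + ?q a b))"
      by (intro sum_mono) (simp add: nn g0)
    also have "\<dots> = (\<Sum>a\<in>strings k. \<Sum>b\<in>UNIV. (sqrt (?r (b # a)) - sqrt (?q a b))\<^sup>2) / (2 * l) + 2 * l"
      by (simp add: sum.distrib stationary_Cons[OF r] stationary_sum[OF r] g_sum
          flip: sum_divide_distrib sum_distrib_left)
    also have "\<dots> \<le> modulus \<phi> (Suc k) / (2 * l) + 2 * l"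
      using l by (intro add_right_mono divide_right_mono equilibrium_hellinger[OF eq]) auto
    finally show ?thesis .
  qed
  have close: "\<exists>j. \<bar>?r (b # a) - (\<Sum>c\<in>strings j. ?r (a @ c) * g (pad (b # a @ c)))\<bar> \<le> e" if e: "0 < e" for e
  proof -
    \<comment> \<open>With \<open>l = e / 4\<close> both terms of \<open>L1\<close> are then at most \<open>e / 2\<close>.\<close>
    have "\<forall>\<^sub>F n in sequentially. modulus \<phi> n < e\<^sup>2 / 4"
      using e by (intro order_tendstoD(2)[OF modulus_tendsto[OF cont_ln_g]]) auto
    then obtain n0 where n0: "\<And>n. n \<ge> n0 \<Longrightarrow> modulus \<phi> n < e\<^sup>2 / 4" by (auto simp: eventually_sequentially)
    let ?k = "length a + n0"
    have "?r (b # a) = (\<Sum>c\<in>strings n0. ?r (b # a @ c))"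
      using stationary_append_right[OF r, of "b # a" n0] by simp
    then have "\<bar>?r (b # a) - (\<Sum>c\<in>strings n0. ?r (a @ c) * g (pad (b # a @ c)))\<bar>
        \<le> (\<Sum>c\<in>strings n0. \<bar>?r (b # a @ c) - ?r (a @ c) * g (pad (b # a @ c))\<bar>)"
      by (simp add: sum_abs flip: sum_subtractf)
    also have "\<dots> \<le> (\<Sum>c\<in>strings n0. \<Sum>b\<in>UNIV. \<bar>?r (b # a @ c) - ?r (a @ c) * g (pad (b # a @ c))\<bar>)"
      by (intro sum_mono member_le_sum[where f = "\<lambda>b. \<bar>?r (b # _) - ?r _ * g (pad (b # _))\<bar>"]) auto
    also have "\<dots> \<le> (\<Sum>a\<in>strings (length a). \<Sum>c\<in>strings n0. \<Sum>b\<in>UNIV. \<bar>?r (b # a @ c) - ?r (a @ c) * g (pad (b # a @ c))\<bar>)"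
      by (rule le_sum_strings[where f = "\<lambda>a. \<Sum>c\<in>strings n0. \<Sum>b\<in>UNIV. \<bar>?r (b # a @ c) - ?r (a @ c) * g (pad (b # a @ c))\<bar>"])
         (auto intro!: sum_nonneg)
    also have "\<dots> = (\<Sum>a\<in>strings ?k. \<Sum>b\<in>UNIV. \<bar>?r (b # a) - ?r a * g (pad (b # a))\<bar>)"
      by (simp add: sum_strings_append)
    also have "\<dots> \<le> modulus \<phi> (Suc ?k) / (2 * (e / 4)) + 2 * (e / 4)" by (rule L1) (use e in simp)
    also have "\<dots> \<le> (e\<^sup>2 / 4) / (2 * (e / 4)) + 2 * (e / 4)"
      using e n0[of "Suc ?k"] by (intro add_right_mono divide_right_mono) auto
    also have "\<dots> = e" using e by (simp add: power2_eq_square)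
    finally show ?thesis by blast
  qed
  have gb: "exp (\<phi> (pad (b # a)) - w a) \<le> g (pad (b # a @ c))" "g (pad (b # a @ c)) \<le> exp (\<phi> (pad (b # a)) + w a)" for c
  proof -
    have "\<bar>\<phi> (pad ((b # a) @ c)) - \<phi> (pad (b # a))\<bar> \<le> w a"
      using modulus_bound[OF cont_ln_g pre_pad_append[of "b # a" c]] by (simp add: w_def)
    then have *: "\<phi> (pad (b # a)) - w a \<le> \<phi> (pad (b # a @ c))" "\<phi> (pad (b # a @ c)) \<le> \<phi> (pad (b # a)) + w a"
      by simp_all
    show "exp (\<phi> (pad (b # a)) - w a) \<le> g (pad (b # a @ c))" "g (pad (b # a @ c)) \<le> exp (\<phi> (pad (b # a)) + w a)"
      using exp_le_cancel_iff[THEN iffD2, OF *(1)] exp_le_cancel_iff[THEN iffD2, OF *(2)] g_pos by simp_all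
  qed
  have bounds: "?r a * exp (\<phi> (pad (b # a)) - w a) \<le> (\<Sum>c\<in>strings j. ?r (a @ c) * g (pad (b # a @ c)))"
    "(\<Sum>c\<in>strings j. ?r (a @ c) * g (pad (b # a @ c))) \<le> ?r a * exp (\<phi> (pad (b # a)) + w a)" for j
    unfolding stationary_append_right[OF r, of a j, symmetric] sum_distrib_right
    by (intro sum_mono mult_left_mono gb nn)+
  show "?r a * exp (\<phi> (pad (b # a)) - w a) \<le> ?r (b # a)"
  proof (rule field_le_epsilon)
    fix e :: real assume "0 < e"
    from close[OF this] obtain j where "\<bar>?r (b # a) - (\<Sum>c\<in>strings j. ?r (a @ c) * g (pad (b # a @ c)))\<bar> \<le> e" ..
    with bounds(1)[of j] show "?r a * exp (\<phi> (pad (b # a)) - w a) \<le> ?r (b # a) + e" by linarith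
  qed
  show "?r (b # a) \<le> ?r a * exp (\<phi> (pad (b # a)) + w a)"
  proof (rule field_le_epsilon)
    fix e :: real assume "0 < e"
    from close[OF this] obtain j where "\<bar>?r (b # a) - (\<Sum>c\<in>strings j. ?r (a @ c) * g (pad (b # a @ c)))\<bar> \<le> e" ..
    with bounds(2)[of j] show "?r (b # a) \<le> ?r a * exp (\<phi> (pad (b # a)) + w a) + e" by linarith
  qed
qed

lemma equilibrium_cylinder_pos:
  assumes eq: "equilibrium_state \<phi> \<rho>"
  shows "0 < measure \<rho> (cylinder a)"
proof (induction a)
  case Nil
  have "\<rho> \<in> invariant_measures" using eq by (simp add: equilibrium_state_def)
  from stationary_Nil[OF invariant_stationary[OF this]] show ?case by simp
next
  case (Cons b a)
  then show ?case
    using less_le_trans[OF _ equilibrium_conditional_probability(1)[OF eq, where a = a and b = b]] by simp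
qed

text \<open>
  By the estimate of conditional probabilities, prepending \<open>a\<close> changes \<open>L\<close> by nearly the same amount as
  the Birkhoff sums, which are almost additive themselves. The factor 3 collects this error for
  \<open>a\<close> before \<open>b\<close>, for \<open>a\<close> alone, and the error of the Birkhoff sums.
\<close>

lemma almost_additive_equilibrium:
  assumes eq: "equilibrium_state \<phi> \<rho>"
  shows "almost_additive (\<lambda>m. 3 * sum_modulus \<phi> m) (\<lambda>a. ln (measure \<rho> (cylinder a)))"
proof -
  let ?L = "\<lambda>a. ln (measure \<rho> (cylinder a))" and ?S = "birkhoff \<phi>"
  have \<rho>: "\<rho> \<in> invariant_measures" using eq by (simp add: equilibrium_state_def)
  note r = invariant_stationary[OF \<rho>]
  note pos = equilibrium_cylinder_pos[OF eq]
  have step: "\<bar>?L (b # a) - ?L a - \<phi> (pad (b # a))\<bar> \<le> modulus \<phi> (Suc (length a))" for a b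
  proof -
    note cp = equilibrium_conditional_probability[OF eq, where a = a and b = b]
    have "ln (measure \<rho> (cylinder a) * exp (\<phi> (pad (b # a)) - modulus \<phi> (Suc (length a)))) \<le> ?L (b # a)"
      using cp(1) pos by (subst ln_le_cancel_iff) auto
    moreover have "?L (b # a) \<le> ln (measure \<rho> (cylinder a) * exp (\<phi> (pad (b # a)) + modulus \<phi> (Suc (length a))))"
      using cp(2) pos by (subst ln_le_cancel_iff) auto
    ultimately show ?thesis using pos[of a] by (simp add: ln_mult abs_le_iff)
  qed
  have diff: "\<bar>(?L (a @ b) - ?L b) - (?S (a @ b) - ?S b)\<bar> \<le> sum_modulus \<phi> (length a)" for a b
  proof (induction a)
    case (Cons x a)
    have "modulus \<phi> (Suc (length (a @ b))) \<le> modulus \<phi> (Suc (length a))"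
      by (rule antimonoD[OF antimono_modulus[OF cont_ln_g]]) simp
    with Cons step[of x "a @ b"] show ?case by (simp add: sum_modulus_def)
  qed (simp add: sum_modulus_def)
  have "?L [] = 0" using stationary_Nil[OF r] by simp
  then have "\<bar>?L a - ?S a\<bar> \<le> sum_modulus \<phi> (length a)" for a
    using diff[of a "[]"] by simp
  then have add: "\<bar>?L (a @ b) - ?L a - ?L b\<bar> \<le> 3 * sum_modulus \<phi> (length a)" for a b
    using diff[of a b] birkhoff_append[OF cont_ln_g, of a b] by (smt (verit))
  have "(\<lambda>m. 3 * (sum_modulus \<phi> m / real m)) \<longlonglongrightarrow> 3 * 0"
    by (intro tendsto_intros sum_modulus_tendsto[OF cont_ln_g])
  with add show ?thesis
    using mono_sum_modulus[OF cont_ln_g] by (simp add: almost_additive_def mono_def)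
qed

end


section \<open>The rate function\<close>

lemma entropy_range:
  fixes \<nu> :: "(nat \<Rightarrow> 'a::{finite,discrete_topology}) measure"
  assumes "\<nu> \<in> invariant_measures" shows "entropy \<nu> \<in> {0..ln (real CARD('a))}"
  using entropy_rate_nonneg[OF invariant_stationary[OF assms]] entropy_rate_le[OF invariant_stationary[OF assms]]
  by (simp add: entropy_eq_entropy_rate)

lemma rate_function_le:
  fixes \<rho> :: "(nat \<Rightarrow> 'a::{finite,discrete_topology}) measure"
  assumes "\<nu> \<in> invariant_measures" "entropy \<nu> = u"
  shows "rate_function \<rho> u \<le> ereal (relative_entropy \<nu> \<rho>)"
  using entropy_range[OF assms(1)] assms by (auto simp: rate_function_def intro!: INF_lower)

abbreviation (input) cyl :: "(nat \<Rightarrow> 'a) measure \<Rightarrow> 'a list \<Rightarrow> real" where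
  "cyl \<nu> \<equiv> \<lambda>a. measure \<nu> (cylinder a)"

abbreviation (input) ln_cyl :: "(nat \<Rightarrow> 'a) measure \<Rightarrow> 'a list \<Rightarrow> real" where
  "ln_cyl \<nu> \<equiv> \<lambda>a. ln (measure \<nu> (cylinder a))"

context
  fixes \<rho> :: "(nat \<Rightarrow> 'a::{finite,discrete_topology}) measure" and c :: "nat \<Rightarrow> real"
  assumes \<rho>: "\<rho> \<in> invariant_measures"
    and \<rho>_pos: "\<And>a. 0 < measure \<rho> (cylinder a)"
    and L: "almost_additive c (ln_cyl \<rho>)"
begin

lemma relative_entropy_sum_eq:
  assumes \<nu>: "\<nu> \<in> invariant_measures"
  shows "(\<Sum>a\<in>strings k. cyl \<nu> a * ln (cyl \<nu> a / cyl \<rho> a))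
    = - block_entropy k (cyl \<nu>) - block_mean (ln_cyl \<rho>) (cyl \<nu>) k"
proof -
  note p = invariant_stationary[OF \<nu>]
  have "(\<Sum>a\<in>strings k. cyl \<nu> a * ln (cyl \<nu> a / cyl \<rho> a))
      = (\<Sum>a\<in>strings k. cyl \<nu> a * ln (cyl \<nu> a) - cyl \<nu> a * ln_cyl \<rho> a)"
  proof (intro sum.cong refl)
    fix a
    show "cyl \<nu> a * ln (cyl \<nu> a / cyl \<rho> a) = cyl \<nu> a * ln (cyl \<nu> a) - cyl \<nu> a * ln_cyl \<rho> a"
    proof (cases "cyl \<nu> a = 0")
      case False
      then have "0 < cyl \<nu> a" by (simp add: zero_less_measure_iff)
      then show ?thesis using \<rho>_pos[of a] by (simp add: ln_div right_diff_distrib)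
    qed simp
  qed
  then show ?thesis by (simp add: sum_subtractf block_entropy_stationary[OF p] block_mean_def)
qed

lemma relative_entropy_tendsto:
  assumes \<nu>: "\<nu> \<in> invariant_measures"
  shows "(\<lambda>k. (1 / real k) * (\<Sum>a\<in>strings k. cyl \<nu> a * ln (cyl \<nu> a / cyl \<rho> a)))
     \<longlonglongrightarrow> - entropy \<nu> - mean_rate (ln_cyl \<rho>) (cyl \<nu>)"
proof -
  note p = invariant_stationary[OF \<nu>]
  have "(\<lambda>k. - (block_entropy k (cyl \<nu>) / real k) - block_mean (ln_cyl \<rho>) (cyl \<nu>) k / real k)
      \<longlonglongrightarrow> - entropy \<nu> - mean_rate (ln_cyl \<rho>) (cyl \<nu>)"
    unfolding entropy_eq_entropy_rate
    by (intro tendsto_intros entropy_rate_limits(1)[OF p] mean_rate_tendsto[OF p L])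
  then show ?thesis unfolding relative_entropy_sum_eq[OF \<nu>] by (simp add: diff_divide_distrib)
qed

lemma relative_entropy_eq:
  assumes \<nu>: "\<nu> \<in> invariant_measures"
  shows "relative_entropy \<nu> \<rho> = - entropy \<nu> - mean_rate (ln_cyl \<rho>) (cyl \<nu>)"
  unfolding relative_entropy_def by (rule limI[OF relative_entropy_tendsto[OF \<nu>]])

lemma relative_entropy_nonneg:
  assumes \<nu>: "\<nu> \<in> invariant_measures"
  shows "0 \<le> relative_entropy \<nu> \<rho>"
proof -
  note p = invariant_stationary[OF \<nu>]
  have "block_entropy k (cyl \<nu>) \<le> - block_mean (ln_cyl \<rho>) (cyl \<nu>) k" for k
    unfolding block_mean_def
    using \<rho>_pos stationary_sum[OF invariant_stationary[OF \<rho>], of k]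
    by (intro block_entropy_le_cross_entropy[OF p]) (auto simp: less_imp_neq[symmetric])
  then have sum: "0 \<le> - block_entropy k (cyl \<nu>) - block_mean (ln_cyl \<rho>) (cyl \<nu>) k" for k
    by (smt (verit))
  have "0 \<le> (1 / real k) * (\<Sum>a\<in>strings k. cyl \<nu> a * ln (cyl \<nu> a / cyl \<rho> a))" for k
    unfolding relative_entropy_sum_eq[OF \<nu>] by (rule mult_nonneg_nonneg[OF _ sum]) simp
  then show ?thesis
    unfolding relative_entropy_eq[OF \<nu>]
    by (intro LIMSEQ_le_const[OF relative_entropy_tendsto[OF \<nu>]]) blast
qed

lemma rate_function_nonneg: "0 \<le> rate_function \<rho> u"
  unfolding rate_function_def using relative_entropy_nonneg by (auto intro!: INF_greatest)

lemma rate_function_less: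
  assumes "rate_function \<rho> u < x"
  obtains \<nu> where "\<nu> \<in> invariant_measures" "entropy \<nu> = u" "ereal (relative_entropy \<nu> \<rho>) < x"
proof -
  have "u \<in> {0..ln (real CARD('a))}" using assms by (auto simp: rate_function_def split: if_splits)
  with assms have "(INF \<nu>\<in>{\<nu> \<in> invariant_measures. entropy \<nu> = u}. ereal (relative_entropy \<nu> \<rho>)) < x"
    by (simp add: rate_function_def)
  then show ?thesis using that unfolding INF_less_iff by auto
qed

text \<open>
  The relative entropy is affine, since entropy and the mean rate of \<open>ln_cyl \<rho>\<close> are, so one can mix
  measures that are nearly optimal at \<open>u\<close> and at \<open>v\<close>.
\<close>

lemma ereal_convex_rate_function: "ereal_convex (rate_function \<rho>)"
  unfolding ereal_convex_def
proof (intro allI impI)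
  fix u v s t :: real assume "0 \<le> s \<and> 0 \<le> t \<and> s + t = 1"
  then have st: "0 \<le> s" "0 \<le> t" "s + t = 1" by auto
  let ?I = "rate_function \<rho>"
  consider "s = 0" | "t = 0" | "?I u = \<infinity>" "0 < s" | "?I v = \<infinity>" "0 < t"
    | "0 < s" "0 < t" "?I u \<noteq> \<infinity>" "?I v \<noteq> \<infinity>" using st by fastforce
  then show "?I (s * u + t * v) \<le> ereal s * ?I u + ereal t * ?I v"
  proof cases
    case 1 then show ?thesis using st by (simp add: zero_ereal_def[symmetric] one_ereal_def[symmetric])
  next
    case 2 then show ?thesis using st by (simp add: zero_ereal_def[symmetric] one_ereal_def[symmetric])
  next
    case 3 then show ?thesis by simp
  next
    case 4 then show ?thesis by simp
  next
    case 5
    then obtain a b where ab: "?I u = ereal a" "?I v = ereal b"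
      using rate_function_nonneg[of u] rate_function_nonneg[of v]
      by (cases "?I u"; cases "?I v") auto
    show ?thesis unfolding ab
    proof (rule ereal_le_epsilon2)
      fix e :: real assume e: "0 < e"
      obtain \<mu> where \<mu>: "\<mu> \<in> invariant_measures" "entropy \<mu> = u" "relative_entropy \<mu> \<rho> < a + e"
        using rate_function_less[of u "ereal (a + e)"] e by (auto simp: ab)
      obtain \<nu> where \<nu>: "\<nu> \<in> invariant_measures" "entropy \<nu> = v" "relative_entropy \<nu> \<rho> < b + e"
        using rate_function_less[of v "ereal (b + e)"] e by (auto simp: ab)
      note p = invariant_stationary[OF \<mu>(1)] and q = invariant_stationary[OF \<nu>(1)]
      obtain \<xi> where \<xi>: "\<xi> \<in> invariant_measures" "\<And>a. cyl \<xi> a = s * cyl \<mu> a + t * cyl \<nu> a"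
        using stationary_extension[OF stationary_mixture[OF p q st]] by auto
      have ent: "entropy \<xi> = s * u + t * v"
        using entropy_rate_mixture[OF p q st] \<mu>(2) \<nu>(2) by (simp add: entropy_eq_entropy_rate \<xi>(2))
      have "mean_rate (ln_cyl \<rho>) (cyl \<xi>) = s * mean_rate (ln_cyl \<rho>) (cyl \<mu>) + t * mean_rate (ln_cyl \<rho>) (cyl \<nu>)"
        using mean_rate_mixture[OF p q L st] by (simp add: \<xi>(2))
      then have "relative_entropy \<xi> \<rho> = s * relative_entropy \<mu> \<rho> + t * relative_entropy \<nu> \<rho>"
        using \<mu> \<nu> \<xi>(1) ent by (simp add: relative_entropy_eq algebra_simps)
      also have "\<dots> \<le> s * (a + e) + t * (b + e)"
        using st \<mu>(3) \<nu>(3) by (intro add_mono mult_left_mono) auto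
      also have "\<dots> = s * a + t * b + (s + t) * e" by (simp add: algebra_simps)
      finally have "ereal (relative_entropy \<xi> \<rho>) \<le> ereal s * ereal a + ereal t * ereal b + ereal e"
        using st by simp
      with rate_function_le[OF \<xi>(1) ent]
      show "?I (s * u + t * v) \<le> ereal s * ereal a + ereal t * ereal b + ereal e"
        by (rule order_trans)
    qed
  qed
qed

end


section \<open>The large deviation principle\<close>

context
  fixes \<rho> :: "(nat \<Rightarrow> 'a::{finite,discrete_topology}) measure" and c :: "nat \<Rightarrow> real"
    and k :: "nat \<Rightarrow> nat" and \<epsilon> :: real and F :: "nat \<Rightarrow> 'a list \<Rightarrow> real"
  assumes \<rho>: "\<rho> \<in> invariant_measures"
    and \<rho>_pos: "\<And>a. 0 < measure \<rho> (cylinder a)"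
    and L: "almost_additive c (ln_cyl \<rho>)"
    and card: "0 < ln (real CARD('a))"
    and k: "filterlim k at_top sequentially"
    and eps: "0 < \<epsilon>"
    and k_le: "\<forall>\<^sub>F n in sequentially. real (k n) \<le> (1 - \<epsilon>) / ln (real CARD('a)) * ln (real n)"
    and F: "\<forall>\<^sub>F n in sequentially. \<forall>x\<in>strings n. cond_empirical_entropy (k n) x \<le> F n x \<and>
          F n x \<le> empirical_entropy (k n) x / real (k n)"
begin

text \<open>
  The factor in \<open>sum_le_type_count\<close> that accounts for the number of empirical measures and of initial
  states of the Markov chains.
\<close>

definition type_bound :: "nat \<Rightarrow> real" where
  "type_bound n = real (n + 1) ^ (CARD('a) ^ k n) * real CARD('a) ^ (k n - 1)"

lemma type_bound_pos: "0 < type_bound n"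
  by (simp add: type_bound_def)

lemma k_ge_1: "\<forall>\<^sub>F n in sequentially. 1 \<le> k n"
  using k by (simp add: filterlim_at_top)

lemma k_over_n: "(\<lambda>n. real (k n) / real n) \<longlonglongrightarrow> 0"
proof (rule tendsto_sandwich[where f = "\<lambda>_. 0"])
  show "(\<lambda>n. (1 - \<epsilon>) / ln (real CARD('a)) * (ln (real n) / real n)) \<longlonglongrightarrow> 0"
  proof -
    have "(\<lambda>n::nat. ln (real n) / real n) \<longlonglongrightarrow> 0" by real_asymp
    then show ?thesis by (rule tendsto_mult_right_zero)
  qed
  show "\<forall>\<^sub>F n in sequentially. real (k n) / real n \<le> (1 - \<epsilon>) / ln (real CARD('a)) * (ln (real n) / real n)"
    using k_le
  proof eventually_elim
    case (elim n)
    then have "real (k n) / real n \<le> ((1 - \<epsilon>) / ln (real CARD('a)) * ln (real n)) / real n"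
      by (rule divide_right_mono) simp
    then show ?case by simp
  qed
qed auto

text \<open>
  The growth condition on \<open>k\<close> says that \<open>CARD('a) ^ k n\<close> is at most \<open>n powr (1 - \<epsilon>)\<close>.
\<close>

lemma ln_type_bound: "(\<lambda>n. ln (type_bound n) / real n) \<longlonglongrightarrow> 0"
proof (rule tendsto_sandwich[where f = "\<lambda>_. 0"])
  let ?A = "real CARD('a)"
  have "(\<lambda>n. real n powr (- \<epsilon>) * ln (real n + 1)) \<longlonglongrightarrow> 0" using eps by real_asymp
  then have "(\<lambda>n. real n powr (- \<epsilon>) * ln (real n + 1) + real (k n) / real n * ln ?A) \<longlonglongrightarrow> 0 + 0 * ln ?A"
    by (intro tendsto_intros k_over_n)
  then show "(\<lambda>n. real n powr (- \<epsilon>) * ln (real n + 1) + real (k n) / real n * ln ?A) \<longlonglongrightarrow> 0" by simp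
  have A1: "1 \<le> ?A" by simp
  have ln_eq: "ln (type_bound n) = ?A ^ k n * ln (real n + 1) + real (k n - 1) * ln ?A" for n
    by (simp add: type_bound_def ln_mult ln_realpow add.commute)
  show "\<forall>\<^sub>F n in sequentially. 0 \<le> ln (type_bound n) / real n"
    unfolding ln_eq by (intro always_eventually allI divide_nonneg_nonneg add_nonneg_nonneg mult_nonneg_nonneg) auto
  show "\<forall>\<^sub>F n in sequentially. ln (type_bound n) / real n \<le> real n powr (- \<epsilon>) * ln (real n + 1) + real (k n) / real n * ln ?A"
    using k_le eventually_gt_at_top[of 0]
  proof eventually_elim
    case (elim n)
    have n0: "0 < real n" using elim by simp
    have "?A ^ k n = exp (real (k n) * ln ?A)" by (simp add: exp_of_nat_mult)
    also have "\<dots> \<le> exp ((1 - \<epsilon>) * ln (real n))"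
      using mult_right_mono[OF elim(1), of "ln ?A"] card by simp
    also have "\<dots> = real n * real n powr (- \<epsilon>)"
      using n0 by (simp add: powr_def algebra_simps exp_diff exp_minus divide_inverse)
    finally have "?A ^ k n * ln (real n + 1) \<le> real n * real n powr (- \<epsilon>) * ln (real n + 1)"
      by (rule mult_right_mono) simp
    moreover have "real (k n - 1) * ln ?A \<le> real (k n) * ln ?A" by (intro mult_right_mono) auto
    ultimately have "ln (type_bound n) / real n \<le> (real n * real n powr (- \<epsilon>) * ln (real n + 1) + real (k n) * ln ?A) / real n"
      unfolding ln_eq by (intro divide_right_mono) auto
    then show ?case using n0 by (simp add: add_divide_distrib)
  qed
qed auto

lemma string_measure_eq: "string_measure \<rho> S = (\<Sum>a\<in>S. exp (ln_cyl \<rho> a))"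
  using \<rho>_pos by (simp add: string_measure_def)

text \<open>
  The loss of \<open>invariant_measure_of_string\<close>.
\<close>

definition slack :: "nat \<Rightarrow> real" where
  "slack n = 3 * (c n / real n) + 2 * (c (k n) / real (k n))"

lemma slack_tendsto: "slack \<longlonglongrightarrow> 0"
proof -
  note c = almost_additiveD(3)[OF L]
  have "slack \<longlonglongrightarrow> 3 * 0 + 2 * 0"
    unfolding slack_def by (intro tendsto_intros c filterlim_compose[OF c k])
  then show ?thesis by simp
qed

text \<open>
  Every string is represented by an invariant measure whose entropy is the value of the statistic.
\<close>

lemma rate_function_string_le:
  "\<forall>\<^sub>F n in sequentially. \<forall>x\<in>strings n. rate_function \<rho> (F n x) \<le> ereal (slack n - ln_cyl \<rho> x / real n - F n x)"
  using F k_ge_1 eventually_gt_at_top[of 0]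
proof eventually_elim
  case (elim n)
  show ?case
  proof
    fix x :: "'a list" assume x: "x \<in> strings n"
    have xne: "x \<noteq> []" using x elim(3) by (auto simp: strings_def)
    have "Suc (k n - 1) = k n" using elim(2) by simp
    then have "0 \<le> cond_empirical_entropy (k n) x"
      using cond_entropy_nonneg[OF stationary_empirical[OF xne], of "k n - 1"]
      by (simp add: cond_empirical_entropy_eq[OF xne])
    with elim(1) x have u: "0 \<le> F n x" "F n x \<le> block_entropy (k n) (empirical x) / real (k n)"
      by (fastforce simp: empirical_entropy_def)+
    obtain \<nu> where \<nu>: "\<nu> \<in> invariant_measures" "entropy \<nu> = F n x"
      "ln_cyl \<rho> x / real n - 3 * c n / real n - 2 * c (k n) / real (k n) \<le> mean_rate (ln_cyl \<rho>) (\<lambda>a. measure \<nu> (cylinder a))"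
      using invariant_measure_of_string[OF x elim(3) _ L u] elim(2) by auto
    have "rate_function \<rho> (F n x) \<le> ereal (relative_entropy \<nu> \<rho>)" by (rule rate_function_le[OF \<nu>(1,2)])
    also have "\<dots> \<le> ereal (slack n - ln_cyl \<rho> x / real n - F n x)"
      unfolding relative_entropy_eq[OF \<rho> \<rho>_pos L \<nu>(1)] using \<nu>(2,3) by (simp add: slack_def)
    finally show "rate_function \<rho> (F n x) \<le> ereal (slack n - ln_cyl \<rho> x / real n - F n x)" .
  qed
qed

text \<open>
  If \<open>J\<close> is the infimum of the rate function over \<open>C\<close>, a string with \<open>F n x\<close> in \<open>C\<close> satisfies
  \<open>L x + n * F n x \<le> n * (slack n - J)\<close>. The number of strings that share its empirical measure is
  controlled by the conditional entropy, which is at most \<open>F n x\<close>.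
\<close>

lemma ldp_upper_bound:
  "limsup (\<lambda>n. ereal (1 / real n) * ereal_ln (string_measure \<rho> {x \<in> strings n. F n x \<in> C}))
     \<le> - (INF u\<in>C. rate_function \<rho> u)"
proof -
  let ?S = "\<lambda>n. {x \<in> strings n. F n x \<in> C}"
  let ?t = "\<lambda>n. ereal (1 / real n) * ereal_ln (string_measure \<rho> (?S n))"
  define J where "J = (INF u\<in>C. rate_function \<rho> u)"
  have J0: "0 \<le> J" unfolding J_def by (intro INF_greatest rate_function_nonneg[OF \<rho> \<rho>_pos L])
  have J_le: "\<forall>\<^sub>F n in sequentially. \<forall>x\<in>?S n. J \<le> ereal (slack n - ln_cyl \<rho> x / real n - F n x)"
    using rate_function_string_le
  proof eventually_elim
    case (elim n)
    then show ?case unfolding J_def by (auto intro: INF_lower2)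
  qed
  show ?thesis
  proof (cases "J = \<infinity>")
    case True
    \<comment> \<open>No string can have its value in \<open>C\<close>, as it would yield a finite value of the rate function there.\<close>
    have "\<forall>\<^sub>F n in sequentially. ?t n \<le> - \<infinity>"
      using J_le eventually_gt_at_top[of 0]
    proof eventually_elim
      case (elim n)
      then have "?S n = {}" using True by auto
      then have "string_measure \<rho> (?S n) = 0" by (simp only: string_measure_def sum.empty)
      then show ?case using elim(2) by (simp add: ereal_ln_def)
    qed
    then have "limsup ?t \<le> - \<infinity>" by (rule Limsup_bounded)
    then show ?thesis using True unfolding J_def by simp
  next
    case False
    then obtain j where j: "J = ereal j" using J0 by (cases J) auto
    have "\<forall>\<^sub>F n in sequentially. ?t n \<le> ereal (ln (type_bound n) / real n + slack n - j)"
      using J_le F k_ge_1 eventually_gt_at_top[of 0]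
    proof eventually_elim
      case (elim n)
      have n0: "0 < real n" using elim by simp
      let ?D = "exp (real n * (slack n - j))"
      have "string_measure \<rho> (?S n) \<le> real (n + 1) ^ (CARD('a) ^ k n) * real CARD('a) ^ (k n - 1) * ?D"
        unfolding string_measure_eq
      proof (rule sum_le_type_count)
        fix x assume x: "x \<in> ?S n"
        have "j \<le> slack n - ln_cyl \<rho> x / real n - F n x" using elim(1) x by (simp add: j)
        then have "real n * j \<le> real n * (slack n - ln_cyl \<rho> x / real n - F n x)" using n0 by simp
        also have "\<dots> = real n * slack n - ln_cyl \<rho> x - real n * F n x" using n0 by (simp add: right_diff_distrib)
        also have "\<dots> \<le> real n * slack n - ln_cyl \<rho> x - real n * cond_empirical_entropy (k n) x"
          using elim(2) x n0 by simp
        finally show "exp (ln_cyl \<rho> x) \<le> ?D * exp (- real n * cond_empirical_entropy (k n) x)"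
          by (simp add: algebra_simps flip: exp_add)
      qed (use elim in auto)
      then have le: "string_measure \<rho> (?S n) \<le> type_bound n * ?D" by (simp add: type_bound_def)
      show ?case
      proof (cases "string_measure \<rho> (?S n) = 0")
        case True then show ?thesis using n0 by (simp add: ereal_ln_def)
      next
        case False
        moreover have "0 \<le> string_measure \<rho> (?S n)" by (simp add: string_measure_def sum_nonneg)
        ultimately have pos: "0 < string_measure \<rho> (?S n)" by simp
        have "ln (string_measure \<rho> (?S n)) \<le> ln (type_bound n * ?D)"
          using le pos type_bound_pos[of n] by (subst ln_le_cancel_iff) auto
        also have "\<dots> = ln (type_bound n) + real n * (slack n - j)"
          using type_bound_pos[of n] by (simp add: ln_mult)
        finally have "ln (string_measure \<rho> (?S n)) / real n \<le> (ln (type_bound n) + real n * (slack n - j)) / real n"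
          by (rule divide_right_mono) simp
        then show ?thesis using False n0 by (simp add: ereal_ln_def add_divide_distrib)
      qed
    qed
    then have "limsup ?t \<le> limsup (\<lambda>n. ereal (ln (type_bound n) / real n + slack n - j))"
      by (rule Limsup_mono)
    also have "\<dots> = ereal (0 + 0 - j)"
      by (intro lim_imp_Limsup tendsto_intros ln_type_bound slack_tendsto) simp
    finally show ?thesis using j by (simp add: J_def)
  qed
qed

text \<open>
  The strings built from typical blocks of \<open>\<nu>\<close> have block entropy at most \<open>u + 2 * \<delta>\<close>. They number
  at least \<open>exp (n * (u - \<delta>))\<close>, at least twice as many as there are strings with conditional entropy at
  most \<open>u - 3 * \<delta>\<close>.
\<close>

lemma ldp_lower_bound_measure:
  assumes \<nu>: "\<nu> \<in> invariant_measures" and U: "open U" "entropy \<nu> \<in> U" and d: "0 < d"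
  shows "\<forall>\<^sub>F n in sequentially. ereal (- relative_entropy \<nu> \<rho> - d)
     \<le> ereal (1 / real n) * ereal_ln (string_measure \<rho> {x \<in> strings n. F n x \<in> U})"
proof -
  let ?p = "\<lambda>a. measure \<nu> (cylinder a)"
  define u e where "u = entropy \<nu>" and "e = mean_rate (ln_cyl \<rho>) ?p"
  note p = invariant_stationary[OF \<nu>]
  have rel: "relative_entropy \<nu> \<rho> = - u - e"
    unfolding u_def e_def by (rule relative_entropy_eq[OF \<rho> \<rho>_pos L \<nu>])
  obtain r where r: "0 < r" "ball u r \<subseteq> U" using U unfolding u_def by (rule openE)
  define \<delta> where "\<delta> = min (r / 4) (d / 5)"
  have \<delta>: "0 < \<delta>" "4 * \<delta> \<le> r" "5 * \<delta> \<le> d" using r d by (auto simp: \<delta>_def)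
  have "\<forall>\<^sub>F N in sequentially. block_entropy N ?p / real N < u + \<delta>"
    using \<delta>(1) entropy_rate_limits(1)[OF p] by (intro order_tendstoD) (auto simp: u_def entropy_eq_entropy_rate)
  moreover have "\<forall>\<^sub>F N in sequentially. e - \<delta> < block_mean (ln_cyl \<rho>) ?p N / real N"
    using \<delta>(1) mean_rate_tendsto[OF p L] by (intro order_tendstoD) (auto simp: e_def)
  moreover have "\<forall>\<^sub>F N in sequentially. c N / real N < \<delta>"
    using \<delta>(1) almost_additiveD(3)[OF L] by (intro order_tendstoD) auto
  ultimately have "\<forall>\<^sub>F N in sequentially. block_entropy N ?p / real N < u + \<delta> \<and>
      e - \<delta> < block_mean (ln_cyl \<rho>) ?p N / real N \<and> c N / real N < \<delta> \<and> 0 < N"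
    using eventually_gt_at_top[of 0] by eventually_elim simp
  then obtain N where N: "block_entropy N ?p / real N < u + \<delta>"
      "e - \<delta> < block_mean (ln_cyl \<rho>) ?p N / real N" "c N / real N < \<delta>" "0 < N"
    using eventually_happens'[OF sequentially_bot] by blast
  have uN: "u \<le> block_entropy N ?p / real N"
    unfolding u_def entropy_eq_entropy_rate by (rule entropy_rate_le_mean[OF p N(4)])
  have ev_T: "\<forall>\<^sub>F n in sequentially. ln (type_bound n) / real n < \<delta>"
    using \<delta>(1) ln_type_bound by (intro order_tendstoD) auto
  have ev_2: "\<forall>\<^sub>F n in sequentially. ln 2 / real n < \<delta>"
    using \<delta>(1) by (intro order_tendstoD(2)[OF lim_const_over_n]) auto
  show ?thesis
    using typical_strings[OF p L N(4) \<delta>(1) k k_over_n] ev_T ev_2 F k_ge_1 eventually_gt_at_top[of 0]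
  proof eventually_elim
    case (elim n)
    have n0: "0 < real n" using elim by simp
    from elim(1) obtain G where G: "G \<subseteq> strings n"
      "exp (real n * (block_entropy N ?p / real N - \<delta>)) \<le> real (card G)"
      "\<And>x. x \<in> G \<Longrightarrow> real n * ((block_mean (ln_cyl \<rho>) ?p N - c N) / real N - \<delta>) \<le> ln_cyl \<rho> x"
      "\<And>x. x \<in> G \<Longrightarrow> block_entropy (k n) (empirical x) / real (k n) \<le> block_entropy N ?p / real N + \<delta>"
      by blast
    define low :: "'a list set" where "low = {x \<in> strings n. cond_empirical_entropy (k n) x \<le> u - 3 * \<delta>}"
    let ?S = "{x \<in> strings n. F n x \<in> U}"
    have fin: "finite G" "finite low" "finite ?S"
      using G(1) finite_subset[OF _ finite_strings[of n]] by (auto simp: low_def)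
    have ln2: "ln 2 \<le> real n * \<delta>" using elim(3) n0 by (simp add: field_simps)
    have half: "exp (y - real n * \<delta>) \<le> exp y / 2" for y
    proof -
      have "exp (y - real n * \<delta>) \<le> exp (y - ln 2)" using ln2 by simp
      then show ?thesis by (simp add: exp_diff)
    qed
    have "real (card low) = (\<Sum>x\<in>low. 1)" by simp
    also have "\<dots> \<le> real (n + 1) ^ (CARD('a) ^ k n) * real CARD('a) ^ (k n - 1) * exp (real n * (u - 3 * \<delta>))"
    proof (rule sum_le_type_count)
      fix x assume "x \<in> low"
      then have "real n * cond_empirical_entropy (k n) x \<le> real n * (u - 3 * \<delta>)"
        using n0 by (simp add: low_def)
      then show "1 \<le> exp (real n * (u - 3 * \<delta>)) * exp (- real n * cond_empirical_entropy (k n) x)"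
        by (simp flip: exp_add)
    qed (use elim in \<open>auto simp: low_def\<close>)
    also have "\<dots> = exp (ln (type_bound n)) * exp (real n * (u - 3 * \<delta>))"
      using type_bound_pos[of n] by (simp add: type_bound_def)
    also have "\<dots> \<le> exp (real n * \<delta>) * exp (real n * (u - 3 * \<delta>))"
      using elim(2) n0 by (simp add: field_simps)
    also have "\<dots> = exp (real n * (u - \<delta>) - real n * \<delta>)"
      by (simp add: algebra_simps flip: exp_add)
    also have "\<dots> \<le> exp (real n * (u - \<delta>)) / 2" by (rule half)
    finally have low: "real (card low) \<le> exp (real n * (u - \<delta>)) / 2" .
    have "exp (real n * (u - \<delta>)) \<le> exp (real n * (block_entropy N ?p / real N - \<delta>))"
      using uN n0 by simp
    with G(2) low have "exp (real n * (u - \<delta>)) / 2 \<le> real (card G) - real (card low)" by linarith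
    also have "\<dots> \<le> real (card (G - low))"
      using fin diff_card_le_card_Diff[of low G] by linarith
    finally have cardG: "exp (real n * (u - \<delta>)) / 2 \<le> real (card (G - low))" .
    have sub: "G - low \<subseteq> ?S"
    proof
      fix x assume x: "x \<in> G - low"
      then have xs: "x \<in> strings n" using G(1) by auto
      have "u - 3 * \<delta> < cond_empirical_entropy (k n) x" using x xs by (auto simp: low_def)
      also have "\<dots> \<le> F n x" using elim(4) xs by blast
      finally have lo: "u - 3 * \<delta> < F n x" .
      have "F n x \<le> block_entropy (k n) (empirical x) / real (k n)"
        using elim(4) xs by (simp add: empirical_entropy_def)
      also have "\<dots> < u + 2 * \<delta>" using G(4)[of x] x N(1) by simp
      finally have "F n x \<in> ball u r" using lo \<delta> by (simp add: dist_real_def abs_less_iff)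
      then show "x \<in> ?S" using r(2) xs by auto
    qed
    have Lge: "exp (real n * (e - 3 * \<delta>)) \<le> exp (ln_cyl \<rho> x)" if "x \<in> G" for x
    proof -
      have "e - 3 * \<delta> \<le> (block_mean (ln_cyl \<rho>) ?p N - c N) / real N - \<delta>"
        using N(2,3) by (simp add: diff_divide_distrib)
      then have "real n * (e - 3 * \<delta>) \<le> real n * ((block_mean (ln_cyl \<rho>) ?p N - c N) / real N - \<delta>)"
        using n0 by simp
      also have "\<dots> \<le> ln_cyl \<rho> x" by (rule G(3)[OF that])
      finally show ?thesis by simp
    qed
    have "exp (real n * (- relative_entropy \<nu> \<rho> - d)) \<le> exp (real n * (u - \<delta>) + real n * (e - 3 * \<delta>) - real n * \<delta>)"
      using mult_left_mono[OF \<delta>(3), of "real n"] by (simp add: rel algebra_simps)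
    also have "\<dots> \<le> exp (real n * (u - \<delta>) + real n * (e - 3 * \<delta>)) / 2" by (rule half)
    also have "\<dots> = exp (real n * (u - \<delta>)) / 2 * exp (real n * (e - 3 * \<delta>))" by (simp add: exp_add)
    also have "\<dots> \<le> real (card (G - low)) * exp (real n * (e - 3 * \<delta>))"
      by (rule mult_right_mono[OF cardG]) simp
    also have "\<dots> = (\<Sum>x\<in>G - low. exp (real n * (e - 3 * \<delta>)))" by simp
    also have "\<dots> \<le> (\<Sum>x\<in>G - low. exp (ln_cyl \<rho> x))" by (intro sum_mono Lge) auto
    also have "\<dots> \<le> string_measure \<rho> ?S"
      unfolding string_measure_eq by (intro sum_mono2 fin sub) auto
    finally have ge: "exp (real n * (- relative_entropy \<nu> \<rho> - d)) \<le> string_measure \<rho> ?S" .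
    then have pos: "0 < string_measure \<rho> ?S" by (rule less_le_trans[OF exp_gt_zero])
    have "real n * (- relative_entropy \<nu> \<rho> - d) \<le> ln (string_measure \<rho> ?S)"
      using ge pos by (simp add: ln_ge_iff)
    then have "real n * (- relative_entropy \<nu> \<rho> - d) / real n \<le> ln (string_measure \<rho> ?S) / real n"
      by (rule divide_right_mono) simp
    then show ?case using pos n0 by (simp add: ereal_ln_def)
  qed
qed

lemma ldp_lower_bound:
  assumes U: "open U"
  shows "- (INF u\<in>U. rate_function \<rho> u)
     \<le> liminf (\<lambda>n. ereal (1 / real n) * ereal_ln (string_measure \<rho> {x \<in> strings n. F n x \<in> U}))"
proof -
  let ?l = "liminf (\<lambda>n. ereal (1 / real n) * ereal_ln (string_measure \<rho> {x \<in> strings n. F n x \<in> U}))"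
  have *: "- ?l \<le> ereal (relative_entropy \<nu> \<rho>)" if \<nu>: "\<nu> \<in> invariant_measures" "entropy \<nu> \<in> U" for \<nu>
  proof (rule ereal_le_epsilon2)
    fix d :: real assume d: "0 < d"
    have "ereal (- relative_entropy \<nu> \<rho> - d) \<le> ?l"
      by (rule Liminf_bounded[OF ldp_lower_bound_measure[OF \<nu>(1) U \<nu>(2) d]])
    then have "- ?l \<le> - ereal (- relative_entropy \<nu> \<rho> - d)" by (simp only: ereal_minus_le_minus)
    then show "- ?l \<le> ereal (relative_entropy \<nu> \<rho>) + ereal d" by (simp add: add.commute)
  qed
  have "- ?l \<le> (INF u\<in>U. rate_function \<rho> u)"
    by (intro INF_greatest) (auto simp: rate_function_def intro!: INF_greatest *)
  then show ?thesis by (simp only: ereal_uminus_le_reorder)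
qed

lemma large_deviation_principle_sandwiched:
  "large_deviation_principle \<rho> F (rate_function \<rho>)"
  unfolding large_deviation_principle_def using ldp_upper_bound ldp_lower_bound by blast

end

theorem theorem3p1:
  fixes g :: "(nat \<Rightarrow> 'a::{finite,discrete_topology}) \<Rightarrow> real"
    and \<rho> :: "(nat \<Rightarrow> 'a) measure"
    and k :: "nat \<Rightarrow> nat"
    and \<epsilon> :: real
  assumes "g_measure g \<rho>"
    and "\<forall>n\<ge>1. 0 < k n"
    and "filterlim k at_top sequentially"
    and "0 < \<epsilon>" and "\<epsilon> < 1"
    and "eventually (\<lambda>n. real (k n) \<le> (1 - \<epsilon>) / ln (real CARD('a)) * ln (real n)) sequentially"
  shows "ereal_convex (rate_function \<rho>) \<and>
    large_deviation_principle \<rho> (\<lambda>n x. cond_empirical_entropy (k n) x) (rate_function \<rho>) \<and>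
    large_deviation_principle \<rho> (\<lambda>n x. empirical_entropy (k n) x / real (k n)) (rate_function \<rho>)"
proof -
  have g: "g_function g" and eq: "equilibrium_state (\<lambda>x. ln (g x)) \<rho>"
    using assms(1) by (auto simp: g_measure_def)
  have \<rho>: "\<rho> \<in> invariant_measures" using eq by (simp add: equilibrium_state_def)
  note pos = equilibrium_cylinder_pos[OF g eq] and L = almost_additive_equilibrium[OF g eq]
  \<comment> \<open>For a one-letter alphabet the growth bound is 0, as \<open>x / 0 = 0\<close>, but \<open>k\<close> diverges.\<close>
  have card: "0 < ln (real CARD('a))"
  proof (rule ccontr)
    assume "\<not> 0 < ln (real CARD('a))"
    moreover have "0 \<le> ln (real CARD('a))" by simp
    ultimately have zero: "ln (real CARD('a)) = 0" by linarith
    have "\<forall>\<^sub>F n in sequentially. 1 \<le> k n" using assms(3) by (simp add: filterlim_at_top)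
    with assms(6) have "\<forall>\<^sub>F n::nat in sequentially. False"
      unfolding zero by eventually_elim simp
    then show False by simp
  qed
  have mean: "cond_empirical_entropy (k n) x \<le> empirical_entropy (k n) x / real (k n)"
    if "1 \<le> n" "x \<in> strings n" for n and x :: "'a list"
  proof -
    have "x \<noteq> []" using that by (auto simp: strings_def)
    then show ?thesis
      using cond_block_entropy_le_mean[OF stationary_empirical, of x "k n"] assms(2) that
      by (simp add: cond_empirical_entropy_eq empirical_entropy_def)
  qed
  note ldp = large_deviation_principle_sandwiched[OF \<rho> pos L card assms(3,4,6)]
  show ?thesis
    by (intro conjI ereal_convex_rate_function[OF \<rho> pos L] ldp eventually_sequentiallyI[of 1]) (auto intro: mean)
qed


end
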